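(* The function $d_{\mathcal M_{p,k}}:\mathcal M_{p,k}\times\mathcal M_{p,k}\to\mathbb R^+$ defined, for $\theta=\pi(U,\Sigma)$ and $\hat\theta=\pi(\hat U,\hat\Sigma)$, as $$d_{\mathcal M_{p,k}}(\theta,\hat\theta)=\alpha\big\|\log(\Sigma^{-1/2}O\hat O^H\hat\Sigma\hat OO^H\Sigma^{-1/2})\big\|_F^2+\beta\big(\log\det(\Sigma^{-1}O\hat O^H\hat\Sigma\hat OO^H)\big)^2+\|\Theta\|_F^2,$$ where $O$, $\hat O$ and $\Theta$ correspond to the singular value decomposition $U^H\hat U=O\cos(\Theta)\hat O^H$, is a symmetric divergence function on $\mathcal M_{p,k}$, i.e. $d_{\mathcal M_{p,k}}(\theta,\hat\theta)\ge0$ with equality if and only if $\theta=\hat\theta$, and $d_{\mathcal M_{p,k}}(\theta,\hat\theta)=d_{\mathcal M_{p,k}}(\hat\theta,\theta)$. It is obtained by measuring the squared length, according to the metric on $\mathcal M_{p,k}$ induced by $\langle\cdot,\cdot\rangle$, of the curve $\widetilde\gamma(t)=\pi(\widetilde U(t),\widetilde\Sigma(t))$, where $(\widetilde U(t),\widetilde\Sigma(t))$ is the geodesic on $\overline{\mathcal M}_{p,k}$ defined as $$\widetilde U(t)=UO\cos(t\Theta)O^H+(I_p-UU^H)\hat U\hat O(\sin(\Theta))^{\dagger}\sin(t\Theta)O^H,$$ $$\widetilde\Sigma(t)=\Sigma^{1/2}\big(\Sigma^{-1/2}O\hat O^H\hat\Sigma\hat OO^H\Sigma^{-1/2}\bi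g)^t\Sigma^{1/2}.$$
   Context: Let $1\le k<p$ be integers. $\mathrm{St}_{p,k}=\{U\in\mathbb C^{p\times k}:U^HU=I_k\}$, $\mathcal H_k$ is the space of $k\times k$ Hermitian matrices, $\mathcal H_k^{++}$ the manifold of Hermitian positive definite $k\times k$ matrices, $\mathcal U_k$ the unitary group. Let $\overline{\mathcal M}_{p,k}=\mathrm{St}_{p,k}\times\mathcal H_k^{++}$, with tangent space at $\bar\theta=(U,\Sigma)$ $$T_{\bar\theta}\overline{\mathcal M}_{p,k}=\{(\xi_U,\xi_\Sigma)\in\mathbb C^{p\times k}\times\mathcal H_k:\ U^H\xi_U+\xi_U^HU=0\}.$$ For $\alpha>0$ and $\beta>-\alpha/k$, equip it with the Riemannian metric $$\langle\bar\xi,\bar\eta\rangle_{\bar\theta}=\mathrm{Re}\,\mathrm{tr}\big(\xi_U^H(I_p-\tfrac12UU^H)\eta_U\big)+\alpha\,\mathrm{tr}(\Sigma^{-1}\xi_\Sigma\Sigma^{-1}\eta_\Sigma)+\beta\,\mathrm{tr}(\Sigma^{-1}\xi_\Sigma)\,\mathrm{tr}(\Sigma^{-1}\eta_\Sigma).$$ $\mathcal M_{p,k}$ is the quotient of $\overline{\mathcal M}_{p,k}$ by the (isometric) action $(U,\Sigma)\mapsto(UO,O^H\Sigma O)$ of $O\in\mathcal U_k$, $\pi$ is the quotient map, and the induced metric on $\mathcal M_{p,k}$ is the one making $\pi$ a Riemannian submersion. In the singular value decomposition, $O,\hat O\in\mathcal U_k$ and $\Theta$ is the diagonal matrix of principal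 angles (entries in $[0,\pi/2]$). $\log$ is the matrix logarithm, $\|\cdot\|_F$ the Frobenius norm, $A^\dagger$ the Moore–Penrose pseudo-inverse, $A^t=\exp(t\log A)$ the matrix power, and $\cos$, $\sin$ of a diagonal matrix act entrywise on the diagonal.
   Formalization: The squared length of γ̃ in M is only ≤ d, with equality iff the lifted geodesic is horizontal; the lift's squared length equals d. Where U^H Û is singular, d depends on the SVD, so any choice is allowed, with the conjugate-transposed SVD for the swapped pair. *)

theory Defs
  imports "HOL-Analysis.Analysis"
begin

section \<open>Complex matrices\<close>

definition ctranspose :: "complex^'n^'m \<Rightarrow> complex^'m^'n"  ("_\<^sup>H" [1000] 1000) where
  "A\<^sup>H = (\<chi> i j. cnj (A $ j $ i))"

definition hermitian :: "complex^'n^'n \<Rightarrow> bool" where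
  "hermitian A \<longleftrightarrow> A\<^sup>H = A"

definition hpd :: "complex^'n^'n \<Rightarrow> bool" where
  "hpd A \<longleftrightarrow> hermitian A \<and>
     (\<forall>x. x \<noteq> 0 \<longrightarrow> 0 < Re (\<Sum>i\<in>UNIV. cnj (x $ i) * (A *v x) $ i))"

definition unitary :: "complex^'n^'n \<Rightarrow> bool" where
  "unitary A \<longleftrightarrow> A\<^sup>H ** A = mat 1 \<and> A ** A\<^sup>H = mat 1"

text \<open>
  Multiplication and \<^const>\<open>exp\<close> are not instantiated to the matrix product on this type, hence the
  explicit exponential series.
\<close>

definition mexp :: "complex^'n^'n \<Rightarrow> complex^'n^'n" where
  "mexp A = (\<Sum>n. (1 / fact n) *\<^sub>R (((\<lambda>B. A ** B) ^^ n) (mat 1)))"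

text \<open>
  The logarithm is only applied to Hermitian positive definite matrices; there the principal
  logarithm is the unique Hermitian one.
\<close>

definition mlog :: "complex^'n^'n \<Rightarrow> complex^'n^'n" where
  "mlog A = (THE L. hermitian L \<and> mexp L = A)"

definition mpow :: "complex^'n^'n \<Rightarrow> real \<Rightarrow> complex^'n^'n" where
  "mpow A t = mexp (t *\<^sub>R mlog A)"

text \<open>The Moore--Penrose pseudo-inverse, by the four Penrose equations.\<close>

definition pinv :: "complex^'n^'m \<Rightarrow> complex^'m^'n" where
  "pinv A = (THE X. A ** X ** A = A \<and> X ** A ** X = X \<and>
                    (A ** X)\<^sup>H = A ** X \<and> (X ** A)\<^sup>H = X ** A)"

text \<open>Entrywise action on the diagonal; off-diagonal entries stay zero even if \<open>f 0 \<noteq> 0\<close>.\<close>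

definition diag_apply :: "(complex \<Rightarrow> complex) \<Rightarrow> complex^'n^'n \<Rightarrow> complex^'n^'n" where
  "diag_apply f D = (\<chi> i j. if i = j then f (D $ i $ i) else 0)"

definition angle_matrix :: "complex^'n^'n \<Rightarrow> bool" where
  "angle_matrix \<Theta> \<longleftrightarrow>
     (\<forall>i. \<Theta> $ i $ i \<in> complex_of_real ` {0..pi / 2}) \<and> (\<forall>i j. i \<noteq> j \<longrightarrow> \<Theta> $ i $ j = 0)"

definition cos_svd ::
  "complex^'n^'n \<Rightarrow> complex^'n^'n \<Rightarrow> complex^'n^'n \<Rightarrow> complex^'n^'n \<Rightarrow> bool" where
  "cos_svd A Q \<Theta> Q' \<longleftrightarrow>
     unitary Q \<and> unitary Q' \<and> angle_matrix \<Theta> \<and> A = Q ** diag_apply cos \<Theta> ** Q'\<^sup>H"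


section \<open>Curves in a submanifold of a normed space with a Riemannian metric\<close>

text \<open>
  A metric is a map \<open>g\<close> with \<open>g x \<xi> \<eta>\<close> the inner product at \<open>x\<close>; only its values on tangent vectors
  matter. All curves are parametrized by \<open>{0..1}\<close>.
\<close>

definition velocity :: "(real \<Rightarrow> 'a::real_normed_vector) \<Rightarrow> real \<Rightarrow> 'a" where
  "velocity c t = vector_derivative c (at t within {0..1})"

definition curve_length ::
  "('a::real_normed_vector \<Rightarrow> 'a \<Rightarrow> 'a \<Rightarrow> real) \<Rightarrow> (real \<Rightarrow> 'a) \<Rightarrow> real" where
  "curve_length g c = integral {0..1} (\<lambda>t. sqrt (g (c t) (velocity c t) (velocity c t)))"

definition curve_energy ::
  "('a::real_normed_vector \<Rightarrow> 'a \<Rightarrow> 'a \<Rightarrow> real) \<Rightarrow> (real \<Rightarrow> 'a) \<Rightarrow> real" where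
  "curve_energy g c = 1 / 2 * integral {0..1} (\<lambda>t. g (c t) (velocity c t) (velocity c t))"

text \<open>
  Variations of \<open>c\<close> within \<open>S\<close> with fixed endpoints. The regularity required is implied by
  joint \<open>C\<^sup>2\<close>-smoothness.
\<close>

definition proper_variation ::
  "'a::real_normed_vector set \<Rightarrow> (real \<Rightarrow> 'a) \<Rightarrow> (real \<Rightarrow> real \<Rightarrow> 'a) \<Rightarrow> bool" where
  "proper_variation S c F \<longleftrightarrow>
     (\<exists>\<epsilon>>0. \<exists>Fs Ft Fst.
        (\<forall>s\<in>{-\<epsilon><..<\<epsilon>}. \<forall>t\<in>{0..1}.
            F s t \<in> S \<and>
            ((\<lambda>s. F s t) has_vector_derivative Fs s t) (at s) \<and>
            (F s has_vector_derivative Ft s t) (at t within {0..1}) \<and>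
            ((\<lambda>s. Ft s t) has_vector_derivative Fst s t) (at s) \<and>
            (Fs s has_vector_derivative Fst s t) (at t within {0..1})) \<and>
        continuous_on ({-\<epsilon><..<\<epsilon>} \<times> {0..1}) (\<lambda>(s, t). Fs s t) \<and>
        continuous_on ({-\<epsilon><..<\<epsilon>} \<times> {0..1}) (\<lambda>(s, t). Ft s t) \<and>
        continuous_on ({-\<epsilon><..<\<epsilon>} \<times> {0..1}) (\<lambda>(s, t). Fst s t) \<and>
        (\<forall>t\<in>{0..1}. F 0 t = c t) \<and>
        (\<forall>s\<in>{-\<epsilon><..<\<epsilon>}. F s 0 = c 0 \<and> F s 1 = c 1))"

text \<open>
  Geodesics as critical points of the energy functional. This agrees with vanishing covariant
  acceleration for the Levi-Civita connection but needs no connection.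
\<close>

definition geodesic ::
  "'a::real_normed_vector set \<Rightarrow> ('a \<Rightarrow> 'a \<Rightarrow> 'a \<Rightarrow> real) \<Rightarrow> (real \<Rightarrow> 'a) \<Rightarrow> bool" where
  "geodesic S g c \<longleftrightarrow>
     (\<forall>t\<in>{0..1}. c t \<in> S) \<and>
     (\<forall>t\<in>{0..1}. (c has_vector_derivative velocity c t) (at t within {0..1})) \<and>
     continuous_on {0..1} (velocity c) \<and>
     (\<forall>F. proper_variation S c F \<longrightarrow>
        ((\<lambda>s. curve_energy g (F s)) has_real_derivative 0) (at 0))"

definition tangent_vectors :: "'a::real_normed_vector set \<Rightarrow> 'a \<Rightarrow> 'a set" where
  "tangent_vectors S x =
     {v. \<exists>c. (\<forall>t. c t \<in> S) \<and> c 0 = x \<and> (c has_vector_derivative v) (at 0)}"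


section \<open>The total space and its quotient\<close>

type_synonym ('p, 'k) point = "((complex, 'k) vec, 'p) vec \<times> ((complex, 'k) vec, 'k) vec"

definition total_space :: "('p::finite, 'k::finite) point set" where
  "total_space = {(U, \<Sigma>). U\<^sup>H ** U = mat 1 \<and> hpd \<Sigma>}"

definition total_tangent :: "('p::finite, 'k::finite) point \<Rightarrow> ('p, 'k) point set" where
  "total_tangent = (\<lambda>(U, \<Sigma>).
     {(\<xi>U, \<xi>\<Sigma>). hermitian \<xi>\<Sigma> \<and> U\<^sup>H ** \<xi>U + \<xi>U\<^sup>H ** U = 0})"

text \<open>The two traces involving \<open>\<Sigma>\<close> are real on tangent vectors, so \<^const>\<open>Re\<close> is only a coercion there.\<close>

definition riem_metric ::
  "real \<Rightarrow> real \<Rightarrow> ('p::finite, 'k::finite) point \<Rightarrow> ('p, 'k) point \<Rightarrow> ('p, 'k) point \<Rightarrow> real" where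
  "riem_metric \<alpha> \<beta> = (\<lambda>(U, \<Sigma>) (\<xi>U, \<xi>\<Sigma>) (\<eta>U, \<eta>\<Sigma>).
     Re (trace (\<xi>U\<^sup>H ** (mat 1 - (1 / 2) *\<^sub>R (U ** U\<^sup>H)) ** \<eta>U))
     + \<alpha> * Re (trace (matrix_inv \<Sigma> ** \<xi>\<Sigma> ** matrix_inv \<Sigma> ** \<eta>\<Sigma>))
     + \<beta> * Re (trace (matrix_inv \<Sigma> ** \<xi>\<Sigma>)) * Re (trace (matrix_inv \<Sigma> ** \<eta>\<Sigma>)))"

text \<open>A point of the quotient is an orbit; in particular it is also the fibre over itself.\<close>

definition quot_proj :: "('p::finite, 'k::finite) point \<Rightarrow> ('p, 'k) point set" where
  "quot_proj = (\<lambda>(U, \<Sigma>). {(U ** Q, Q\<^sup>H ** \<Sigma> ** Q) | Q. unitary Q})"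

definition quot_manifold :: "('p::finite, 'k::finite) point set set" where
  "quot_manifold = quot_proj ` total_space"

definition vertical :: "('p::finite, 'k::finite) point \<Rightarrow> ('p, 'k) point set" where
  "vertical x = tangent_vectors (quot_proj x) x"

definition horizontal ::
  "real \<Rightarrow> real \<Rightarrow> ('p::finite, 'k::finite) point \<Rightarrow> ('p, 'k) point set" where
  "horizontal \<alpha> \<beta> x = {\<xi> \<in> total_tangent x. \<forall>v\<in>vertical x. riem_metric \<alpha> \<beta> x \<xi> v = 0}"

definition horizontal_part ::
  "real \<Rightarrow> real \<Rightarrow> ('p::finite, 'k::finite) point \<Rightarrow> ('p, 'k) point \<Rightarrow> ('p, 'k) point" where
  "horizontal_part \<alpha> \<beta> x \<xi> = (THE \<eta>. \<eta> \<in> horizontal \<alpha> \<beta> x \<and> \<xi> - \<eta> \<in> vertical x)"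

text \<open>
  The quotient metric making the projection a Riemannian submersion, evaluated on the images under
  the differential of the projection at \<open>x\<close> of the tangent vectors \<open>\<xi>\<close> and \<open>\<eta>\<close>.
\<close>

definition quot_metric ::
  "real \<Rightarrow> real \<Rightarrow> ('p::finite, 'k::finite) point \<Rightarrow> ('p, 'k) point \<Rightarrow> ('p, 'k) point \<Rightarrow> real" where
  "quot_metric \<alpha> \<beta> x \<xi> \<eta> =
     riem_metric \<alpha> \<beta> x (horizontal_part \<alpha> \<beta> x \<xi>) (horizontal_part \<alpha> \<beta> x \<eta>)"

text \<open>
  The speed of a curve \<open>\<gamma>\<close> of orbits is read off from any lift that is differentiable at the given
  time; two such lifts have velocities with the same image in the quotient.
\<close>

definition quot_speed ::
  "real \<Rightarrow> real \<Rightarrow> (real \<Rightarrow> ('p::finite, 'k::finite) point set) \<Rightarrow> real \<Rightarrow> real" where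
  "quot_speed \<alpha> \<beta> \<gamma> t =
     (THE r. \<exists>c v. (\<forall>\<tau>\<in>{0..1}. c \<tau> \<in> total_space \<and> quot_proj (c \<tau>) = \<gamma> \<tau>) \<and>
                   (c has_vector_derivative v) (at t within {0..1}) \<and>
                   r = sqrt (quot_metric \<alpha> \<beta> (c t) v v))"

text \<open>
  This is the length of a lift only if the lift is horizontal; otherwise it is strictly smaller for a
  differentiable lift whose vertical velocity does not vanish almost everywhere.
\<close>

definition quot_length ::
  "real \<Rightarrow> real \<Rightarrow> (real \<Rightarrow> ('p::finite, 'k::finite) point set) \<Rightarrow> real" where
  "quot_length \<alpha> \<beta> \<gamma> = integral {0..1} (quot_speed \<alpha> \<beta> \<gamma>)"


section \<open>The divergence\<close>

text \<open>The norm of the type is the Frobenius norm. The determinant is real and positive.\<close>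

definition div_formula ::
  "real \<Rightarrow> real \<Rightarrow> complex^'k^'k \<Rightarrow> complex^'k^'k \<Rightarrow>
   complex^'k^'k \<Rightarrow> complex^'k^'k \<Rightarrow> complex^'k^'k \<Rightarrow> real" where
  "div_formula \<alpha> \<beta> \<Sigma> \<Sigma>' Q \<Theta> Q' =
     \<alpha> * (norm (mlog (mpow \<Sigma> (-1/2) ** Q ** Q'\<^sup>H ** \<Sigma>' ** Q' ** Q\<^sup>H ** mpow \<Sigma> (-1/2))))\<^sup>2
     + \<beta> * (ln (Re (det (matrix_inv \<Sigma> ** Q ** Q'\<^sup>H ** \<Sigma>' ** Q' ** Q\<^sup>H))))\<^sup>2
     + (norm \<Theta>)\<^sup>2"

text \<open>
  If \<open>U\<^sup>H ** U'\<close> is singular, its polar factor \<open>Q ** Q'\<^sup>H\<close>, and with it the formula, depends on the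
  chosen singular value decomposition. A divergence is therefore a function on the quotient given by
  some choice of representatives and decompositions, where the decomposition used for the
  swapped pair is the conjugate transpose \<open>Q' ** diag_apply cos \<Theta> ** Q\<^sup>H\<close> of the original one.
\<close>

definition svd_divergence ::
  "real \<Rightarrow> real \<Rightarrow> (('p::finite, 'k::finite) point set \<Rightarrow> ('p, 'k) point set \<Rightarrow> real) \<Rightarrow> bool" where
  "svd_divergence \<alpha> \<beta> d \<longleftrightarrow>
     (\<forall>\<theta>\<in>quot_manifold. \<forall>\<theta>'\<in>quot_manifold. \<exists>U \<Sigma> U' \<Sigma>' Q \<Theta> Q'.
        (U, \<Sigma>) \<in> total_space \<and> quot_proj (U, \<Sigma>) = \<theta> \<and>
        (U', \<Sigma>') \<in> total_space \<and> quot_proj (U', \<Sigma>') = \<theta>' \<and>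
        cos_svd (U\<^sup>H ** U') Q \<Theta> Q' \<and>
        d \<theta> \<theta>' = div_formula \<alpha> \<beta> \<Sigma> \<Sigma>' Q \<Theta> Q' \<and>
        d \<theta>' \<theta> = div_formula \<alpha> \<beta> \<Sigma>' \<Sigma> Q' \<Theta> Q)"

definition symmetric_divergence_on :: "'a set \<Rightarrow> ('a \<Rightarrow> 'a \<Rightarrow> real) \<Rightarrow> bool" where
  "symmetric_divergence_on S d \<longleftrightarrow>
     (\<forall>x\<in>S. \<forall>y\<in>S. 0 \<le> d x y \<and> (d x y = 0 \<longleftrightarrow> x = y) \<and> d x y = d y x)"

definition geo_U ::
  "complex^'k^'p \<Rightarrow> complex^'k^'p \<Rightarrow> complex^'k^'k \<Rightarrow> complex^'k^'k \<Rightarrow> complex^'k^'k \<Rightarrow>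
   real \<Rightarrow> complex^'k^'p" where
  "geo_U U U' Q \<Theta> Q' t =
     U ** Q ** diag_apply cos (t *\<^sub>R \<Theta>) ** Q\<^sup>H
     + (mat 1 - U ** U\<^sup>H) ** U' ** Q' ** pinv (diag_apply sin \<Theta>) ** diag_apply sin (t *\<^sub>R \<Theta>) ** Q\<^sup>H"

definition geo_\<Sigma> ::
  "complex^'k^'k \<Rightarrow> complex^'k^'k \<Rightarrow> complex^'k^'k \<Rightarrow> complex^'k^'k \<Rightarrow> real \<Rightarrow> complex^'k^'k" where
  "geo_\<Sigma> \<Sigma> \<Sigma>' Q Q' t =
     mpow \<Sigma> (1/2)
     ** mpow (mpow \<Sigma> (-1/2) ** Q ** Q'\<^sup>H ** \<Sigma>' ** Q' ** Q\<^sup>H ** mpow \<Sigma> (-1/2)) t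
     ** mpow \<Sigma> (1/2)"

definition geo_lift ::
  "complex^'k^'p \<Rightarrow> complex^'k^'k \<Rightarrow> complex^'k^'p \<Rightarrow> complex^'k^'k \<Rightarrow>
   complex^'k^'k \<Rightarrow> complex^'k^'k \<Rightarrow> complex^'k^'k \<Rightarrow> real \<Rightarrow> ('p::finite, 'k::finite) point" where
  "geo_lift U \<Sigma> U' \<Sigma>' Q \<Theta> Q' t = (geo_U U U' Q \<Theta> Q' t, geo_\<Sigma> \<Sigma> \<Sigma>' Q Q' t)"

end

theory Submission
  imports Defs
begin

text \<open>
  The matrix logarithm in the divergence is that of \<open>Z ** Z\<^sup>H\<close> with
  \<open>Z = \<Sigma>\<^sup>-\<^sup>1\<^sup>/\<^sup>2 Q Q'\<^sup>H \<Sigma>'\<^sup>1\<^sup>/\<^sup>2\<close>. Exchanging the two points replaces \<open>Z\<close> by \<open>Z\<^sup>-\<^sup>1\<close>, hence the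
  logarithm by a unitary conjugate of its negative, which gives symmetry. Definiteness follows from
  \<open>(tr L)\<^sup>2 \<le> k \<parallel>L\<parallel>\<^sup>2\<close>. For the lifted curve \<open>(V, S)\<close> one has \<open>V\<^sup>H V' = 0\<close>, \<open>V'' = - V H\<close> with \<open>H\<close>
  Hermitian, and \<open>S' = S B\<close> with \<open>B\<close> constant. This makes the first variation of the energy the integral
  of the derivative of a function that vanishes at the endpoints, and makes the speed constant.
  The speed of the projected curve is that of the horizontal part of the velocity. It depends
  continuously on time, so its length is maximal exactly if the velocity is horizontal throughout.
\<close>

text \<open>The divergence is not a single formula. If \<open>U\<^sup>H ** U'\<close> is singular,
  the value can depend on the decomposition, so \<open>d\<close> selects one of several values.
  Definiteness survives because a zero value leaves no ambiguity: it forces \<Theta> = 0, and then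
  \<open>U\<^sup>H ** U'\<close> is the unitary matrix \<open>Q ** Q'\<^sup>H\<close> itself.
  Symmetry survives because the two orders of the points have the same set of possible values.

  The lift is a geodesic of the total space, but in general it is not horizontal. As
  \<open>(V t)\<^sup>H ** V1 t = 0\<close>, the Stiefel part of the velocity is orthogonal to all
  vertical vectors, and what remains is the condition that \<open>B\<close> is Hermitian. This holds
  exactly if \<Sigma> commutes with \<open>Q ** Q'\<^sup>H ** \<Sigma>' ** Q' ** Q\<^sup>H\<close>;
  otherwise the projected curve is strictly shorter than the lift.

  Logarithms, powers and principal angles rest on the spectral theorem and the singular value
  decomposition, both obtained by maximising a trace over the compact unitary group.\<close>

section \<open>Matrix algebra\<close>

text \<open>Distributivity, limits, continuity and the product rule for \<open>**\<close> are all
  instances of general facts on bounded bilinear maps; this lemma supplies them.\<close>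

lemma bounded_bilinear_matrix_mult:
  "bounded_bilinear (\<lambda>(A::complex^'n^'m) (B::complex^'k^'n). A ** B)"
proof -
  have "bilinear (\<lambda>(A::complex^'n^'m) (B::complex^'k^'n). A ** B)"
    unfolding bilinear_def
    by (auto intro!: linearI simp: matrix_add_ldistrib matrix_matrix_mult_def vec_eq_iff
        sum.distrib scaleR_sum_right algebra_simps)
  then show ?thesis by (simp add: bilinear_conv_bounded_bilinear)
qed


lemma bounded_linear_ctranspose: "bounded_linear (ctranspose :: complex^'n^'m \<Rightarrow> _)"
proof -
  have "linear (ctranspose :: complex^'n^'m \<Rightarrow> _)"
    by (auto intro!: linearI simp: ctranspose_def vec_eq_iff)
  then show ?thesis by (simp add: linear_conv_bounded_linear)
qed

lemma ctranspose_linear: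
  "(A + B)\<^sup>H = A\<^sup>H + B\<^sup>H" "(A - B)\<^sup>H = A\<^sup>H - B\<^sup>H" "(- A)\<^sup>H = - A\<^sup>H"
  "(r *\<^sub>R A)\<^sup>H = r *\<^sub>R A\<^sup>H" "0\<^sup>H = 0"
  by (simp_all add: ctranspose_def vec_eq_iff)

lemma bounded_linear_trace: "bounded_linear (trace :: complex^'n^'n \<Rightarrow> _)"
proof -
  have "linear (trace :: complex^'n^'n \<Rightarrow> _)"
    by (auto intro!: linearI simp: trace_def sum.distrib scaleR_sum_right)
  then show ?thesis by (simp add: linear_conv_bounded_linear)
qed

lemma trace_linear:
  fixes A B :: "complex^'n^'n"
  shows "trace (A + B) = trace A + trace B" "trace (A - B) = trace A - trace B"
    "trace (- A) = - trace A" "trace (r *\<^sub>R A) = r *\<^sub>R trace A" "trace (0 :: complex^'n^'n) = 0"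
  by (simp_all add: trace_def sum.distrib sum_subtractf sum_negf scaleR_sum_right)

lemma ctranspose_ctranspose [simp]: "(A\<^sup>H)\<^sup>H = A"
  by (simp add: ctranspose_def vec_eq_iff)

lemma ctranspose_mult: "(A ** B)\<^sup>H = B\<^sup>H ** A\<^sup>H"
  by (simp add: ctranspose_def vec_eq_iff matrix_matrix_mult_def mult.commute)

lemma ctranspose_mat_1 [simp]: "(mat 1)\<^sup>H = mat 1"
  by (auto simp: ctranspose_def vec_eq_iff mat_def)

lemma ctranspose_nth [simp]: "A\<^sup>H $ i $ j = cnj (A $ j $ i)"
  by (simp add: ctranspose_def)

lemma trace_ctranspose: "trace (A\<^sup>H) = cnj (trace A)"
  by (simp add: trace_def)

text \<open>The bridge between traces and the Euclidean structure of the type: \<open>inner\<close>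
  is the real Frobenius product, so \<open>norm\<close> is the Frobenius norm.\<close>

lemma Re_trace_ctranspose_mult: "Re (trace (A\<^sup>H ** B)) = inner A B"
proof -
  have "Re (trace (A\<^sup>H ** B)) = (\<Sum>j\<in>UNIV. \<Sum>i\<in>UNIV. inner (A $ i $ j) (B $ i $ j))"
    by (simp add: trace_def matrix_matrix_mult_def inner_complex_def)
  also have "\<dots> = inner A B"
    by (subst sum.swap) (simp add: inner_vec_def)
  finally show ?thesis .
qed

lemmas matrix_assoc = matrix_mul_assoc[symmetric]

lemmas matrix_ring =
  bounded_bilinear.add_left [OF bounded_bilinear_matrix_mult]
  bounded_bilinear.add_right [OF bounded_bilinear_matrix_mult]
  bounded_bilinear.diff_left [OF bounded_bilinear_matrix_mult]
  bounded_bilinear.diff_right [OF bounded_bilinear_matrix_mult]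
  bounded_bilinear.minus_left [OF bounded_bilinear_matrix_mult]
  bounded_bilinear.minus_right [OF bounded_bilinear_matrix_mult]
  bounded_bilinear.scaleR_left [OF bounded_bilinear_matrix_mult]
  bounded_bilinear.scaleR_right [OF bounded_bilinear_matrix_mult]
  bounded_bilinear.zero_left [OF bounded_bilinear_matrix_mult]
  bounded_bilinear.zero_right [OF bounded_bilinear_matrix_mult]

lemmas matrix_scaleR =
  bounded_bilinear.scaleR_left [OF bounded_bilinear_matrix_mult]
  bounded_bilinear.scaleR_right [OF bounded_bilinear_matrix_mult]

lemmas ctranspose_simps = ctranspose_mult ctranspose_linear

text \<open>Products are normalised to right-nested form, where the two factors that cancel are
  followed by a further factor \<open>X\<close>.\<close>

lemma inverse_cancel: "A ** B = mat 1 \<Longrightarrow> A ** (B ** X) = X" 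
  for A :: "complex^'n^'m"
  by (simp add: matrix_mul_assoc)

lemma unitary_mult_left [simp]:
  assumes "unitary Q" shows "Q\<^sup>H ** Q = mat 1" "Q ** Q\<^sup>H = mat 1"
    "Q\<^sup>H ** (Q ** X) = X" "Q ** (Q\<^sup>H ** X) = X"
  using assms by (auto simp: unitary_def inverse_cancel)

lemma unitary_ctranspose [simp]: "unitary (Q\<^sup>H) \<longleftrightarrow> unitary Q"
  unfolding unitary_def ctranspose_ctranspose by (rule conj_commute)

lemma unitary_mult [simp]: "unitary Q \<Longrightarrow> unitary R \<Longrightarrow> unitary (Q ** R)"
  unfolding unitary_def[of "Q ** R"] by (simp add: ctranspose_mult matrix_assoc)

lemma unitary_mat_1 [simp]: "unitary (mat 1)"
  unfolding unitary_def ctranspose_mat_1 matrix_mul_lid by simp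

lemma unitaryI: "Q\<^sup>H ** Q = mat 1 \<Longrightarrow> unitary Q"
  unfolding unitary_def using matrix_left_right_inverse by blast

lemma hermitian_conj: "hermitian A \<Longrightarrow> hermitian (Q\<^sup>H ** A ** Q)"
  by (simp add: hermitian_def ctranspose_mult matrix_assoc)

lemma inner_matrix_mult_left: "inner (A ** X) Y = inner X (A\<^sup>H ** Y)"
  by (simp add: Re_trace_ctranspose_mult[symmetric] ctranspose_mult matrix_assoc)

lemma inner_matrix_mult_right: "inner (X ** A) Y = inner X (Y ** A\<^sup>H)"
  using trace_mul_sym[of "A\<^sup>H" "X\<^sup>H ** Y"]
  by (simp add: Re_trace_ctranspose_mult[symmetric] ctranspose_mult matrix_assoc)

lemma inner_ctranspose: "inner (A\<^sup>H) (B\<^sup>H) = inner A B"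
  using trace_ctranspose[of "B ** A\<^sup>H"] trace_mul_sym[of A "B\<^sup>H"] trace_mul_sym[of "A\<^sup>H" B]
  by (metis Re_trace_ctranspose_mult ctranspose_ctranspose ctranspose_mult inner_commute)

lemma norm_unitary_mult:
  assumes "unitary Q"
  shows "norm (Q ** X) = norm X" "norm (Y ** Q) = norm Y"
proof -
  show "norm (Q ** X) = norm X"
    using assms by (simp add: norm_eq_sqrt_inner inner_matrix_mult_left)
  show "norm (Y ** Q) = norm Y"
    using assms by (simp add: norm_eq_sqrt_inner inner_matrix_mult_right matrix_assoc)
qed

lemma trace_unitary_conj: "unitary Q \<Longrightarrow> trace (Q ** (A ** Q\<^sup>H)) = trace A"
  by (subst trace_mul_sym) (simp add: matrix_assoc)

section \<open>Diagonal matrices\<close>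

definition dg :: "('n \<Rightarrow> complex) \<Rightarrow> complex^'n^'n" where
  "dg f = (\<chi> i j. if i = j then f i else 0)"

abbreviation rdg :: "('n \<Rightarrow> real) \<Rightarrow> complex^'n^'n" where
  "rdg f \<equiv> dg (\<lambda>i. complex_of_real (f i))"

lemma dg_nth: "dg f $ i $ j = (if i = j then f i else 0)"
  by (simp add: dg_def)

lemma dg_mult_nth: "(dg f ** X) $ i $ j = f i * X $ i $ j"
  by (simp add: matrix_matrix_mult_def dg_nth if_distrib[of "\<lambda>x. x * _"] cong: if_cong)

lemma mult_dg_nth: "(X ** dg f) $ i $ j = X $ i $ j * f j"
  by (simp add: matrix_matrix_mult_def dg_nth if_distrib[of "\<lambda>x. _ * x"] cong: if_cong)

lemma dg_mult [simp]: "dg f ** dg g = dg (\<lambda>i. f i * g i)"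
  by (auto simp: vec_eq_iff dg_mult_nth dg_nth)

lemma dg_mult' [simp]: "dg f ** (dg g ** X) = dg (\<lambda>i. f i * g i) ** X"
  by (simp add: matrix_mul_assoc)

lemma dg_1 [simp]: "dg (\<lambda>i. 1) = mat 1"
  by (auto simp: vec_eq_iff dg_nth mat_def)

lemma ctranspose_dg [simp]: "(dg f)\<^sup>H = dg (\<lambda>i. cnj (f i))"
  by (auto simp: vec_eq_iff dg_nth)

lemma trace_dg: "trace (dg f) = (\<Sum>i\<in>UNIV. f i)"
  by (simp add: trace_def dg_nth)

lemma det_dg: "det (dg f) = (\<Prod>i\<in>UNIV. f i)"
  by (subst det_diagonal) (auto simp: dg_nth)

lemma dg_scaleR: "r *\<^sub>R dg f = dg (\<lambda>i. r *\<^sub>R f i)"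
  by (auto simp: vec_eq_iff dg_nth)

lemma dg_add: "dg f + dg g = dg (\<lambda>i. f i + g i)"
  by (auto simp: vec_eq_iff dg_nth)

lemma dg_eq_iff [simp]: "dg f = dg g \<longleftrightarrow> f = g"
  by (auto simp: vec_eq_iff dg_nth fun_eq_iff split: if_splits)

lemma norm_rdg: "(norm (rdg f))\<^sup>2 = (\<Sum>i\<in>UNIV. (f i)\<^sup>2)"
  by (simp add: power2_norm_eq_inner Re_trace_ctranspose_mult[symmetric] trace_dg)
     (simp add: power2_eq_square)

lemma unitary_dg: "(\<And>i. cmod (f i) = 1) \<Longrightarrow> unitary (dg f)"
  by (rule unitaryI) (simp add: complex_norm_square[symmetric] mult.commute)

text \<open>The (i, j) entry of the commutator is \<open>N $ i $ j\<close> times the difference of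
  the entries j and i of \<open>d\<close>, which is nonzero off the diagonal.\<close>

lemma commutes_dg_imp_diagonal:
  fixes N :: "complex^'n^'n"
  assumes "N ** rdg d = rdg d ** N" and "inj d"
  shows "N = dg (\<lambda>i. N $ i $ i)"
proof -
  have "N $ i $ j = 0" if "i \<noteq> j" for i j
  proof -
    have "(N ** rdg d) $ i $ j = (rdg d ** N) $ i $ j"
      using assms(1) by simp
    then have "N $ i $ j * (of_real (d j) - of_real (d i)) = 0"
      by (simp add: mult_dg_nth dg_mult_nth algebra_simps)
    then show ?thesis
      using assms(2) that by (auto dest: injD)
  qed
  then show ?thesis
    by (auto simp: vec_eq_iff dg_nth)
qed

text \<open>Entrywise, either \<open>X $ i $ j\<close> vanishes or \<open>d i = e j\<close>, and
  both alternatives are preserved by any \<open>f\<close>. No polynomial approximation of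
  \<open>f\<close> is involved.\<close>

lemma intertwine_fun:
  fixes X :: "complex^'n^'m"
  assumes "rdg d ** X = X ** rdg e"
  shows "rdg (\<lambda>i. f (d i)) ** X = X ** rdg (\<lambda>i. f (e i))"
proof -
  have "of_real (f (d i)) * X $ i $ j = X $ i $ j * of_real (f (e j))" for i j
  proof -
    have "(rdg d ** X) $ i $ j = (X ** rdg e) $ i $ j"
      using assms by simp
    then have "X $ i $ j = 0 \<or> d i = e j"
      by (simp add: mult_dg_nth dg_mult_nth)
    then show ?thesis by auto
  qed
  then show ?thesis
    by (simp add: vec_eq_iff mult_dg_nth dg_mult_nth)
qed

lemma spectral_intertwine_fun:
  fixes X :: "complex^'n^'m"
  assumes "unitary Q" "unitary R"
    and "Q ** rdg d ** Q\<^sup>H ** X = X ** (R ** rdg e ** R\<^sup>H)"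
  shows "Q ** rdg (\<lambda>i. f (d i)) ** Q\<^sup>H ** X = X ** (R ** rdg (\<lambda>i. f (e i)) ** R\<^sup>H)"
proof -
  have "rdg d ** (Q\<^sup>H ** X ** R) = (Q\<^sup>H ** X ** R) ** rdg e"
    using arg_cong[OF assms(3), of "\<lambda>Z. Q\<^sup>H ** Z ** R"] assms(1,2) by (simp add: matrix_assoc)
  from arg_cong[OF intertwine_fun[OF this, of f], of "\<lambda>Z. Q ** Z ** R\<^sup>H"]
  show ?thesis
    using assms(1,2) by (simp add: matrix_assoc)
qed

section \<open>Inverses\<close>

lemma matrix_inv_mult:
  assumes "invertible A"
  shows "A ** matrix_inv A = mat 1" "matrix_inv A ** A = mat 1"
proof -
  have "A ** matrix_inv A = mat 1 \<and> matrix_inv A ** A = mat 1"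
    unfolding matrix_inv_def using assms unfolding invertible_def by (rule someI_ex)
  then show "A ** matrix_inv A = mat 1" "matrix_inv A ** A = mat 1" by auto
qed

lemma matrix_inv_cancel:
  assumes "invertible A"
  shows "A ** (matrix_inv A ** X) = X" "matrix_inv A ** (A ** Y) = Y"
  using matrix_inv_mult[OF assms] by (simp_all add: matrix_mul_assoc)

lemma matrix_inv_unique:
  fixes A B :: "complex^'n^'n"
  assumes "A ** B = mat 1"
  shows "matrix_inv A = B"
proof -
  have "invertible A"
    using assms invertible_right_inverse by blast
  then have "matrix_inv A ** (A ** B) = B"
    by (rule matrix_inv_cancel)
  then show ?thesis by (simp add: assms)
qed

lemma matrix_inv_commute:
  fixes A B :: "complex^'n^'n"
  assumes "invertible A" "A ** B = B ** A"
  shows "matrix_inv A ** B = B ** matrix_inv A"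
proof -
  have "matrix_inv A ** B = matrix_inv A ** (B ** A) ** matrix_inv A"
    by (simp add: matrix_assoc matrix_inv_mult[OF assms(1)])
  also have "\<dots> = B ** matrix_inv A"
    by (simp add: assms(2)[symmetric] matrix_assoc matrix_inv_cancel[OF assms(1)])
  finally show ?thesis .
qed

section \<open>Continuity and derivatives of matrix products and inverses\<close>

lemma matrix_mult_bound:
  obtains K where "K > 0" "\<And>(A::complex^'n^'m) (B::complex^'k^'n). norm (A ** B) \<le> norm A * norm B * K"
  using bounded_bilinear.pos_bounded[OF bounded_bilinear_matrix_mult] by metis

lemmas tendsto_matrix_mult [tendsto_intros] = bounded_bilinear.tendsto [OF bounded_bilinear_matrix_mult]
lemmas continuous_on_matrix_mult [continuous_intros] =
  bounded_bilinear.continuous_on [OF bounded_bilinear_matrix_mult]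
lemmas has_vector_derivative_matrix_mult [derivative_intros] =
  bounded_bilinear.has_vector_derivative [OF bounded_bilinear_matrix_mult]
lemmas has_vector_derivative_ctranspose [derivative_intros] =
  bounded_linear.has_vector_derivative [OF bounded_linear_ctranspose]
lemmas has_vector_derivative_trace [derivative_intros] =
  bounded_linear.has_vector_derivative [OF bounded_linear_trace]
lemmas continuous_on_ctranspose [continuous_intros] =
  bounded_linear.continuous_on [OF bounded_linear_ctranspose]
lemmas continuous_on_trace [continuous_intros] =
  bounded_linear.continuous_on [OF bounded_linear_trace]

text \<open>The resolvent identity. It yields both the continuity and the derivative of the
  inverse.\<close>

lemma matrix_inv_diff:
  fixes A B :: "complex^'n^'n"
  assumes "invertible A" "invertible B"
  shows "matrix_inv B - matrix_inv A = - (matrix_inv B ** ((B - A) ** matrix_inv A))"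
  by (simp add: matrix_ring matrix_inv_cancel[OF assms(2)] matrix_inv_mult[OF assms(1)])

lemma tendsto_matrix_inv:
  fixes f :: "'a \<Rightarrow> complex^'n^'n"
  assumes f: "(f \<longlongrightarrow> A) F" and A: "invertible A" and inv: "\<forall>\<^sub>F x in F. invertible (f x)"
  shows "((\<lambda>x. matrix_inv (f x)) \<longlongrightarrow> matrix_inv A) F"
proof -
  obtain K where K: "K > 0" "\<And>(A::complex^'n^'n) (B::complex^'n^'n). norm (A ** B) \<le> norm A * norm B * K"
    using matrix_mult_bound by blast
  let ?B = "matrix_inv A"
  have lim: "((\<lambda>x. norm (f x - A) * norm ?B * K\<^sup>2) \<longlongrightarrow> 0) F"
    using tendsto_mult[OF tendsto_norm_zero[OF LIM_zero[OF f]] tendsto_const[of "norm ?B * K\<^sup>2" F]]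
    by (simp add: mult.assoc)
  \<comment> \<open>Once the relative error is below 1/2, the unknown \<open>norm ?G\<close> on the
    right of the resolvent estimate can be absorbed on the left, which bounds it by
    \<open>2 * norm ?B\<close>.\<close>
  have small: "\<forall>\<^sub>F x in F. norm (f x - A) * norm ?B * K\<^sup>2 < 1 / 2"
    using order_tendstoD(2)[OF lim, of "1/2"] by simp
  have "\<forall>\<^sub>F x in F. norm (matrix_inv (f x) - ?B) \<le> 2 * norm ?B * (norm (f x - A) * norm ?B * K\<^sup>2)"
    using inv small
  proof eventually_elim
    case (elim x)
    let ?G = "matrix_inv (f x)" and ?e = "norm (f x - A) * norm ?B * K\<^sup>2"
    have "norm (?G - ?B) \<le> norm ?G * norm ((f x - A) ** ?B) * K"
      using K(2)[of ?G "(f x - A) ** ?B"] matrix_inv_diff[OF A elim(1)] by simp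
    also have "\<dots> \<le> norm ?G * (norm (f x - A) * norm ?B * K) * K"
      using K by (intro mult_right_mono mult_left_mono) auto
    finally have 1: "norm (?G - ?B) \<le> norm ?G * ?e"
      by (simp add: power2_eq_square mult_ac)
    have "norm ?G \<le> norm (?G - ?B) + norm ?B"
      using norm_triangle_ineq[of "?G - ?B" ?B] by simp
    also have "\<dots> \<le> norm ?G * (1/2) + norm ?B"
      using 1 elim(2) mult_left_mono[of ?e "1/2" "norm ?G"] by simp
    finally have "norm ?G \<le> 2 * norm ?B" by simp
    then have "norm ?G * ?e \<le> 2 * norm ?B * ?e"
      by (intro mult_right_mono) auto
    with 1 show ?case by simp
  qed
  moreover have "((\<lambda>x. 2 * norm ?B * (norm (f x - A) * norm ?B * K\<^sup>2)) \<longlongrightarrow> 0) F"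
    using tendsto_mult[OF tendsto_const[of "2 * norm ?B" F] lim] by simp
  ultimately show ?thesis
    by (rule LIM_zero_cancel[OF Lim_null_comparison])
qed

lemma continuous_on_matrix_inv [continuous_intros]:
  fixes f :: "'a::topological_space \<Rightarrow> complex^'n^'n"
  assumes "continuous_on S f" "\<And>x. x \<in> S \<Longrightarrow> invertible (f x)"
  shows "continuous_on S (\<lambda>x. matrix_inv (f x))"
  unfolding continuous_on_def
proof
  fix x assume "x \<in> S"
  then show "((\<lambda>x. matrix_inv (f x)) \<longlongrightarrow> matrix_inv (f x)) (at x within S)"
    using assms by (intro tendsto_matrix_inv)
      (auto simp: continuous_on_def eventually_at_topological)
qed

text \<open>With the derivative written as a limit of difference quotients, the resolvent identity
  divided by \<open>y - x\<close> gives the derivative of the inverse directly.\<close>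

lemma has_vector_derivative_iff_quotient:
  "(f has_vector_derivative D) (at x within S) \<longleftrightarrow>
   ((\<lambda>y. (f y - f x) /\<^sub>R (y - x)) \<longlongrightarrow> D) (at x within S)"
proof -
  have "norm ((f y - f x) - (y - x) *\<^sub>R D) / norm (y - x) = norm ((f y - f x) /\<^sub>R (y - x) - D)"
    if "y \<noteq> x" for y
  proof -
    have "(f y - f x) /\<^sub>R (y - x) - D = ((f y - f x) - (y - x) *\<^sub>R D) /\<^sub>R (y - x)"
      using that by (simp add: scaleR_diff_right)
    then show ?thesis
      by (simp add: divide_inverse_commute)
  qed
  then have "((\<lambda>y. norm ((f y - f x) - (y - x) *\<^sub>R D) / norm (y - x)) \<longlongrightarrow> 0) (at x within S) \<longleftrightarrow>
    ((\<lambda>y. norm ((f y - f x) /\<^sub>R (y - x) - D)) \<longlongrightarrow> 0) (at x within S)"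
    by (intro filterlim_cong) (auto simp: eventually_at_topological)
  then show ?thesis
    unfolding has_vector_derivative_def has_derivative_iff_norm
    by (simp add: bounded_linear_scaleR_left tendsto_norm_zero_iff LIM_zero_iff)
qed

lemma has_vector_derivative_matrix_inv:
  fixes f :: "real \<Rightarrow> complex^'n^'n"
  assumes f: "(f has_vector_derivative D) (at x within S)"
    and x: "invertible (f x)" and inv: "\<And>y. y \<in> S \<Longrightarrow> invertible (f y)"
  shows "((\<lambda>x. matrix_inv (f x)) has_vector_derivative - (matrix_inv (f x) ** (D ** matrix_inv (f x))))
    (at x within S)"
proof -
  have "((\<lambda>y. - (matrix_inv (f y) ** (((f y - f x) /\<^sub>R (y - x)) ** matrix_inv (f x)))) \<longlongrightarrow>
      - (matrix_inv (f x) ** (D ** matrix_inv (f x)))) (at x within S)"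
    using f has_vector_derivative_continuous[OF f] x inv
    by (intro tendsto_intros tendsto_matrix_inv)
       (auto simp: has_vector_derivative_iff_quotient continuous_within eventually_at_topological)
  moreover have "\<forall>\<^sub>F y in at x within S.
      - (matrix_inv (f y) ** (((f y - f x) /\<^sub>R (y - x)) ** matrix_inv (f x)))
      = (matrix_inv (f y) - matrix_inv (f x)) /\<^sub>R (y - x)"
    using inv by (auto simp: eventually_at_topological matrix_inv_diff[OF x] matrix_scaleR)
  ultimately show ?thesis
    unfolding has_vector_derivative_iff_quotient by (simp add: tendsto_cong)
qed


section \<open>The unitary group\<close>

text \<open>The tangent space of the unitary group at the identity.\<close>

definition skew :: "complex^'n^'n \<Rightarrow> bool" where
  "skew W \<longleftrightarrow> W\<^sup>H = - W"

lemma norm_unitary: "unitary Q \<Longrightarrow> (norm Q)\<^sup>2 = real CARD('n)" for Q :: "complex^'n^'n"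
  using Re_trace_ctranspose_mult[of Q Q] trace_dg[of "\<lambda>_::'n. 1"] by (simp add: power2_norm_eq_inner)

lemma compact_unitary: "compact {Q :: complex^'n^'n. unitary Q}"
proof (rule compact_eq_bounded_closed[THEN iffD2], intro conjI)
  have "norm Q \<le> sqrt (real CARD('n))" if "unitary Q" for Q :: "complex^'n^'n"
    using norm_unitary[OF that] by (simp add: real_le_rsqrt)
  then show "bounded {Q :: complex^'n^'n. unitary Q}"
    unfolding bounded_iff by blast
  have "{Q :: complex^'n^'n. unitary Q} = {Q. Q\<^sup>H ** Q = mat 1}"
    using unitaryI unitary_mult_left(1) by blast
  then show "closed {Q :: complex^'n^'n. unitary Q}"
    by (simp add: closed_Collect_eq continuous_intros)
qed

lemma skew_quadratic_form:
  assumes "skew W"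
  shows "inner X (W ** X) = 0"
proof -
  have "inner X (W ** X) = inner X (W\<^sup>H ** X)"
    using inner_matrix_mult_left[of W X X] by (simp add: inner_commute)
  then show ?thesis
    using assms by (simp add: skew_def matrix_ring)
qed

text \<open>A kernel vector equals its image under \<open>W\<close>, so its squared norm is a value
  of the quadratic form of \<open>W\<close>, which is zero. The vector is treated as a one-column
  matrix to reuse the rules for \<open>inner\<close> and \<open>**\<close>.\<close>

lemma invertible_one_minus_skew:
  fixes W :: "complex^'n^'n"
  assumes "skew W"
  shows "invertible (mat 1 - W)"
proof -
  have "x = 0" if "(mat 1 - W) *v x = 0" for x
  proof -
    define X :: "complex^unit^'n" where "X = (\<chi> i j. x $ i)"
    have "((mat 1 - W) ** X) $ i $ j = ((mat 1 - W) *v x) $ i" for i j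
      by (simp add: X_def matrix_matrix_mult_def matrix_vector_mult_def)
    then have "(mat 1 - W) ** X = 0"
      by (simp add: that vec_eq_iff)
    then have "X - W ** X = 0"
      by (simp add: matrix_ring)
    then have "inner X X = inner X (W ** X)"
      by simp
    then have "X = 0"
      by (simp add: skew_quadratic_form[OF assms])
    then show ?thesis
      by (auto simp: X_def vec_eq_iff)
  qed
  then show ?thesis
    using matrix_left_invertible_ker invertible_left_inverse by metis
qed

text \<open>The Cayley transform, a unitary curve through the identity with prescribed
  skew-Hermitian velocity \<open>W\<close>; each of its two factors contributes half of
  \<open>W\<close>. Being rational in \<open>t\<close>, it needs only the derivative of
  \<open>matrix_inv\<close>, whereas \<open>mexp\<close> is evaluated below on Hermitian matrices
  only.\<close>

definition cayley :: "complex^'n^'n \<Rightarrow> real \<Rightarrow> complex^'n^'n" where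
  "cayley W t = matrix_inv (mat 1 - (t / 2) *\<^sub>R W) ** (mat 1 + (t / 2) *\<^sub>R W)"

lemma skew_scaleR: "skew W \<Longrightarrow> skew (r *\<^sub>R W)"
  by (simp add: skew_def ctranspose_linear)

text \<open>The two factors \<open>mat 1 - V\<close> and \<open>mat 1 + V\<close> commute and are
  exchanged by the conjugate transpose, as for (1 + v) / (1 - v) with imaginary v.\<close>

lemma unitary_cayley:
  assumes "skew W"
  shows "unitary (cayley W t)"
proof -
  let ?V = "(t / 2) *\<^sub>R W"
  have V: "skew ?V" "skew (- ?V)"
    using skew_scaleR[OF assms] skew_scaleR[OF assms, of "- (t / 2)"] by simp_all
  note inv = invertible_one_minus_skew[OF V(1)] invertible_one_minus_skew[OF V(2)]
  let ?A = "mat 1 - ?V" and ?B = "mat 1 + ?V"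
  have inv: "invertible ?A" "invertible ?B"
    using inv by simp_all
  have "(mat 1 - V) ** (mat 1 + V) = (mat 1 + V) ** (mat 1 - V)" for V :: "complex^'n^'n"
    by (simp add: matrix_ring)
  then have AB: "?A ** ?B = ?B ** ?A" .
  have H: "?A\<^sup>H = ?B" "?B\<^sup>H = ?A"
    using V by (simp_all add: ctranspose_linear skew_def)
  have "(matrix_inv ?A)\<^sup>H ** ?B = mat 1"
    using H(1) arg_cong[OF matrix_inv_mult(1)[OF inv(1)], of ctranspose] by (simp add: ctranspose_mult)
  then have "?B ** (matrix_inv ?A)\<^sup>H = mat 1"
    by (rule matrix_left_right_inverse[THEN iffD1])
  then have invH: "(matrix_inv ?A)\<^sup>H = matrix_inv ?B"
    by (rule matrix_inv_unique[symmetric])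
  have "(cayley W t)\<^sup>H ** cayley W t = ?A ** (matrix_inv ?B ** (matrix_inv ?A ** ?B))"
    by (simp add: cayley_def ctranspose_mult invH H matrix_assoc)
  also have "\<dots> = mat 1"
  proof -
    have "matrix_inv ?A ** ?B = ?B ** matrix_inv ?A"
      by (rule matrix_inv_commute[OF inv(1) AB])
    then show ?thesis
      by (simp only: matrix_inv_cancel[OF inv(2)] matrix_inv_mult[OF inv(1)])
  qed
  finally show ?thesis by (rule unitaryI)
qed

lemma matrix_inv_mat_1 [simp]: "matrix_inv (mat 1 :: complex^'n^'n) = mat 1"
  by (rule matrix_inv_unique) simp

lemma cayley_0 [simp]: "cayley W 0 = mat 1"
  by (simp add: cayley_def)

lemma has_vector_derivative_cayley:
  fixes W :: "complex^'n^'n"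
  assumes "skew W"
  shows "(cayley W has_vector_derivative W) (at 0)"
proof -
  have inv: "invertible (mat 1 - (t / 2) *\<^sub>R W)" for t
    by (rule invertible_one_minus_skew) (use assms in \<open>simp add: skew_scaleR\<close>)
  have 1: "((\<lambda>t. mat 1 + (t / 2) *\<^sub>R W) has_vector_derivative (1 / 2) *\<^sub>R W) (at 0)"
    by (auto intro!: derivative_eq_intros)
  have 2: "((\<lambda>t. mat 1 - (t / 2) *\<^sub>R W) has_vector_derivative - ((1 / 2) *\<^sub>R W)) (at 0)"
    by (auto intro!: derivative_eq_intros)
  have "((\<lambda>t. matrix_inv (mat 1 - (t / 2) *\<^sub>R W)) has_vector_derivative (1 / 2) *\<^sub>R W) (at 0)"
    using has_vector_derivative_matrix_inv[OF 2 inv inv] by (simp add: matrix_ring)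
  from has_vector_derivative_matrix_mult[OF this 1]
  show ?thesis
    unfolding cayley_def[abs_def] by (simp add: scaleR_add_left[symmetric])
qed

section \<open>Maxima over the unitary group, the spectral theorem and singular values\<close>

lemma has_real_derivative_imp_0_of_max:
  fixes f :: "real \<Rightarrow> real"
  assumes "(f has_vector_derivative D) (at 0)" "\<And>t. f t \<le> f 0"
  shows "D = 0"
  using assms DERIV_local_max[of f D 0 1] by (simp add: has_real_derivative_iff_has_vector_derivative)

text \<open>First-order condition at \<open>C = mat 1\<close>. Along the Cayley curve with velocity
  \<open>M\<^sup>H - M\<close> the derivative of the trace is half the squared norm of
  \<open>M - M\<^sup>H\<close>.\<close>

lemma hermitian_if_trace_unitary_max:
  fixes M :: "complex^'n^'n"
  assumes "\<And>C. unitary C \<Longrightarrow> Re (trace (C ** M)) \<le> Re (trace M)"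
  shows "hermitian M"
proof -
  define W where "W = M\<^sup>H - M"
  have W: "skew W"
    by (simp add: W_def skew_def ctranspose_linear)
  have "((\<lambda>t. Re (trace (cayley W t ** M))) has_vector_derivative Re (trace (W ** M))) (at 0)"
    using has_vector_derivative_cayley[OF W]
    by (auto intro!: derivative_eq_intros bounded_linear.has_vector_derivative[OF bounded_linear_Re])
  then have "Re (trace (W ** M)) = 0"
    by (rule has_real_derivative_imp_0_of_max) (use assms unitary_cayley[OF W] in simp)
  then have 0: "inner (M - M\<^sup>H) M = 0"
    using Re_trace_ctranspose_mult[of "M - M\<^sup>H" M] by (simp add: W_def ctranspose_linear)
  have "inner (M - M\<^sup>H) (M - M\<^sup>H) = 2 * inner (M - M\<^sup>H) M"
    using inner_ctranspose[of M M] by (simp add: inner_diff inner_commute[of "M\<^sup>H" M])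
  with 0 show ?thesis
    by (simp add: hermitian_def)
qed

text \<open>Weights for the traces maximised below. Distinct weights force a commuting matrix to be
  diagonal; positive ones keep their squares distinct and reveal the signs of the singular
  values.\<close>

lemma ex_distinct_weights: "\<exists>d :: 'n::finite \<Rightarrow> real. inj d \<and> (\<forall>i. 0 < d i)"
proof -
  obtain g :: "'n \<Rightarrow> nat" where "inj g"
    using finite_imp_inj_to_nat_seg[of "UNIV :: 'n set"] by auto
  then have "inj (\<lambda>i. real (Suc (g i)))"
    by (auto simp: inj_def)
  then show ?thesis
    by (intro exI[of _ "\<lambda>i. real (Suc (g i))"]) auto
qed

lemma hermitian_diagonal:
  assumes "hermitian A" "A = dg f"
  shows "A = rdg (\<lambda>i. Re (f i))"
proof -
  have "f = (\<lambda>i. cnj (f i))"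
    using assms by (simp add: hermitian_def)
  then have "f = (\<lambda>i. of_real (Re (f i)))"
    by (metis Reals_cnj_iff of_real_Re)
  with assms show ?thesis by simp
qed

text \<open>
  If \<open>Q\<close> maximises \<open>Re (tr (Q\<^sup>H A Q D))\<close> over the compact unitary group, then \<open>Q\<^sup>H A Q\<close> commutes with the
  diagonal matrix \<open>D\<close>, whose entries are distinct.
\<close>

theorem hermitian_spectral:
  fixes A :: "complex^'n^'n"
  assumes "hermitian A"
  obtains Q d where "unitary Q" "A = Q ** rdg d ** Q\<^sup>H"
proof -
  obtain w :: "'n \<Rightarrow> real" where w: "inj w"
    using ex_distinct_weights by blast
  let ?D = "rdg w"
  let ?f = "\<lambda>Q. Re (trace (Q\<^sup>H ** A ** Q ** ?D))"
  have "continuous_on {Q :: complex^'n^'n. unitary Q} ?f"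
    by (intro continuous_intros)
  then obtain Q where Q: "unitary Q" and max: "\<And>R. unitary R \<Longrightarrow> ?f R \<le> ?f Q"
    using continuous_attains_sup[OF compact_unitary, of ?f] unitary_mat_1 by blast
  define N where "N = Q\<^sup>H ** A ** Q"
  have N: "hermitian N"
    unfolding N_def using assms by (rule hermitian_conj)
  \<comment> \<open>The commutator is the direction of steepest change: moving \<open>Q\<close>
    along it, the derivative of the trace is \<open>trace (W ** W)\<close>, that is, minus the
    squared norm of the skew-Hermitian \<open>W\<close>.\<close>
  define W where "W = ?D ** N - N ** ?D"
  have W: "skew W"
    using N by (simp add: W_def skew_def ctranspose_simps hermitian_def)
  let ?g = "\<lambda>t. Re (trace ((cayley W t)\<^sup>H ** N ** cayley W t ** ?D))"
  have "(?g has_vector_derivative Re (trace ((N ** W - W ** N) ** ?D))) (at 0)"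
    using has_vector_derivative_cayley[OF W] W
    by (auto intro!: derivative_eq_intros bounded_linear.has_vector_derivative[OF bounded_linear_Re]
        simp: skew_def matrix_ring)
  then have "Re (trace ((N ** W - W ** N) ** ?D)) = 0"
  proof (rule has_real_derivative_imp_0_of_max)
    fix t
    show "?g t \<le> ?g 0"
      using max[of "Q ** cayley W t"] unitary_cayley[OF W] Q
      by (simp add: N_def ctranspose_mult matrix_assoc)
  qed
  moreover have "trace ((N ** W - W ** N) ** ?D) = trace (W ** W)"
  proof -
    have "trace ((N ** W - W ** N) ** ?D) = trace (N ** (W ** ?D)) - trace (W ** (N ** ?D))"
      by (simp add: matrix_ring matrix_assoc trace_linear)
    also have "trace (N ** (W ** ?D)) = trace (W ** (?D ** N))"
      using trace_mul_sym[of N "W ** ?D"] by (simp add: matrix_assoc)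
    finally show ?thesis
      by (simp add: W_def matrix_ring trace_linear)
  qed
  ultimately have "inner W W = 0"
    using W Re_trace_ctranspose_mult[of W W] by (simp add: skew_def matrix_ring(5,6) trace_linear(3))
  then have "N ** ?D = ?D ** N"
    by (simp add: W_def)
  from commutes_dg_imp_diagonal[OF this w] N
  have "N = rdg (\<lambda>i. Re (N $ i $ i))"
    using hermitian_diagonal by blast
  moreover have "A = Q ** N ** Q\<^sup>H"
    using Q by (simp add: N_def matrix_assoc)
  ultimately show ?thesis
    using that Q by metis
qed

text \<open>
  If \<open>Q\<close> and \<open>R\<close> maximise \<open>Re (tr (N D))\<close> with \<open>N = Q\<^sup>H A R\<close>, then \<open>N D\<close> and \<open>D N\<close> are Hermitian, so \<open>N\<close>
  commutes with \<open>D\<^sup>2\<close>.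
\<close>

theorem svd_exists:
  fixes A :: "complex^'n^'n"
  obtains Q s R where "unitary Q" "unitary R" "\<And>i. 0 \<le> s i" "A = Q ** rdg s ** R\<^sup>H"
proof -
  obtain w :: "'n \<Rightarrow> real" where w: "inj w" "\<And>i. 0 < w i"
    using ex_distinct_weights by blast
  let ?D = "rdg w"
  let ?f = "\<lambda>(Q, R). Re (trace (Q\<^sup>H ** A ** R ** ?D))"
  let ?S = "{Q :: complex^'n^'n. unitary Q} \<times> {Q :: complex^'n^'n. unitary Q}"
  have "continuous_on ?S ?f"
    unfolding split_beta by (intro continuous_intros)
  moreover have "compact ?S"
    by (intro compact_Times compact_unitary)
  moreover have "(mat 1, mat 1) \<in> ?S"
    by simp
  moreover from this have "?S \<noteq> {}"
    by blast
  ultimately obtain x where x: "x \<in> ?S" "\<And>y. y \<in> ?S \<Longrightarrow> ?f y \<le> ?f x"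
    using continuous_attains_sup[of ?S ?f] by blast
  obtain Q R where QR: "unitary Q" "unitary R" and x_eq: "x = (Q, R)"
    using x(1) by auto
  have max: "Re (trace (Q'\<^sup>H ** A ** R' ** ?D)) \<le> Re (trace (Q\<^sup>H ** A ** R ** ?D))"
    if "unitary Q'" "unitary R'" for Q' R'
    using x(2)[of "(Q', R')"] that by (simp add: x_eq)
  define N where "N = Q\<^sup>H ** A ** R"
  \<comment> \<open>Changing only one of the two unitary arguments multiplies \<open>N ** ?D\<close>
    or \<open>?D ** N\<close> by an arbitrary unitary matrix under the trace, so
    \<open>hermitian_if_trace_unitary_max\<close> applies to each product.\<close>
  have left: "Re (trace (C ** (N ** ?D))) \<le> Re (trace (N ** ?D))" if "unitary C" for C
    using max[of "Q ** C\<^sup>H" R] that QR by (simp add: N_def ctranspose_mult matrix_assoc)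
  have right: "Re (trace (C ** (?D ** N))) \<le> Re (trace (?D ** N))" if "unitary C" for C
    using max[of Q "R ** C"] that QR trace_mul_sym[of N "C ** ?D"] trace_mul_sym[of N ?D]
    by (simp add: N_def ctranspose_mult matrix_assoc)
  have h: "hermitian (N ** ?D)" "hermitian (?D ** N)"
    using left right by (auto intro: hermitian_if_trace_unitary_max)
  have eq: "?D ** N\<^sup>H = N ** ?D" "N\<^sup>H ** ?D = ?D ** N"
    using h by (simp_all add: hermitian_def ctranspose_mult)
  have "N ** rdg (\<lambda>i. (w i)\<^sup>2) = (?D ** N\<^sup>H) ** ?D"
    by (simp add: eq(1) matrix_assoc power2_eq_square)
  also have "\<dots> = ?D ** (?D ** N)"
    using eq(2) by (simp add: matrix_assoc del: dg_mult')
  finally have "N ** rdg (\<lambda>i. (w i)\<^sup>2) = rdg (\<lambda>i. (w i)\<^sup>2) ** N"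
    by (simp add: power2_eq_square)
  moreover have "inj (\<lambda>i. (w i)\<^sup>2)"
    using w by (auto simp: inj_def) (metis less_imp_le power2_eq_imp_eq)
  ultimately have N: "N = dg (\<lambda>i. N $ i $ i)"
    by (rule commutes_dg_imp_diagonal)
  define n where "n i = N $ i $ i" for i
  have Nn: "N = dg n"
    unfolding n_def by (rule N)
  have "N ** ?D = rdg (\<lambda>i. Re (n i * w i))"
    using hermitian_diagonal[OF h(1), of "\<lambda>i. n i * w i"] by (simp add: Nn)
  then have "n i * w i = of_real (Re (n i) * w i)" for i
    by (simp add: Nn fun_eq_iff)
  then have n: "n i = of_real (Re (n i))" for i
    using w(2)[of i] by (metis mult_cancel_right of_real_eq_0_iff of_real_mult less_irrefl)
  have "0 \<le> Re (n i)" for i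
  proof -
    \<comment> \<open>Flipping the sign of the i-th diagonal entry is a unitary change and changes
      the trace by \<open>- 2 * Re (n i) * w i\<close>, which cannot be an increase at the
      maximum.\<close>
    define c where "c = (\<lambda>j. if j = i then - 1 else 1 :: complex)"
    have "Re (trace (dg c ** (N ** ?D))) \<le> Re (trace (N ** ?D))"
      by (intro left unitary_dg) (simp add: c_def)
    then have "0 \<le> (\<Sum>j\<in>UNIV. Re (n j * w j) - Re (c j * (n j * w j)))"
      by (simp add: Nn trace_dg sum_subtractf)
    also have "\<dots> = (\<Sum>j\<in>UNIV. if j = i then 2 * (Re (n i) * w i) else 0)"
      by (intro sum.cong) (auto simp: c_def)
    finally show ?thesis
      using w(2)[of i] by (simp add: zero_le_mult_iff)
  qed
  moreover have "A = Q ** N ** R\<^sup>H"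
    using QR by (simp add: N_def matrix_assoc)
  moreover have "N = rdg (\<lambda>i. Re (n i))"
    using Nn n by (metis (no_types, lifting) ext)
  ultimately show ?thesis
    using that QR by metis
qed

section \<open>Functional calculus\<close>

lemma matrix_powers_spectral:
  assumes "unitary Q"
  shows "((\<lambda>B. (Q ** rdg d ** Q\<^sup>H) ** B) ^^ n) (mat 1) = Q ** rdg (\<lambda>i. d i ^ n) ** Q\<^sup>H"
  using assms by (induction n) (simp_all add: matrix_assoc)

lemma rdg_sums:
  assumes "\<And>i. (\<lambda>n. f n i) sums g i"
  shows "(\<lambda>n. rdg (f n)) sums rdg g"
  unfolding sums_def
proof (intro vec_tendstoI)
  fix i j
  have "(\<lambda>n. \<Sum>k<n. of_real (f k i) :: complex) \<longlonglongrightarrow> of_real (g i)"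
    using sums_of_real[OF assms[of i], where 'a = complex] by (simp add: sums_def)
  then show "(\<lambda>n. (\<Sum>k<n. rdg (f k)) $ i $ j) \<longlonglongrightarrow> rdg g $ i $ j"
    by (cases "i = j") (simp_all add: dg_nth)
qed

lemma mexp_spectral:
  assumes "unitary Q"
  shows "mexp (Q ** rdg d ** Q\<^sup>H) = Q ** rdg (\<lambda>i. exp (d i)) ** Q\<^sup>H"
proof -
  have "(\<lambda>n. rdg (\<lambda>i. d i ^ n /\<^sub>R fact n)) sums rdg (\<lambda>i. exp (d i))"
    by (intro rdg_sums exp_converges)
  moreover have "bounded_linear (\<lambda>Z. Q ** Z ** Q\<^sup>H)"
    by (intro bounded_linear_compose[OF bounded_bilinear.bounded_linear_left[OF bounded_bilinear_matrix_mult]]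
        bounded_bilinear.bounded_linear_right[OF bounded_bilinear_matrix_mult])
  ultimately have "(\<lambda>n. Q ** rdg (\<lambda>i. d i ^ n /\<^sub>R fact n) ** Q\<^sup>H) sums (Q ** rdg (\<lambda>i. exp (d i)) ** Q\<^sup>H)"
    by (rule bounded_linear.sums[rotated])
  moreover have "Q ** rdg (\<lambda>i. d i ^ n /\<^sub>R fact n) ** Q\<^sup>H
      = (1 / fact n) *\<^sub>R (Q ** rdg (\<lambda>i. d i ^ n) ** Q\<^sup>H)" for n
  proof -
    have "rdg (\<lambda>i. d i ^ n /\<^sub>R fact n) = (1 / fact n) *\<^sub>R rdg (\<lambda>i. d i ^ n)"
      by (simp add: dg_scaleR scaleR_conv_of_real[where 'a = complex] divide_inverse)
    then show ?thesis
      by (simp add: matrix_scaleR)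
  qed
  ultimately show ?thesis
    unfolding mexp_def matrix_powers_spectral[OF assms] by (simp add: sums_iff)
qed

lemma hermitian_spectral_form: "hermitian (Q ** rdg d ** Q\<^sup>H)"
  by (simp add: hermitian_def ctranspose_mult matrix_assoc)

text \<open>Applying a function to the eigenvalues does not depend on the chosen diagonalisation;
  this is what makes the Hermitian logarithm unique.\<close>

lemma spectral_fun_unique:
  assumes "unitary Q" "unitary R" "Q ** rdg d ** Q\<^sup>H = R ** rdg e ** R\<^sup>H"
  shows "Q ** rdg (\<lambda>i. f (d i)) ** Q\<^sup>H = R ** rdg (\<lambda>i. f (e i)) ** R\<^sup>H"
  using spectral_intertwine_fun[OF assms(1,2), of d "mat 1" e f] assms(3) by simp

text \<open>Uniqueness is the point: a competing Hermitian logarithm is diagonalised and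
  exponentiated, and \<open>ln\<close> is then applied to two diagonalisations of the same
  matrix.\<close>

lemma mlog_spectral:
  assumes "unitary Q" "\<And>i. 0 < d i"
  shows "mlog (Q ** rdg d ** Q\<^sup>H) = Q ** rdg (\<lambda>i. ln (d i)) ** Q\<^sup>H"
  unfolding mlog_def
proof (rule the_equality)
  show "hermitian (Q ** rdg (\<lambda>i. ln (d i)) ** Q\<^sup>H) \<and>
      mexp (Q ** rdg (\<lambda>i. ln (d i)) ** Q\<^sup>H) = Q ** rdg d ** Q\<^sup>H"
    using assms(2) by (simp add: mexp_spectral[OF assms(1)] hermitian_spectral_form)
next
  fix L assume L: "hermitian L \<and> mexp L = Q ** rdg d ** Q\<^sup>H"
  then obtain R e where R: "unitary R" and Le: "L = R ** rdg e ** R\<^sup>H"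
    using hermitian_spectral by blast
  then have "R ** rdg (\<lambda>i. exp (e i)) ** R\<^sup>H = Q ** rdg d ** Q\<^sup>H"
    using L mexp_spectral[OF R] by simp
  from spectral_fun_unique[OF R assms(1) this, of ln]
  show "L = Q ** rdg (\<lambda>i. ln (d i)) ** Q\<^sup>H"
    by (simp add: Le)
qed

lemma mpow_spectral:
  assumes "unitary Q" "\<And>i. 0 < d i"
  shows "mpow (Q ** rdg d ** Q\<^sup>H) t = Q ** rdg (\<lambda>i. d i powr t) ** Q\<^sup>H"
proof -
  have "rdg (\<lambda>i. t * ln (d i)) = t *\<^sub>R rdg (\<lambda>i. ln (d i))"
    by (simp add: dg_scaleR scaleR_conv_of_real[where 'a = complex])
  then have "t *\<^sub>R (Q ** rdg (\<lambda>i. ln (d i)) ** Q\<^sup>H) = Q ** rdg (\<lambda>i. t * ln (d i)) ** Q\<^sup>H"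
    by (simp add: matrix_scaleR del: of_real_mult)
  moreover have "exp (t * ln (d i)) = d i powr t" for i
    using assms(2)[of i] by (simp add: powr_def)
  ultimately show ?thesis
    by (simp add: mpow_def mlog_spectral[OF assms] mexp_spectral[OF assms(1)] del: of_real_mult)
qed

section \<open>Positive definite matrices\<close>

text \<open>Vectors become one-column matrices, so that the adjoint rules for \<open>inner\<close>
  and \<open>**\<close> apply to the quadratic form.\<close>

lemma hpd_iff:
  fixes A :: "complex^'n^'n"
  shows "hpd A \<longleftrightarrow> hermitian A \<and> (\<forall>X :: complex^unit^'n. X \<noteq> 0 \<longrightarrow> 0 < inner X (A ** X))"
proof -
  have *: "Re (\<Sum>i\<in>UNIV. cnj (x $ i) * (A *v x) $ i) = inner X (A ** X)"
    if "X = (\<chi> i j. x $ i)" for x and X :: "complex^unit^'n"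
  proof -
    have "(A ** X) $ i $ j = (A *v x) $ i" for i j
      by (simp add: that matrix_matrix_mult_def matrix_vector_mult_def)
    then show ?thesis
      by (simp add: inner_vec_def inner_complex_def that)
  qed
  have "(\<forall>x. x \<noteq> 0 \<longrightarrow> 0 < Re (\<Sum>i\<in>UNIV. cnj (x $ i) * (A *v x) $ i)) \<longleftrightarrow>
    (\<forall>X :: complex^unit^'n. X \<noteq> 0 \<longrightarrow> 0 < inner X (A ** X))"
  proof (intro iffI allI impI)
    fix X :: "complex^unit^'n"
    define x where "x = (\<chi> i. X $ i $ ())"
    assume a: "\<forall>x. x \<noteq> 0 \<longrightarrow> 0 < Re (\<Sum>i\<in>UNIV. cnj (x $ i) * (A *v x) $ i)" and "X \<noteq> 0"
    have X: "X = (\<chi> i j. x $ i)"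
      by (simp add: x_def vec_eq_iff)
    have "x \<noteq> 0"
      using \<open>X \<noteq> 0\<close> by (auto simp: x_def vec_eq_iff)
    with a have "0 < Re (\<Sum>i\<in>UNIV. cnj (x $ i) * (A *v x) $ i)"
      by blast
    then show "0 < inner X (A ** X)"
      by (simp only: *[OF X])
  next
    fix x :: "complex^'n"
    define X :: "complex^unit^'n" where "X = (\<chi> i j. x $ i)"
    assume "\<forall>X :: complex^unit^'n. X \<noteq> 0 \<longrightarrow> 0 < inner X (A ** X)" "x \<noteq> 0"
    moreover have "X \<noteq> 0"
      using \<open>x \<noteq> 0\<close> by (auto simp: X_def vec_eq_iff)
    ultimately show "0 < Re (\<Sum>i\<in>UNIV. cnj (x $ i) * (A *v x) $ i)"
      using *[OF X_def] by (simp del: Re_sum)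
  qed
  then show ?thesis by (simp add: hpd_def)
qed

lemma hpd_congruence:
  fixes A T :: "complex^'n^'n"
  assumes "hpd A" "invertible T"
  shows "hpd (T\<^sup>H ** A ** T)"
  unfolding hpd_iff
proof (intro conjI allI impI)
  show "hermitian (T\<^sup>H ** A ** T)"
    using assms by (simp add: hpd_iff hermitian_conj)
  fix X :: "complex^unit^'n" assume "X \<noteq> 0"
  then have "T ** X \<noteq> 0"
    using matrix_inv_cancel(2)[OF assms(2), of X] by (auto simp: matrix_ring)
  then have "0 < inner (T ** X) (A ** (T ** X))"
    using assms(1) by (simp add: hpd_iff)
  then show "0 < inner X (T\<^sup>H ** A ** T ** X)"
    by (simp add: inner_matrix_mult_left matrix_assoc)
qed

lemma unitary_invertible: "unitary Q \<Longrightarrow> invertible Q"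
  unfolding invertible_def by (metis unitary_mult_left(1,2))

lemma hpd_unitary_conj: "hpd A \<Longrightarrow> unitary Q \<Longrightarrow> hpd (Q\<^sup>H ** A ** Q)"
  by (rule hpd_congruence[OF _ unitary_invertible])

lemma inner_rdg: "inner X (rdg d ** X) = (\<Sum>i\<in>UNIV. d i * (norm (X $ i))\<^sup>2)"
proof -
  have "(rdg d ** X) $ i = d i *\<^sub>R X $ i" for i
    by (simp add: vec_eq_iff dg_mult_nth scaleR_conv_of_real[where 'a = complex])
  then show ?thesis
    by (subst inner_vec_def) (simp add: power2_norm_eq_inner)
qed

lemma hpd_rdg: "hpd (rdg d) \<longleftrightarrow> (\<forall>i. 0 < d i)"
proof
  assume h: "hpd (rdg d)"
  show "\<forall>i. 0 < d i"
  proof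
    fix i
    define X :: "complex^unit^'a" where "X = (\<chi> r c. if r = i then 1 else 0)"
    have "X $ i $ () \<noteq> 0"
      by (simp add: X_def)
    then have "X \<noteq> 0"
      by auto
    then have "0 < inner X (rdg d ** X)"
      using h by (simp add: hpd_iff)
    also have "\<dots> = (\<Sum>r\<in>UNIV. if r = i then d i * (norm (X $ i))\<^sup>2 else 0)"
      unfolding inner_rdg by (intro sum.cong) (auto simp: X_def vec_eq_iff zero_vec_def[symmetric])
    also have "\<dots> = d i * (norm (X $ i))\<^sup>2"
      by simp
    finally show "0 < d i"
      by (simp add: zero_less_mult_iff)
  qed
next
  assume d: "\<forall>i. 0 < d i"
  show "hpd (rdg d)"
    unfolding hpd_iff inner_rdg
  proof (intro conjI allI impI)
    show "hermitian (rdg d)"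
      by (simp add: hermitian_def)
    fix X :: "complex^unit^'a" assume "X \<noteq> 0"
    then obtain i where "X $ i \<noteq> 0"
      by (auto simp: vec_eq_iff)
    then show "0 < (\<Sum>i\<in>UNIV. d i * (norm (X $ i))\<^sup>2)"
      using d by (intro sum_pos2[of _ i]) (auto simp: less_imp_le)
  qed
qed

lemma hpd_spectral_form: "unitary Q \<Longrightarrow> (\<And>i. 0 < d i) \<Longrightarrow> hpd (Q ** rdg d ** Q\<^sup>H)"
  using hpd_unitary_conj[of "rdg d" "Q\<^sup>H"] by (simp add: hpd_rdg)

lemma hpd_spectral:
  assumes "hpd A"
  shows "\<exists>Q d. unitary Q \<and> (\<forall>i. 0 < d i) \<and> A = Q ** rdg d ** Q\<^sup>H"
proof -
  obtain Q d where Q: "unitary Q" and A: "A = Q ** rdg d ** Q\<^sup>H"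
    using assms hermitian_spectral unfolding hpd_def by blast
  have "hpd (rdg d)"
    using hpd_unitary_conj[OF assms Q] Q by (simp add: A matrix_assoc)
  then show ?thesis
    using Q A hpd_rdg by blast
qed

lemma hpd_hermitian: "hpd A \<Longrightarrow> hermitian A"
  by (simp add: hpd_def)

lemma hpd_invertible:
  assumes "hpd A"
  shows "invertible A"
proof -
  obtain Q d where Q: "unitary Q" and d: "\<And>i. 0 < d i" and A: "A = Q ** rdg d ** Q\<^sup>H"
    using hpd_spectral[OF assms] by blast
  have "d i \<noteq> 0" for i
    using d[of i] by simp
  then have "A ** (Q ** rdg (\<lambda>i. inverse (d i)) ** Q\<^sup>H) = mat 1"
    using Q by (simp add: A matrix_assoc)
  then show ?thesis
    using invertible_right_inverse by blast
qed

lemma hermitian_eqD: "hermitian A \<Longrightarrow> A\<^sup>H = A"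
  by (simp add: hermitian_def)

lemma hpd_mpow:
  assumes "hpd A"
  shows "hpd (mpow A t)"
proof -
  obtain Q d where Q: "unitary Q" and d: "\<And>i. 0 < d i" and A: "A = Q ** rdg d ** Q\<^sup>H"
    using hpd_spectral[OF assms] by blast
  have "0 < d i powr t" for i
    using d[of i] by simp
  then show ?thesis
    unfolding A mpow_spectral[OF Q d] by (rule hpd_spectral_form[OF Q])
qed

lemma mpow_add:
  assumes "hpd A"
  shows "mpow A s ** mpow A t = mpow A (s + t)"
proof -
  obtain Q d where Q: "unitary Q" and d: "\<And>i. 0 < d i" and A: "A = Q ** rdg d ** Q\<^sup>H"
    using hpd_spectral[OF assms] by blast
  show ?thesis
    unfolding A mpow_spectral[OF Q d] using Q by (simp add: matrix_assoc powr_add)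
qed

lemma mpow_0:
  assumes "hpd A"
  shows "mpow A 0 = mat 1"
proof -
  obtain Q d where Q: "unitary Q" and d: "\<And>i. 0 < d i" and A: "A = Q ** rdg d ** Q\<^sup>H"
    using hpd_spectral[OF assms] by blast
  have "d i powr 0 = 1" for i
    using d[of i] by simp
  then show ?thesis
    unfolding A mpow_spectral[OF Q d] using Q by (simp add: matrix_assoc)
qed

lemma mpow_1:
  assumes "hpd A"
  shows "mpow A 1 = A"
proof -
  obtain Q d where Q: "unitary Q" and d: "\<And>i. 0 < d i" and A: "A = Q ** rdg d ** Q\<^sup>H"
    using hpd_spectral[OF assms] by blast
  have "d i powr 1 = d i" for i
    using d[of i] by simp
  then show ?thesis
    unfolding A mpow_spectral[OF Q d] using Q by (simp add: matrix_assoc)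
qed

lemma mpow_half:
  assumes "hpd A"
  shows "(mpow A t)\<^sup>H = mpow A t"
    "mpow A (1/2) ** mpow A (1/2) = A"
    "mpow A (1/2) ** mpow A (-1/2) = mat 1"
    "mpow A (-1/2) ** mpow A (1/2) = mat 1"
    "mpow A (-1/2) ** mpow A (-1/2) = matrix_inv A"
proof -
  show "(mpow A t)\<^sup>H = mpow A t"
    using assms hermitian_eqD hpd_hermitian hpd_mpow by blast
  show "mpow A (1/2) ** mpow A (1/2) = A"
    "mpow A (1/2) ** mpow A (-1/2) = mat 1"
    "mpow A (-1/2) ** mpow A (1/2) = mat 1"
    using assms by (simp_all add: mpow_add mpow_0 mpow_1)
  have "mpow A 1 ** mpow A (-1) = mat 1"
    using assms mpow_add[of A 1 "-1"] by (simp add: mpow_0)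
  then show "mpow A (-1/2) ** mpow A (-1/2) = matrix_inv A"
    using assms matrix_inv_unique[of A "mpow A (-1)"] by (simp add: mpow_add mpow_1)
qed

lemma spectral_conj:
  assumes "unitary Q" "unitary R"
  shows "R\<^sup>H ** (Q ** rdg d ** Q\<^sup>H) ** R = (R\<^sup>H ** Q) ** rdg d ** (R\<^sup>H ** Q)\<^sup>H" "unitary (R\<^sup>H ** Q)"
  using assms by (simp_all add: ctranspose_mult matrix_assoc)

lemma mlog_unitary_conj:
  assumes "hpd A" "unitary R"
  shows "mlog (R\<^sup>H ** A ** R) = R\<^sup>H ** mlog A ** R"
proof -
  obtain Q d where Q: "unitary Q" and d: "\<And>i. 0 < d i" and A: "A = Q ** rdg d ** Q\<^sup>H"
    using hpd_spectral[OF assms(1)] by blast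
  show ?thesis
    unfolding A mlog_spectral[OF Q d] spectral_conj[OF Q assms(2)]
    by (rule mlog_spectral[OF spectral_conj(2)[OF Q assms(2)] d])
qed

lemma mpow_unitary_conj:
  assumes "hpd A" "unitary R"
  shows "mpow (R\<^sup>H ** A ** R) t = R\<^sup>H ** mpow A t ** R"
proof -
  obtain Q d where Q: "unitary Q" and d: "\<And>i. 0 < d i" and A: "A = Q ** rdg d ** Q\<^sup>H"
    using hpd_spectral[OF assms(1)] by blast
  show ?thesis
    unfolding A mpow_spectral[OF Q d] spectral_conj[OF Q assms(2)]
    by (rule mpow_spectral[OF spectral_conj(2)[OF Q assms(2)] d])
qed

lemma hermitian_mlog:
  assumes "hpd A"
  shows "hermitian (mlog A)"
proof -
  obtain Q d where "unitary Q" "\<And>i. 0 < d i" "A = Q ** rdg d ** Q\<^sup>H"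
    using hpd_spectral[OF assms] by blast
  then show ?thesis
    by (simp add: mlog_spectral hermitian_spectral_form)
qed

lemma mlog_eq_0_iff:
  assumes "hpd A"
  shows "mlog A = 0 \<longleftrightarrow> A = mat 1"
proof -
  obtain Q d where Q: "unitary Q" and d: "\<And>i. 0 < d i" and A: "A = Q ** rdg d ** Q\<^sup>H"
    using hpd_spectral[OF assms] by blast
  have conj: "Q ** B ** Q\<^sup>H = C \<longleftrightarrow> B = Q\<^sup>H ** C ** Q" for B C
    using Q by (auto simp: matrix_assoc)
  have "mlog A = 0 \<longleftrightarrow> rdg (\<lambda>i. ln (d i)) = 0"
    unfolding A mlog_spectral[OF Q d] conj by (simp add: matrix_ring)
  also have "\<dots> \<longleftrightarrow> (\<forall>i. ln (d i) = 0)"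
    by (auto simp: dg_nth vec_eq_iff)
  also have "\<dots> \<longleftrightarrow> (\<forall>i. d i = 1)"
    using d by simp
  also have "\<dots> \<longleftrightarrow> rdg d = mat 1"
    using dg_eq_iff[of "\<lambda>i. of_real (d i)" "\<lambda>_. 1"] by (simp add: fun_eq_iff)
  also have "\<dots> \<longleftrightarrow> A = mat 1"
    using Q by (simp add: A conj)
  finally show ?thesis .
qed

text \<open>\<open>A ** X\<close> and \<open>A ** Y\<close> are Hermitian and each absorbs the
  other, so they coincide, and likewise \<open>X ** A\<close> and \<open>Y ** A\<close>. Then Y =
  YAY = XAY = XAX = X.\<close>

lemma pinv_eqI:
  fixes A :: "complex^'n^'m"
  assumes "A ** X ** A = A" "X ** A ** X = X" "(A ** X)\<^sup>H = A ** X" "(X ** A)\<^sup>H = X ** A"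
  shows "pinv A = X"
  unfolding pinv_def
proof (rule the_equality)
  fix Y
  assume "A ** Y ** A = A \<and> Y ** A ** Y = Y \<and> (A ** Y)\<^sup>H = A ** Y \<and> (Y ** A)\<^sup>H = Y ** A"
  then have Y: "A ** Y ** A = A" "Y ** A ** Y = Y" "(A ** Y)\<^sup>H = A ** Y" "(Y ** A)\<^sup>H = Y ** A"
    by auto
  have "A ** X = (A ** Y) ** (A ** X)"
    by (simp only: matrix_mul_assoc Y(1))
  also have "\<dots> = ((A ** X) ** (A ** Y))\<^sup>H"
    by (simp only: ctranspose_mult[of "A ** X"] Y(3) assms(3))
  also have "\<dots> = A ** Y"
    by (simp only: matrix_mul_assoc assms(1) Y(3))
  finally have AX: "A ** X = A ** Y" .
  have "X ** A = (X ** A) ** (Y ** A)"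
    by (simp only: matrix_assoc Y(1)[unfolded matrix_assoc])
  also have "\<dots> = ((Y ** A) ** (X ** A))\<^sup>H"
    by (simp only: ctranspose_mult[of "Y ** A"] Y(4) assms(4))
  also have "\<dots> = Y ** A"
    by (simp only: matrix_assoc assms(1)[unfolded matrix_assoc] Y(4)[unfolded matrix_assoc])
  finally have XA: "X ** A = Y ** A" .
  have "Y = Y ** A ** Y"
    by (simp only: Y(2))
  also have "\<dots> = X ** (A ** Y)"
    by (simp only: XA[symmetric] matrix_assoc)
  also have "\<dots> = X"
    by (simp only: AX[symmetric] matrix_mul_assoc assms(2))
  finally show "Y = X" .
qed (use assms in simp)

text \<open>The convention \<open>inverse 0 = 0\<close> makes the entrywise inverse satisfy the
  Penrose equations also at vanishing entries.\<close>

lemma pinv_rdg: "pinv (rdg s) = rdg (\<lambda>i. inverse (s i))"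
proof -
  have "s i = 0 \<or> of_real (s i) * inverse (of_real (s i)) = (1 :: complex)"
    "s i = 0 \<or> inverse (of_real (s i)) * of_real (s i) = (1 :: complex)" for i
    by (cases "s i = 0"; simp)+
  then show ?thesis
    by (intro pinv_eqI) (simp_all add: fun_eq_iff)
qed

section \<open>The divergence formula\<close>

text \<open>Cauchy-Schwarz against the identity matrix, whose squared norm is
  \<open>CARD('n)\<close>.\<close>

lemma trace_le_norm_hermitian: "(Re (trace L))\<^sup>2 \<le> real CARD('n) * (norm L)\<^sup>2" for L :: "complex^'n^'n"
proof -
  have "Re (trace L) = inner (mat 1) L"
    using Re_trace_ctranspose_mult[of "mat 1" L] by simp
  then have "(Re (trace L))\<^sup>2 \<le> inner (mat 1) (mat 1 :: complex^'n^'n) * (norm L)\<^sup>2"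
    using Cauchy_Schwarz_ineq[of "mat 1" L] by (simp add: power2_norm_eq_inner)
  then show ?thesis
    using norm_unitary[OF unitary_mat_1, where 'n = 'n] by (simp add: power2_norm_eq_inner)
qed

text \<open>The form has the eigenvalue \<alpha> on the orthogonal complement of the identity matrix
  and \<alpha> + \<beta> k, with k = \<open>CARD('n)\<close>, on its real multiples. The smaller one
  is the constant; the lower bound on \<beta> says that the second is positive.\<close>

lemma quadratic_form_bound:
  assumes "0 < \<alpha>" "- \<alpha> / real CARD('n) < \<beta>"
  obtains \<delta> where "0 < \<delta>" "\<And>L :: complex^'n^'n. \<delta> * (norm L)\<^sup>2 \<le> \<alpha> * (norm L)\<^sup>2 + \<beta> * (Re (trace L))\<^sup>2"
proof
  define k where "k = real CARD('n)"
  have k: "0 < k"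
    by (simp add: k_def)
  show "0 < min \<alpha> (\<alpha> + \<beta> * k)"
    using assms k by (simp add: k_def[symmetric] field_simps)
  fix L :: "complex^'n^'n"
  let ?a = "(norm L)\<^sup>2" and ?t = "(Re (trace L))\<^sup>2"
  have t: "?t \<le> k * ?a"
    unfolding k_def by (rule trace_le_norm_hermitian)
  show "min \<alpha> (\<alpha> + \<beta> * k) * ?a \<le> \<alpha> * ?a + \<beta> * ?t"
  proof (cases "0 \<le> \<beta>")
    case True
    then have "min \<alpha> (\<alpha> + \<beta> * k) * ?a \<le> \<alpha> * ?a" "0 \<le> \<beta> * ?t"
      by (auto intro!: mult_right_mono)
    then show ?thesis by linarith
  next
    case False
    then have "\<beta> * (k * ?a) \<le> \<beta> * ?t"
      using t by (intro mult_left_mono_neg) auto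
    moreover have "min \<alpha> (\<alpha> + \<beta> * k) * ?a \<le> (\<alpha> + \<beta> * k) * ?a"
      by (intro mult_right_mono) auto
    ultimately show ?thesis
      by (simp add: algebra_simps)
  qed
qed

section \<open>Principal angles and existence of the cosine decomposition\<close>

lemma angle_matrixE:
  assumes "angle_matrix \<Theta>"
  obtains \<theta> where "\<Theta> = rdg \<theta>" "\<And>i. 0 \<le> \<theta> i" "\<And>i. \<theta> i \<le> pi / 2"
proof -
  have "\<Theta> $ i $ i \<in> of_real ` {0..pi / 2}" for i
    using assms by (simp add: angle_matrix_def)
  then have "\<forall>i. \<exists>r. \<Theta> $ i $ i = of_real r \<and> 0 \<le> r \<and> r \<le> pi / 2"
    by (simp add: image_iff Bex_def conj_ac)
  then obtain \<theta> where \<theta>: "\<forall>i. \<Theta> $ i $ i = of_real (\<theta> i) \<and> 0 \<le> \<theta> i \<and> \<theta> i \<le> pi / 2"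
    by (rule choice[THEN exE])
  then have "\<Theta> = rdg \<theta>"
    using assms by (auto simp: vec_eq_iff dg_nth angle_matrix_def)
  then show ?thesis
    using that \<theta> by blast
qed

lemma angle_matrix_rdg: "angle_matrix (rdg \<theta>) \<longleftrightarrow> (\<forall>i. 0 \<le> \<theta> i \<and> \<theta> i \<le> pi / 2)"
  by (auto simp: angle_matrix_def dg_nth image_iff)

lemma diag_apply_rdg:
  "diag_apply cos (rdg \<theta>) = rdg (\<lambda>i. cos (\<theta> i))" "diag_apply sin (rdg \<theta>) = rdg (\<lambda>i. sin (\<theta> i))"
  by (simp_all add: diag_apply_def dg_def vec_eq_iff cos_of_real sin_of_real)

lemma cos_svdE:
  assumes "cos_svd A Q \<Theta> Q'"
  obtains \<theta> where "unitary Q" "unitary Q'" "\<Theta> = rdg \<theta>" "\<And>i. 0 \<le> \<theta> i" "\<And>i. \<theta> i \<le> pi / 2"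
    "A = Q ** rdg (\<lambda>i. cos (\<theta> i)) ** Q'\<^sup>H"
proof -
  have "angle_matrix \<Theta>"
    using assms by (simp add: cos_svd_def)
  then obtain \<theta> where "\<Theta> = rdg \<theta>" "\<And>i. 0 \<le> \<theta> i" "\<And>i. \<theta> i \<le> pi / 2"
    using angle_matrixE by blast
  moreover have "unitary Q" "unitary Q'" "A = Q ** diag_apply cos \<Theta> ** Q'\<^sup>H"
    using assms by (simp_all add: cos_svd_def)
  ultimately show ?thesis
    using that diag_apply_rdg by metis
qed

lemma cos_svd_ctranspose:
  assumes "cos_svd A Q \<Theta> Q'"
  shows "cos_svd (A\<^sup>H) Q' \<Theta> Q"
proof -
  obtain \<theta> where *: "unitary Q" "unitary Q'" "\<Theta> = rdg \<theta>" "\<And>i. 0 \<le> \<theta> i" "\<And>i. \<theta> i \<le> pi / 2"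
    "A = Q ** rdg (\<lambda>i. cos (\<theta> i)) ** Q'\<^sup>H"
    using cos_svdE[OF assms] by blast
  then show ?thesis
    by (simp add: cos_svd_def angle_matrix_rdg diag_apply_rdg ctranspose_mult matrix_assoc)
qed

lemma ctranspose_mult_diagonal_nonneg: "0 \<le> Re ((X\<^sup>H ** X) $ i $ i)"
  by (simp add: matrix_matrix_mult_def sum_nonneg)

text \<open>Singular values are cosines only if they are at most 1. The matrix \<open>K\<close> is
  the part of \<open>U'\<close> orthogonal to the columns of \<open>U\<close>; the Gram matrix of
  \<open>K ** R\<close> is diagonal with entries \<open>1 - (s i)\<^sup>2\<close>, which are
  therefore nonnegative.\<close>

lemma cos_svd_exists:
  fixes U U' :: "complex^'k^'p"
  assumes "U\<^sup>H ** U = mat 1" "U'\<^sup>H ** U' = mat 1"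
  shows "\<exists>Q \<Theta> Q'. cos_svd (U\<^sup>H ** U') Q \<Theta> Q'"
proof -
  obtain Q s R where QR: "unitary Q" "unitary R" and s: "\<And>i. 0 \<le> s i"
    and A: "U\<^sup>H ** U' = Q ** rdg s ** R\<^sup>H"
    by (rule svd_exists[of "U\<^sup>H ** U'"]) (rule that)
  define K where "K = U' - U ** (U\<^sup>H ** U')"
  have "K\<^sup>H ** K = mat 1 - (U\<^sup>H ** U')\<^sup>H ** (U\<^sup>H ** U')"
    using assms(2) by (simp add: K_def ctranspose_simps matrix_ring matrix_assoc inverse_cancel[OF assms(1)])
  then have KK: "K\<^sup>H ** K = R ** (mat 1 - rdg (\<lambda>i. (s i)\<^sup>2)) ** R\<^sup>H"
    using QR by (simp add: A ctranspose_mult matrix_assoc matrix_ring power2_eq_square)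
  have "(K ** R)\<^sup>H ** (K ** R) = R\<^sup>H ** (K\<^sup>H ** K) ** R"
    by (simp add: ctranspose_mult matrix_assoc)
  also have "\<dots> = mat 1 - rdg (\<lambda>i. (s i)\<^sup>2)"
    unfolding KK using QR by (simp add: matrix_assoc)
  finally have "Re (((K ** R)\<^sup>H ** (K ** R)) $ i $ i) = 1 - (s i)\<^sup>2" for i
    by (simp add: dg_nth mat_def)
  then have "0 \<le> 1 - (s i)\<^sup>2" for i
    using ctranspose_mult_diagonal_nonneg[of "K ** R" i] by simp
  then have s1: "s i \<le> 1" for i
    using power2_le_imp_le[of "s i" 1] by simp
  have "cos_svd (U\<^sup>H ** U') Q (rdg (\<lambda>i. arccos (s i))) R"
    using QR s s1 arccos_le_pi2 arccos_lbound
    by (auto simp: cos_svd_def angle_matrix_rdg diag_apply_rdg A order_trans[OF _ s])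
  then show ?thesis by blast
qed

text \<open>The argument of the logarithm in \<open>div_formula\<close> and at the same time the
  base of the power in \<open>geo_\<Sigma>\<close>; it links the divergence to the speed of the
  lift.\<close>

definition whitened :: "complex^'k^'k \<Rightarrow> complex^'k^'k \<Rightarrow> complex^'k^'k \<Rightarrow> complex^'k^'k \<Rightarrow> complex^'k^'k" where
  "whitened \<Sigma> \<Sigma>' Q Q' = mpow \<Sigma> (-1/2) ** Q ** Q'\<^sup>H ** \<Sigma>' ** Q' ** Q\<^sup>H ** mpow \<Sigma> (-1/2)"

lemma det_unitary_conj:
  assumes "unitary Q"
  shows "det (Q ** A ** Q\<^sup>H) = det A"
proof -
  have "det Q * det (Q\<^sup>H) = 1"
    using assms by (simp flip: det_mul)
  then show ?thesis
    by (simp add: det_mul)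
qed

text \<open>Exchanging the two points replaces the matrix \<open>Z\<close> below by its inverse.\<close>

lemma whitened_svd:
  assumes h: "hpd \<Sigma>" "hpd \<Sigma>'" and Q: "unitary Q" "unitary Q'"
    and AB: "unitary A" "unitary B" and s: "\<And>i. 0 < s i"
    and Z: "mpow \<Sigma> (-1/2) ** Q ** Q'\<^sup>H ** mpow \<Sigma>' (1/2) = A ** rdg s ** B\<^sup>H"
  shows "whitened \<Sigma> \<Sigma>' Q Q' = A ** rdg (\<lambda>i. (s i)\<^sup>2) ** A\<^sup>H" (is ?red)
    and "mpow \<Sigma>' (-1/2) ** Q' ** Q\<^sup>H ** mpow \<Sigma> (1/2) = B ** rdg (\<lambda>i. inverse (s i)) ** A\<^sup>H" (is ?inv)
proof -
  define R P R' P' where defs: "R = mpow \<Sigma> (-1/2)" "P = mpow \<Sigma> (1/2)"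
    "R' = mpow \<Sigma>' (-1/2)" "P' = mpow \<Sigma>' (1/2)"
  have H: "R\<^sup>H = R" "P'\<^sup>H = P'" "P' ** P' = \<Sigma>'" "R ** P = mat 1" "P' ** R' = mat 1"
    using h unfolding defs by (blast intro: mpow_half)+
  let ?Z = "R ** Q ** Q'\<^sup>H ** P'" and ?Y = "R' ** Q' ** Q\<^sup>H ** P"
  have Z: "?Z = A ** rdg s ** B\<^sup>H"
    unfolding defs by (rule Z)
  have "whitened \<Sigma> \<Sigma>' Q Q' = ?Z ** ?Z\<^sup>H"
    unfolding whitened_def defs(1)[symmetric] H(3)[symmetric]
    by (simp add: ctranspose_mult H(1,2) matrix_assoc)
  also have "\<dots> = A ** rdg (\<lambda>i. (s i)\<^sup>2) ** A\<^sup>H"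
    unfolding Z using AB by (simp add: ctranspose_mult matrix_assoc power2_eq_square)
  finally show ?red .
  have "?Z ** ?Y = mat 1"
    using Q by (simp add: matrix_assoc inverse_cancel[OF H(5)] H(4))
  then have 1: "?Y = matrix_inv ?Z"
    by (rule matrix_inv_unique[symmetric])
  have "s i \<noteq> 0" for i
    using s[of i] by simp
  then have "?Z ** (B ** rdg (\<lambda>i. inverse (s i)) ** A\<^sup>H) = mat 1"
    unfolding Z using AB by (simp add: matrix_assoc)
  then have "matrix_inv ?Z = B ** rdg (\<lambda>i. inverse (s i)) ** A\<^sup>H"
    by (rule matrix_inv_unique)
  then show ?inv
    unfolding defs[symmetric] 1 .
qed

lemma whitened_svd_exists:
  assumes h: "hpd \<Sigma>" "hpd \<Sigma>'" and Q: "unitary Q" "unitary Q'"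
  obtains A B s where "unitary A" "unitary B" "\<And>i. 0 < s i"
    "mpow \<Sigma> (-1/2) ** Q ** Q'\<^sup>H ** mpow \<Sigma>' (1/2) = A ** rdg s ** B\<^sup>H"
proof -
  let ?Z = "mpow \<Sigma> (-1/2) ** Q ** Q'\<^sup>H ** mpow \<Sigma>' (1/2)"
  obtain A s B where AB: "unitary A" "unitary B" and s: "\<And>i. 0 \<le> s i" and Z: "?Z = A ** rdg s ** B\<^sup>H"
    by (rule svd_exists[of ?Z]) (rule that)
  have "invertible ?Z"
    using h Q by (intro invertible_mult) (auto simp: unitary_invertible hpd_invertible hpd_mpow)
  from invertible_mult[OF invertible_mult[OF unitary_invertible this] unitary_invertible, of "A\<^sup>H" B] AB
  have "invertible (A\<^sup>H ** ?Z ** B)"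
    by (simp only: unitary_ctranspose)
  moreover have "A\<^sup>H ** ?Z ** B = rdg s"
    unfolding Z using AB by (simp add: matrix_assoc)
  ultimately have "invertible (rdg s)"
    by (simp only:)
  then have "s i \<noteq> 0" for i
    by (simp add: invertible_det_nz det_dg)
  then have "0 < s i" for i
    using s[of i] by (simp add: less_le)
  then show ?thesis
    using that AB Z by blast
qed

text \<open>Everything is a function of the singular values \<open>s\<close> in
  \<open>whitened_svd\<close>: the logarithm has the eigenvalues \<open>2 * ln (s i)\<close>. The
  fact \<open>main\<close> is kept general because it is used for both orders of the points; the
  exchange inverts each \<open>s i\<close> and so only flips the signs of these eigenvalues.\<close>

lemma
  assumes h: "hpd \<Sigma>" "hpd \<Sigma>'" and Q: "unitary Q" "unitary Q'"
  shows hpd_whitened: "hpd (whitened \<Sigma> \<Sigma>' Q Q')"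
    and div_formula_whitened: "div_formula \<alpha> \<beta> \<Sigma> \<Sigma>' Q \<Theta> Q' =
      \<alpha> * (norm (mlog (whitened \<Sigma> \<Sigma>' Q Q')))\<^sup>2 + \<beta> * (Re (trace (mlog (whitened \<Sigma> \<Sigma>' Q Q'))))\<^sup>2 + (norm \<Theta>)\<^sup>2"
    and div_formula_swap: "div_formula \<alpha> \<beta> \<Sigma>' \<Sigma> Q' \<Theta> Q = div_formula \<alpha> \<beta> \<Sigma> \<Sigma>' Q \<Theta> Q'"
proof -
  have main: "hpd (whitened \<Sigma> \<Sigma>' Q Q') \<and> (\<forall>\<Theta>. div_formula \<alpha> \<beta> \<Sigma> \<Sigma>' Q \<Theta> Q' =
      \<alpha> * (norm (mlog (whitened \<Sigma> \<Sigma>' Q Q')))\<^sup>2 + \<beta> * (Re (trace (mlog (whitened \<Sigma> \<Sigma>' Q Q'))))\<^sup>2 + (norm \<Theta>)\<^sup>2)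
      \<and> (norm (mlog (whitened \<Sigma> \<Sigma>' Q Q')))\<^sup>2 = (\<Sum>i\<in>UNIV. (2 * ln (s i))\<^sup>2)
      \<and> (Re (trace (mlog (whitened \<Sigma> \<Sigma>' Q Q')))) = (\<Sum>i\<in>UNIV. 2 * ln (s i))"
    if h: "hpd \<Sigma>" "hpd \<Sigma>'" and Q: "unitary Q" "unitary Q'"
      and AB: "unitary A" "unitary B" and s: "\<And>i. 0 < s i"
      and Z: "mpow \<Sigma> (-1/2) ** Q ** Q'\<^sup>H ** mpow \<Sigma>' (1/2) = A ** rdg s ** B\<^sup>H"
    for \<Sigma> \<Sigma>' Q Q' A B and s :: "'a \<Rightarrow> real"
  proof -
    let ?M = "whitened \<Sigma> \<Sigma>' Q Q'"
    have M: "?M = A ** rdg (\<lambda>i. (s i)\<^sup>2) ** A\<^sup>H"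
      by (rule whitened_svd[OF h Q AB s Z])
    have s2: "0 < (s i)\<^sup>2" "ln ((s i)\<^sup>2) = 2 * ln (s i)" for i
      using s[of i] by (simp_all add: ln_realpow)
    have L: "mlog ?M = A ** rdg (\<lambda>i. 2 * ln (s i)) ** A\<^sup>H"
      unfolding M mlog_spectral[OF AB(1) s2(1)] s2(2) ..
    have nL: "(norm (mlog ?M))\<^sup>2 = (\<Sum>i\<in>UNIV. (2 * ln (s i))\<^sup>2)"
      unfolding L norm_unitary_mult(2)[OF AB(1)[THEN unitary_ctranspose[THEN iffD2]]]
        norm_unitary_mult(1)[OF AB(1)] by (rule norm_rdg)
    have "trace (mlog ?M) = trace (rdg (\<lambda>i. 2 * ln (s i)))"
      unfolding L matrix_assoc by (rule trace_unitary_conj[OF AB(1)])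
    then have tL: "Re (trace (mlog ?M)) = (\<Sum>i\<in>UNIV. 2 * ln (s i))"
      by (simp add: trace_dg)
    \<comment> \<open>\<open>matrix_inv \<Sigma>\<close> splits into two factors
      \<open>mpow \<Sigma> (-1/2)\<close>, and determinants commute, so one factor moves to the
      other end. The logarithm of the resulting \<open>det ?M\<close> is the trace of
      \<open>mlog ?M\<close>.\<close>
    have "det (matrix_inv \<Sigma> ** Q ** Q'\<^sup>H ** \<Sigma>' ** Q' ** Q\<^sup>H)
        = det (mpow \<Sigma> (-1/2)) * det (mpow \<Sigma> (-1/2) ** Q ** Q'\<^sup>H ** \<Sigma>' ** Q' ** Q\<^sup>H)"
      by (simp add: mpow_half(5)[OF h(1), symmetric] det_mul mult_ac)
    also have "\<dots> = det ?M"
      by (simp add: whitened_def det_mul mult_ac)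
    also have "\<dots> = of_real (\<Prod>i\<in>UNIV. (s i)\<^sup>2)"
      unfolding M det_unitary_conj[OF AB(1)] by (simp add: det_dg)
    finally have "ln (Re (det (matrix_inv \<Sigma> ** Q ** Q'\<^sup>H ** \<Sigma>' ** Q' ** Q\<^sup>H))) = ln (\<Prod>i\<in>UNIV. (s i)\<^sup>2)"
      by (simp only: Re_complex_of_real)
    also have "\<dots> = Re (trace (mlog ?M))"
      unfolding tL s2(2)[symmetric] using s2(1) by (intro ln_prod) auto
    finally show ?thesis
      using nL tL hpd_spectral_form[OF AB(1) s2(1), of "\<lambda>i. i", folded M]
      unfolding div_formula_def whitened_def[symmetric] by simp
  qed
  obtain A B s where AB: "unitary A" "unitary B" and s: "\<And>i. 0 < s i"
    and Z: "mpow \<Sigma> (-1/2) ** Q ** Q'\<^sup>H ** mpow \<Sigma>' (1/2) = A ** rdg s ** B\<^sup>H"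
    using whitened_svd_exists[OF h Q] by blast
  note 1 = main[OF h Q AB s Z]
  show "hpd (whitened \<Sigma> \<Sigma>' Q Q')"
    and "div_formula \<alpha> \<beta> \<Sigma> \<Sigma>' Q \<Theta> Q' =
      \<alpha> * (norm (mlog (whitened \<Sigma> \<Sigma>' Q Q')))\<^sup>2 + \<beta> * (Re (trace (mlog (whitened \<Sigma> \<Sigma>' Q Q'))))\<^sup>2 + (norm \<Theta>)\<^sup>2"
    using 1 by blast+
  have inv_s: "0 < inverse (s i)" "ln (inverse (s i)) = - ln (s i)" for i
    using s[of i] by (simp_all add: ln_inverse)
  note 2 = main[OF h(2,1) Q(2,1) AB(2,1) inv_s(1) whitened_svd(2)[OF h Q AB s Z]]
  show "div_formula \<alpha> \<beta> \<Sigma>' \<Sigma> Q' \<Theta> Q = div_formula \<alpha> \<beta> \<Sigma> \<Sigma>' Q \<Theta> Q'"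
    using 1 2 by (simp add: inv_s(2) sum_negf)
qed

section \<open>The divergence on the quotient\<close>

lemma total_space_iff: "(U, \<Sigma>) \<in> total_space \<longleftrightarrow> U\<^sup>H ** U = mat 1 \<and> hpd \<Sigma>"
  by (simp add: total_space_def)

lemma quot_proj_iff:
  "(U', \<Sigma>') \<in> quot_proj (U, \<Sigma>) \<longleftrightarrow> (\<exists>R. unitary R \<and> U' = U ** R \<and> \<Sigma>' = R\<^sup>H ** \<Sigma> ** R)"
  by (auto simp: quot_proj_def)

lemma quot_proj_self: "x \<in> quot_proj x"
  by (cases x) (auto simp: quot_proj_iff intro!: exI[of _ "mat 1"])

lemma quot_proj_subset: "y \<in> quot_proj x \<Longrightarrow> quot_proj y \<subseteq> quot_proj x"
proof
  fix z assume y: "y \<in> quot_proj x" and z: "z \<in> quot_proj y"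
  obtain U \<Sigma> where x: "x = (U, \<Sigma>)"
    by fastforce
  obtain R where R: "unitary R" "y = (U ** R, R\<^sup>H ** \<Sigma> ** R)"
    using y by (auto simp: x quot_proj_def)
  obtain S where S: "unitary S" "z = (U ** R ** S, S\<^sup>H ** (R\<^sup>H ** \<Sigma> ** R) ** S)"
    using z by (auto simp: R quot_proj_def)
  have "z = (U ** (R ** S), (R ** S)\<^sup>H ** \<Sigma> ** (R ** S))"
    by (simp add: S ctranspose_mult matrix_assoc)
  moreover have "unitary (R ** S)"
    using R S by simp
  ultimately show "z \<in> quot_proj x"
    by (auto simp: x quot_proj_def)
qed

lemma quot_proj_sym: "y \<in> quot_proj x \<Longrightarrow> x \<in> quot_proj y"
proof -
  assume y: "y \<in> quot_proj x"
  obtain U \<Sigma> where x: "x = (U, \<Sigma>)"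
    by fastforce
  obtain R where R: "unitary R" "y = (U ** R, R\<^sup>H ** \<Sigma> ** R)"
    using y by (auto simp: x quot_proj_def)
  have "x = (U ** R ** R\<^sup>H, (R\<^sup>H)\<^sup>H ** (R\<^sup>H ** \<Sigma> ** R) ** R\<^sup>H)"
    using R(1) by (simp add: x matrix_assoc)
  moreover have "unitary (R\<^sup>H)"
    using R by simp
  ultimately show "x \<in> quot_proj y"
    unfolding R(2) quot_proj_def by blast
qed

lemma quot_proj_eq_iff: "quot_proj x = quot_proj y \<longleftrightarrow> y \<in> quot_proj x"
  using quot_proj_self quot_proj_subset quot_proj_sym by blast

lemma quot_proj_eqE:
  assumes "quot_proj (U, \<Sigma>) = quot_proj (U', \<Sigma>')"
  obtains R where "unitary R" "U' = U ** R" "\<Sigma>' = R\<^sup>H ** \<Sigma> ** R"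
  using assms by (auto simp: quot_proj_eq_iff quot_proj_iff)

lemma ctranspose_mult_self_eq_0: "X\<^sup>H ** X = 0 \<Longrightarrow> X = 0"
  using Re_trace_ctranspose_mult[of X X] by (simp add: trace_linear)

lemma whitened_eq_1_iff:
  assumes "hpd \<Sigma>" "unitary Q" "unitary Q'"
  shows "whitened \<Sigma> \<Sigma>' Q Q' = mat 1 \<longleftrightarrow> \<Sigma>' = (Q ** Q'\<^sup>H)\<^sup>H ** \<Sigma> ** (Q ** Q'\<^sup>H)"
proof -
  define R P where defs: "R = mpow \<Sigma> (-1/2)" "P = mpow \<Sigma> (1/2)"
  have H: "P ** P = \<Sigma>" "R ** P = mat 1" "P ** R = mat 1"
    using assms(1) unfolding defs by (blast intro: mpow_half)+
  have W: "whitened \<Sigma> \<Sigma>' Q Q' = R ** (Q ** Q'\<^sup>H ** \<Sigma>' ** Q' ** Q\<^sup>H) ** R"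
    unfolding whitened_def defs[symmetric] by (simp add: matrix_assoc)
  show ?thesis
  proof
    assume "whitened \<Sigma> \<Sigma>' Q Q' = mat 1"
    then have "P ** (R ** (Q ** Q'\<^sup>H ** \<Sigma>' ** Q' ** Q\<^sup>H) ** R) ** P = P ** P"
      unfolding W by simp
    then have "Q ** Q'\<^sup>H ** \<Sigma>' ** Q' ** Q\<^sup>H = \<Sigma>"
      by (simp add: matrix_assoc H inverse_cancel[OF H(2)] inverse_cancel[OF H(3)])
    then show "\<Sigma>' = (Q ** Q'\<^sup>H)\<^sup>H ** \<Sigma> ** (Q ** Q'\<^sup>H)"
      using assms by (auto simp: ctranspose_mult matrix_assoc)
  next
    assume "\<Sigma>' = (Q ** Q'\<^sup>H)\<^sup>H ** \<Sigma> ** (Q ** Q'\<^sup>H)"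
    then have e: "Q ** Q'\<^sup>H ** \<Sigma>' ** Q' ** Q\<^sup>H = P ** P"
      using assms H(1) by (simp add: ctranspose_mult matrix_assoc)
    show "whitened \<Sigma> \<Sigma>' Q Q' = mat 1"
      unfolding W e by (simp add: matrix_assoc H(2,3) inverse_cancel[OF H(2)])
  qed
qed

text \<open>A zero value kills both the logarithm and the angles. Then
  \<open>U\<^sup>H ** U'\<close> equals the unitary \<open>Q ** Q'\<^sup>H\<close>, and the Gram
  matrix of \<open>U' - U ** (Q ** Q'\<^sup>H)\<close> vanishes. Conversely, on a common orbit
  \<open>U\<^sup>H ** U'\<close> is unitary, so every cosine is 1 and the polar factor is the
  connecting matrix \<open>R\<close>.\<close>

lemma
  fixes U U' :: "complex^'k^'p"
  assumes \<alpha>: "0 < \<alpha>" and \<beta>: "- \<alpha> / real CARD('k) < \<beta>"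
    and x: "(U, \<Sigma>) \<in> total_space" and y: "(U', \<Sigma>') \<in> total_space"
    and svd: "cos_svd (U\<^sup>H ** U') Q \<Theta> Q'"
  shows div_formula_nonneg: "0 \<le> div_formula \<alpha> \<beta> \<Sigma> \<Sigma>' Q \<Theta> Q'"
    and div_formula_eq_0_iff:
      "div_formula \<alpha> \<beta> \<Sigma> \<Sigma>' Q \<Theta> Q' = 0 \<longleftrightarrow> quot_proj (U, \<Sigma>) = quot_proj (U', \<Sigma>')"
proof -
  obtain \<theta> where Q: "unitary Q" "unitary Q'" and \<Theta>: "\<Theta> = rdg \<theta>"
    and \<theta>: "\<And>i. 0 \<le> \<theta> i" "\<And>i. \<theta> i \<le> pi / 2"
    and A: "U\<^sup>H ** U' = Q ** rdg (\<lambda>i. cos (\<theta> i)) ** Q'\<^sup>H"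
    using cos_svdE[OF svd] by blast
  have h: "hpd \<Sigma>" "hpd \<Sigma>'" and U: "U\<^sup>H ** U = mat 1" "U'\<^sup>H ** U' = mat 1"
    using x y by (auto simp: total_space_iff)
  let ?M = "whitened \<Sigma> \<Sigma>' Q Q'"
  obtain \<delta> where \<delta>: "0 < \<delta>"
    "\<delta> * (norm (mlog ?M))\<^sup>2 \<le> \<alpha> * (norm (mlog ?M))\<^sup>2 + \<beta> * (Re (trace (mlog ?M)))\<^sup>2"
    using quadratic_form_bound[OF \<alpha> \<beta>] by blast
  then have lower: "\<delta> * (norm (mlog ?M))\<^sup>2 + (norm \<Theta>)\<^sup>2 \<le> div_formula \<alpha> \<beta> \<Sigma> \<Sigma>' Q \<Theta> Q'"
    unfolding div_formula_whitened[OF h Q] by simp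
  show "0 \<le> div_formula \<alpha> \<beta> \<Sigma> \<Sigma>' Q \<Theta> Q'"
    using \<delta>(1) by (intro order_trans[OF _ lower]) simp
  have zero: "div_formula \<alpha> \<beta> \<Sigma> \<Sigma>' Q \<Theta> Q' = 0 \<longleftrightarrow> mlog ?M = 0 \<and> \<Theta> = 0"
  proof
    assume 0: "div_formula \<alpha> \<beta> \<Sigma> \<Sigma>' Q \<Theta> Q' = 0"
    have "0 \<le> \<delta> * (norm (mlog ?M))\<^sup>2" "0 \<le> (norm \<Theta>)\<^sup>2"
      using \<delta>(1) by simp_all
    then have "\<delta> * (norm (mlog ?M))\<^sup>2 = 0 \<and> (norm \<Theta>)\<^sup>2 = 0"
      using lower[unfolded 0] by linarith
    then show "mlog ?M = 0 \<and> \<Theta> = 0"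
      using \<delta>(1) by simp
  next
    assume "mlog ?M = 0 \<and> \<Theta> = 0"
    then show "div_formula \<alpha> \<beta> \<Sigma> \<Sigma>' Q \<Theta> Q' = 0"
      unfolding div_formula_whitened[OF h Q] by (simp add: trace_linear)
  qed
  show "div_formula \<alpha> \<beta> \<Sigma> \<Sigma>' Q \<Theta> Q' = 0 \<longleftrightarrow> quot_proj (U, \<Sigma>) = quot_proj (U', \<Sigma>')"
    unfolding zero mlog_eq_0_iff[OF hpd_whitened[OF h Q]] whitened_eq_1_iff[OF h(1) Q]
  proof
    assume *: "\<Sigma>' = (Q ** Q'\<^sup>H)\<^sup>H ** \<Sigma> ** (Q ** Q'\<^sup>H) \<and> \<Theta> = 0"
    let ?O = "Q ** Q'\<^sup>H"
    have "\<theta> i = 0" for i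
      using * by (simp add: \<Theta> vec_eq_iff dg_nth split: if_splits)
    then have O: "U\<^sup>H ** U' = ?O"
      by (simp add: A)
    have OH: "U'\<^sup>H ** U = ?O\<^sup>H"
      using arg_cong[OF O, of ctranspose] by (simp add: ctranspose_mult)
    have "(U' - U ** ?O)\<^sup>H ** (U' - U ** ?O) =
        U'\<^sup>H ** U' - ?O\<^sup>H ** (U\<^sup>H ** U') - ((U'\<^sup>H ** U) ** ?O - ?O\<^sup>H ** ((U\<^sup>H ** U) ** ?O))"
      by (simp add: ctranspose_simps matrix_ring matrix_assoc)
    also have "\<dots> = 0"
      unfolding O OH U using Q by (simp add: ctranspose_mult matrix_assoc)
    finally have "U' = U ** ?O"
      using ctranspose_mult_self_eq_0 by fastforce
    then show "quot_proj (U, \<Sigma>) = quot_proj (U', \<Sigma>')"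
      using Q * unfolding quot_proj_eq_iff quot_proj_iff by (intro exI[of _ ?O]) simp
  next
    assume "quot_proj (U, \<Sigma>) = quot_proj (U', \<Sigma>')"
    then obtain R where R: "unitary R" "U' = U ** R" "\<Sigma>' = R\<^sup>H ** \<Sigma> ** R"
      by (rule quot_proj_eqE)
    have AR: "Q ** rdg (\<lambda>i. cos (\<theta> i)) ** Q'\<^sup>H = R"
      using A by (simp add: R(2) inverse_cancel[OF U(1)])
    have "rdg (\<lambda>i. cos (\<theta> i)) = Q\<^sup>H ** R ** Q'"
      using Q by (simp add: AR[symmetric] matrix_assoc)
    then have "unitary (rdg (\<lambda>i. cos (\<theta> i)))"
      using Q R(1) by simp
    from unitary_mult_left(1)[OF this]
    have "dg (\<lambda>i. of_real (cos (\<theta> i) * cos (\<theta> i))) = dg (\<lambda>i. 1)"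
      by simp
    then have c: "cos (\<theta> i) * cos (\<theta> i) = 1" for i
      unfolding dg_eq_iff by (metis of_real_eq_1_iff)
    have "\<theta> i = 0" for i
    proof (rule ccontr)
      assume "\<theta> i \<noteq> 0"
      then have "0 < \<theta> i" "\<theta> i \<le> pi"
        using \<theta>[of i] pi_ge_zero by linarith+
      then have "cos (\<theta> i) < cos 0"
        by (intro cos_monotone_0_pi) auto
      moreover have "0 \<le> cos (\<theta> i)"
        using \<theta>[of i] pi_ge_zero by (intro cos_ge_zero) linarith+
      ultimately have "cos (\<theta> i) * cos (\<theta> i) < 1"
        using mult_strict_mono[of "cos (\<theta> i)" 1 "cos (\<theta> i)" 1] by simp
      then show False
        by (simp add: c)
    qed
    then have "\<theta> = (\<lambda>i. 0)"
      by auto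
    then have "\<Theta> = 0" "R = Q ** Q'\<^sup>H"
      using AR by (simp_all add: \<Theta> vec_eq_iff dg_nth)
    then show "\<Sigma>' = (Q ** Q'\<^sup>H)\<^sup>H ** \<Sigma> ** (Q ** Q'\<^sup>H) \<and> \<Theta> = 0"
      using R(3) by simp
  qed
qed

text \<open>For an invertible matrix the polar factor \<open>Q ** Q'\<^sup>H\<close> and the principal angles are unique.\<close>

lemma div_formula_cong:
  fixes U1 U1' :: "complex^'k^'p"
  assumes h: "hpd \<Sigma>1" "hpd \<Sigma>1'"
    and x: "quot_proj (U1, \<Sigma>1) = quot_proj (U2, \<Sigma>2)"
    and y: "quot_proj (U1', \<Sigma>1') = quot_proj (U2', \<Sigma>2')"
    and svd1: "cos_svd (U1\<^sup>H ** U1') Q1 \<Theta>1 Q1'"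
    and svd2: "cos_svd (U2\<^sup>H ** U2') Q2 \<Theta>2 Q2'"
    and inv: "invertible (U1\<^sup>H ** U1')"
  shows "div_formula \<alpha> \<beta> \<Sigma>1 \<Sigma>1' Q1 \<Theta>1 Q1' = div_formula \<alpha> \<beta> \<Sigma>2 \<Sigma>2' Q2 \<Theta>2 Q2'"
proof -
  obtain R where R: "unitary R" "U2 = U1 ** R" "\<Sigma>2 = R\<^sup>H ** \<Sigma>1 ** R"
    using x by (rule quot_proj_eqE)
  obtain R' where R': "unitary R'" "U2' = U1' ** R'" "\<Sigma>2' = R'\<^sup>H ** \<Sigma>1' ** R'"
    using y by (rule quot_proj_eqE)
  obtain t1 where Q1: "unitary Q1" "unitary Q1'" and \<Theta>1: "\<Theta>1 = rdg t1"
    and t1: "\<And>i. 0 \<le> t1 i" "\<And>i. t1 i \<le> pi / 2"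
    and A1: "U1\<^sup>H ** U1' = Q1 ** rdg (\<lambda>i. cos (t1 i)) ** Q1'\<^sup>H"
    using cos_svdE[OF svd1] by blast
  obtain t2 where Q2: "unitary Q2" "unitary Q2'" and \<Theta>2: "\<Theta>2 = rdg t2"
    and t2: "\<And>i. 0 \<le> t2 i" "\<And>i. t2 i \<le> pi / 2"
    and A2: "U2\<^sup>H ** U2' = Q2 ** rdg (\<lambda>i. cos (t2 i)) ** Q2'\<^sup>H"
    using cos_svdE[OF svd2] by blast
  let ?c1 = "\<lambda>i. cos (t1 i)" and ?c2 = "\<lambda>i. cos (t2 i)"
  let ?X = "R ** Q2" and ?X' = "R' ** Q2'"
  have X: "unitary ?X" "unitary ?X'"
    using R R' Q2 by simp_all
  have cos_nonneg: "0 \<le> ?c1 i" "0 \<le> ?c2 i" for i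
    using t1[of i] t2[of i] by (auto intro!: cos_ge_zero)
  have "R\<^sup>H ** (U1\<^sup>H ** U1') ** R' = Q2 ** rdg ?c2 ** Q2'\<^sup>H"
    using A2 by (simp add: R R' ctranspose_mult matrix_assoc)
  then have "R ** (R\<^sup>H ** (U1\<^sup>H ** U1') ** R') ** R'\<^sup>H = ?X ** rdg ?c2 ** ?X'\<^sup>H"
    by (simp add: ctranspose_mult matrix_assoc)
  then have A3: "U1\<^sup>H ** U1' = ?X ** rdg ?c2 ** ?X'\<^sup>H"
    using R R' by (simp add: matrix_assoc)
  \<comment> \<open>Multiplying by the conjugate transpose eliminates the right unitary factor.
    Cosines and angles are then recovered from their squares by applying \<open>sqrt\<close> and
    \<open>arccos (sqrt x)\<close> to the eigenvalues, the cosines being nonnegative.\<close>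
  have "Q1 ** rdg (\<lambda>i. (?c1 i)\<^sup>2) ** Q1\<^sup>H = (U1\<^sup>H ** U1') ** (U1\<^sup>H ** U1')\<^sup>H"
    unfolding A1 using Q1 by (simp add: ctranspose_mult matrix_assoc power2_eq_square)
  also have "\<dots> = ?X ** rdg (\<lambda>i. (?c2 i)\<^sup>2) ** ?X\<^sup>H"
    unfolding A3 using R R' Q2 by (simp add: ctranspose_mult matrix_assoc power2_eq_square)
  finally have sq: "Q1 ** rdg (\<lambda>i. (?c1 i)\<^sup>2) ** Q1\<^sup>H = ?X ** rdg (\<lambda>i. (?c2 i)\<^sup>2) ** ?X\<^sup>H" .
  note fun_eq = spectral_fun_unique[OF Q1(1) X(1) sq]
  have "arccos (sqrt ((?c1 i)\<^sup>2)) = t1 i" "arccos (sqrt ((?c2 i)\<^sup>2)) = t2 i" for i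
    using cos_nonneg[of i] t1[of i] t2[of i] by (simp_all add: arccos_cos)
  then have "Q1 ** \<Theta>1 ** Q1\<^sup>H = ?X ** \<Theta>2 ** ?X\<^sup>H"
    using fun_eq[of "\<lambda>x. arccos (sqrt x)"] by (simp only: \<Theta>1 \<Theta>2)
  then have "norm (Q1 ** \<Theta>1 ** Q1\<^sup>H) = norm (?X ** \<Theta>2 ** ?X\<^sup>H)"
    by simp
  then have n: "norm \<Theta>1 = norm \<Theta>2"
    using Q1 X by (simp only: norm_unitary_mult unitary_ctranspose)
  let ?P = "Q1 ** rdg ?c1 ** Q1\<^sup>H"
  have P: "?P = ?X ** rdg ?c2 ** ?X\<^sup>H"
    using fun_eq[of sqrt] cos_nonneg by simp
  have polar1: "U1\<^sup>H ** U1' = ?P ** (Q1 ** Q1'\<^sup>H)"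
    unfolding A1 using Q1 by (simp add: matrix_assoc)
  have polar2: "U1\<^sup>H ** U1' = ?P ** (?X ** ?X'\<^sup>H)"
    unfolding A3 P using Q2 R by (simp add: ctranspose_mult matrix_assoc)
  \<comment> \<open>The positive factor can now be cancelled from \<open>polar1\<close> and
    \<open>polar2\<close>. On a kernel of \<open>?P\<close> the two unitary factors could
    differ.\<close>
  have "invertible ?P"
  proof -
    have "?P = (U1\<^sup>H ** U1') ** (Q1' ** Q1\<^sup>H)"
      unfolding A1 using Q1 by (simp add: matrix_assoc)
    moreover have "invertible (Q1' ** Q1\<^sup>H)"
      using Q1 by (intro unitary_invertible) simp
    ultimately show ?thesis
      using inv by (simp only: invertible_mult)
  qed
  then have polar: "Q1 ** Q1'\<^sup>H = ?X ** ?X'\<^sup>H"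
    using matrix_inv_cancel(2)[of ?P "Q1 ** Q1'\<^sup>H"] matrix_inv_cancel(2)[of ?P "?X ** ?X'\<^sup>H"]
      polar1 polar2 by simp
  define S where "S = mpow \<Sigma>1 (-1/2)"
  have S2: "mpow \<Sigma>2 (-1/2) = R\<^sup>H ** S ** R"
    unfolding R(3) S_def by (rule mpow_unitary_conj[OF h(1) R(1)])
  have "whitened \<Sigma>2 \<Sigma>2' Q2 Q2' = R\<^sup>H ** (S ** (?X ** ?X'\<^sup>H) ** \<Sigma>1' ** (?X ** ?X'\<^sup>H)\<^sup>H ** S) ** R"
    unfolding whitened_def S2 R'(3) using R by (simp add: ctranspose_mult matrix_assoc)
  also have "\<dots> = R\<^sup>H ** whitened \<Sigma>1 \<Sigma>1' Q1 Q1' ** R"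
    unfolding whitened_def S_def[symmetric] polar[symmetric] by (simp add: ctranspose_mult matrix_assoc)
  finally have "mlog (whitened \<Sigma>2 \<Sigma>2' Q2 Q2') = R\<^sup>H ** mlog (whitened \<Sigma>1 \<Sigma>1' Q1 Q1') ** R"
    using mlog_unitary_conj[OF hpd_whitened[OF h Q1] R(1)] by simp
  moreover have "norm (R\<^sup>H ** L ** R) = norm L" "trace (R\<^sup>H ** L ** R) = trace L" for L
    using norm_unitary_mult(1)[of "R\<^sup>H" "L"] norm_unitary_mult(2)[OF R(1), of "R\<^sup>H ** L"]
      trace_unitary_conj[of "R\<^sup>H" L] R(1) by (simp_all add: matrix_assoc)
  moreover have "hpd \<Sigma>2" "hpd \<Sigma>2'"
    using h R R' by (simp_all add: hpd_unitary_conj)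
  ultimately show ?thesis
    unfolding div_formula_whitened[OF h Q1] div_formula_whitened[OF \<open>hpd \<Sigma>2\<close> \<open>hpd \<Sigma>2'\<close> Q2] by (simp add: n)
qed

section \<open>Existence and evaluation of the divergence\<close>

definition div_values ::
  "real \<Rightarrow> real \<Rightarrow> ('p::finite, 'k::finite) point set \<Rightarrow> ('p, 'k) point set \<Rightarrow> real set" where
  "div_values \<alpha> \<beta> \<theta> \<theta>' = {r. \<exists>U \<Sigma> U' \<Sigma>' Q \<Theta> Q'.
     (U, \<Sigma>) \<in> total_space \<and> quot_proj (U, \<Sigma>) = \<theta> \<and>
     (U', \<Sigma>') \<in> total_space \<and> quot_proj (U', \<Sigma>') = \<theta>' \<and>
     cos_svd (U\<^sup>H ** U') Q \<Theta> Q' \<and> r = div_formula \<alpha> \<beta> \<Sigma> \<Sigma>' Q \<Theta> Q'}"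

lemma div_formula_swap_total:
  assumes "(U, \<Sigma>) \<in> total_space" "(U', \<Sigma>') \<in> total_space" "cos_svd (U\<^sup>H ** U') Q \<Theta> Q'"
  shows "div_formula \<alpha> \<beta> \<Sigma>' \<Sigma> Q' \<Theta> Q = div_formula \<alpha> \<beta> \<Sigma> \<Sigma>' Q \<Theta> Q'"
    and "cos_svd (U'\<^sup>H ** U) Q' \<Theta> Q"
proof -
  show "div_formula \<alpha> \<beta> \<Sigma>' \<Sigma> Q' \<Theta> Q = div_formula \<alpha> \<beta> \<Sigma> \<Sigma>' Q \<Theta> Q'"
    by (rule div_formula_swap) (use assms in \<open>auto simp: total_space_iff cos_svd_def\<close>)
  show "cos_svd (U'\<^sup>H ** U) Q' \<Theta> Q"
    using cos_svd_ctranspose[OF assms(3)] by (simp add: ctranspose_mult)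
qed

text \<open>\<open>svd_divergence\<close> ties the values of both orders to the same decomposition.
  Since both orders have the same set of values, choosing an element by \<open>SOME\<close>
  automatically makes the same choice for both.\<close>

lemma div_values_sym:
  fixes \<theta> \<theta>' :: "('p::finite, 'k::finite) point set"
  shows "div_values \<alpha> \<beta> \<theta> \<theta>' = div_values \<alpha> \<beta> \<theta>' \<theta>"
proof -
  have "r \<in> div_values \<alpha> \<beta> \<theta>' \<theta>" if "r \<in> div_values \<alpha> \<beta> \<theta> \<theta>'"
    for r and \<theta> \<theta>' :: "('p, 'k) point set"
  proof -
    obtain U \<Sigma> U' \<Sigma>' Q \<Theta> Q' where *: "(U, \<Sigma>) \<in> total_space" "quot_proj (U, \<Sigma>) = \<theta>"
      "(U', \<Sigma>') \<in> total_space" "quot_proj (U', \<Sigma>') = \<theta>'" "cos_svd (U\<^sup>H ** U') Q \<Theta> Q'"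
      "r = div_formula \<alpha> \<beta> \<Sigma> \<Sigma>' Q \<Theta> Q'"
      using \<open>r \<in> div_values \<alpha> \<beta> \<theta> \<theta>'\<close> unfolding div_values_def by blast
    show ?thesis
      unfolding div_values_def
      using * div_formula_swap_total(1)[OF *(1,3,5), of \<alpha> \<beta>] div_formula_swap_total(2)[OF *(1,3,5)]
      by (intro CollectI exI[of _ U'] exI[of _ \<Sigma>'] exI[of _ U] exI[of _ \<Sigma>] exI[of _ Q'] exI[of _ \<Theta>] exI[of _ Q]) simp
  qed
  then show ?thesis by blast
qed

lemma svd_divergence_exists:
  "\<exists>d :: ('p::finite, 'k::finite) point set \<Rightarrow> ('p, 'k) point set \<Rightarrow> real. svd_divergence \<alpha> \<beta> d"
proof
  define d :: "('p, 'k) point set \<Rightarrow> ('p, 'k) point set \<Rightarrow> real"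
    where "d \<theta> \<theta>' = (SOME r. r \<in> div_values \<alpha> \<beta> \<theta> \<theta>')" for \<theta> \<theta>'
  show "svd_divergence \<alpha> \<beta> d"
    unfolding svd_divergence_def
  proof (intro ballI)
    fix \<theta> \<theta>' :: "('p, 'k) point set"
    assume "\<theta> \<in> quot_manifold" "\<theta>' \<in> quot_manifold"
    then obtain U \<Sigma> U' \<Sigma>' where U: "(U, \<Sigma>) \<in> total_space" "\<theta> = quot_proj (U, \<Sigma>)"
      "(U', \<Sigma>') \<in> total_space" "\<theta>' = quot_proj (U', \<Sigma>')"
      by (auto simp: quot_manifold_def)
    obtain Q \<Theta> Q' where "cos_svd (U\<^sup>H ** U') Q \<Theta> Q'"
      using cos_svd_exists U by (metis total_space_iff)
    then have "div_formula \<alpha> \<beta> \<Sigma> \<Sigma>' Q \<Theta> Q' \<in> div_values \<alpha> \<beta> \<theta> \<theta>'"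
      unfolding div_values_def using U by blast
    then have "d \<theta> \<theta>' \<in> div_values \<alpha> \<beta> \<theta> \<theta>'"
      unfolding d_def by (rule someI)
    then obtain U \<Sigma> U' \<Sigma>' Q \<Theta> Q' where *: "(U, \<Sigma>) \<in> total_space" "quot_proj (U, \<Sigma>) = \<theta>"
      "(U', \<Sigma>') \<in> total_space" "quot_proj (U', \<Sigma>') = \<theta>'" "cos_svd (U\<^sup>H ** U') Q \<Theta> Q'"
      "d \<theta> \<theta>' = div_formula \<alpha> \<beta> \<Sigma> \<Sigma>' Q \<Theta> Q'"
      unfolding div_values_def by blast
    moreover have "d \<theta>' \<theta> = div_formula \<alpha> \<beta> \<Sigma>' \<Sigma> Q' \<Theta> Q"
      using *(6) div_formula_swap_total(1)[OF *(1,3,5), of \<alpha> \<beta>] by (simp add: d_def div_values_sym[of \<alpha> \<beta> \<theta>' \<theta>])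
    ultimately show "\<exists>U \<Sigma> U' \<Sigma>' Q \<Theta> Q'.
        (U, \<Sigma>) \<in> total_space \<and> quot_proj (U, \<Sigma>) = \<theta> \<and>
        (U', \<Sigma>') \<in> total_space \<and> quot_proj (U', \<Sigma>') = \<theta>' \<and>
        cos_svd (U\<^sup>H ** U') Q \<Theta> Q' \<and>
        d \<theta> \<theta>' = div_formula \<alpha> \<beta> \<Sigma> \<Sigma>' Q \<Theta> Q' \<and>
        d \<theta>' \<theta> = div_formula \<alpha> \<beta> \<Sigma>' \<Sigma> Q' \<Theta> Q"
      by blast
  qed
qed

lemma svd_divergenceD:
  assumes "svd_divergence \<alpha> \<beta> d" "\<theta> \<in> quot_manifold" "\<theta>' \<in> quot_manifold"
  obtains U \<Sigma> U' \<Sigma>' Q \<Theta> Q' where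
    "(U, \<Sigma>) \<in> total_space" "quot_proj (U, \<Sigma>) = \<theta>" "(U', \<Sigma>') \<in> total_space" "quot_proj (U', \<Sigma>') = \<theta>'"
    "cos_svd (U\<^sup>H ** U') Q \<Theta> Q'" "d \<theta> \<theta>' = div_formula \<alpha> \<beta> \<Sigma> \<Sigma>' Q \<Theta> Q'"
    "d \<theta>' \<theta> = div_formula \<alpha> \<beta> \<Sigma>' \<Sigma> Q' \<Theta> Q"
  using assms unfolding svd_divergence_def by meson

lemma svd_divergence_symmetric:
  fixes d :: "('p::finite, 'k::finite) point set \<Rightarrow> ('p, 'k) point set \<Rightarrow> real"
  assumes \<alpha>: "0 < \<alpha>" and \<beta>: "- \<alpha> / real CARD('k) < \<beta>" and d: "svd_divergence \<alpha> \<beta> d"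
  shows "symmetric_divergence_on quot_manifold d"
  unfolding symmetric_divergence_on_def
proof (intro ballI)
  fix \<theta> \<theta>' :: "('p, 'k) point set"
  assume \<theta>: "\<theta> \<in> quot_manifold" "\<theta>' \<in> quot_manifold"
  obtain U \<Sigma> U' \<Sigma>' Q \<Theta> Q' where *: "(U, \<Sigma>) \<in> total_space" "quot_proj (U, \<Sigma>) = \<theta>"
    "(U', \<Sigma>') \<in> total_space" "quot_proj (U', \<Sigma>') = \<theta>'"
    "cos_svd (U\<^sup>H ** U') Q \<Theta> Q'" "d \<theta> \<theta>' = div_formula \<alpha> \<beta> \<Sigma> \<Sigma>' Q \<Theta> Q'"
    "d \<theta>' \<theta> = div_formula \<alpha> \<beta> \<Sigma>' \<Sigma> Q' \<Theta> Q"
    by (rule svd_divergenceD[OF d \<theta>]) (rule that)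
  show "0 \<le> d \<theta> \<theta>' \<and> (d \<theta> \<theta>' = 0 \<longleftrightarrow> \<theta> = \<theta>') \<and> d \<theta> \<theta>' = d \<theta>' \<theta>"
    using div_formula_nonneg[OF \<alpha> \<beta> *(1,3,5)] div_formula_eq_0_iff[OF \<alpha> \<beta> *(1,3,5)]
      div_formula_swap_total(1)[OF *(1,3,5), of \<alpha> \<beta>] *(2,4,6,7) by simp
qed

lemma svd_divergence_eq:
  fixes d :: "('p::finite, 'k::finite) point set \<Rightarrow> ('p, 'k) point set \<Rightarrow> real"
  assumes d: "svd_divergence \<alpha> \<beta> d"
    and x: "(U, \<Sigma>) \<in> total_space" and y: "(U', \<Sigma>') \<in> total_space"
    and svd: "cos_svd (U\<^sup>H ** U') Q \<Theta> Q'" and inv: "invertible (U\<^sup>H ** U')"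
  shows "d (quot_proj (U, \<Sigma>)) (quot_proj (U', \<Sigma>')) = div_formula \<alpha> \<beta> \<Sigma> \<Sigma>' Q \<Theta> Q'"
proof -
  have "quot_proj (U, \<Sigma>) \<in> quot_manifold" "quot_proj (U', \<Sigma>') \<in> quot_manifold"
    using x y by (auto simp: quot_manifold_def)
  then obtain V T V' T' S \<Phi> S' where *: "(V, T) \<in> total_space" "quot_proj (V, T) = quot_proj (U, \<Sigma>)"
    "(V', T') \<in> total_space" "quot_proj (V', T') = quot_proj (U', \<Sigma>')"
    "cos_svd (V\<^sup>H ** V') S \<Phi> S'"
    "d (quot_proj (U, \<Sigma>)) (quot_proj (U', \<Sigma>')) = div_formula \<alpha> \<beta> T T' S \<Phi> S'"
    by (rule svd_divergenceD[OF d]) (rule that)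
  have "hpd \<Sigma>" "hpd \<Sigma>'"
    using x y by (auto simp: total_space_iff)
  from div_formula_cong[OF this *(2,4)[symmetric] svd *(5) inv] *(6)
  show ?thesis by simp
qed

section \<open>The metric along curves\<close>

text \<open>In this form \<Sigma> enters only through \<open>matrix_inv \<Sigma> ** a\<close>, the
  quantity that stays constant along the geodesic.\<close>

lemma riem_metric_eq:
  "riem_metric \<alpha> \<beta> (U, \<Sigma>) (\<xi>, a) (\<eta>, b) =
     inner \<xi> \<eta> - 1 / 2 * inner (U\<^sup>H ** \<xi>) (U\<^sup>H ** \<eta>)
     + \<alpha> * Re (trace ((matrix_inv \<Sigma> ** a) ** (matrix_inv \<Sigma> ** b)))
     + \<beta> * Re (trace (matrix_inv \<Sigma> ** a)) * Re (trace (matrix_inv \<Sigma> ** b))"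
proof -
  have "\<xi>\<^sup>H ** (mat 1 - (1 / 2) *\<^sub>R (U ** U\<^sup>H)) ** \<eta> = \<xi>\<^sup>H ** \<eta> - (1 / 2) *\<^sub>R ((U\<^sup>H ** \<xi>)\<^sup>H ** (U\<^sup>H ** \<eta>))"
    by (simp add: matrix_ring ctranspose_mult matrix_assoc)
  then have "Re (trace (\<xi>\<^sup>H ** (mat 1 - (1 / 2) *\<^sub>R (U ** U\<^sup>H)) ** \<eta>))
      = inner \<xi> \<eta> - 1 / 2 * inner (U\<^sup>H ** \<xi>) (U\<^sup>H ** \<eta>)"
    by (simp add: trace_linear Re_trace_ctranspose_mult[symmetric])
  then show ?thesis
    by (simp add: riem_metric_def matrix_assoc)
qed

lemmas has_vector_derivative_inner [derivative_intros] =
  bounded_bilinear.has_vector_derivative [OF bounded_bilinear_inner]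

lemmas has_vector_derivative_Re [derivative_intros] =
  bounded_linear.has_vector_derivative [OF bounded_linear_Re]

text \<open>\<open>W'\<close> is the derivative of \<open>matrix_inv (\<sigma> s) ** q s\<close>,
  with the rule for the inverse built in; the factor 2 comes from the symmetry of each term of the
  metric.\<close>

lemma has_vector_derivative_riem_metric:
  fixes v p :: "real \<Rightarrow> complex^'k^'p" and \<sigma> q :: "real \<Rightarrow> complex^'k^'k"
  assumes v: "(v has_vector_derivative v') (at s within T)"
    and p: "(p has_vector_derivative p') (at s within T)"
    and \<sigma>: "(\<sigma> has_vector_derivative \<sigma>') (at s within T)"
    and q: "(q has_vector_derivative q') (at s within T)"
    and inv: "invertible (\<sigma> s)" "\<And>r. r \<in> T \<Longrightarrow> invertible (\<sigma> r)"
  defines "W \<equiv> matrix_inv (\<sigma> s) ** q s"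
  defines "W' \<equiv> matrix_inv (\<sigma> s) ** q' - matrix_inv (\<sigma> s) ** (\<sigma>' ** W)"
  shows "((\<lambda>s. riem_metric \<alpha> \<beta> (v s, \<sigma> s) (p s, q s) (p s, q s)) has_vector_derivative
      2 * (inner (p s) p' - 1 / 2 * inner ((v s)\<^sup>H ** p s) (v'\<^sup>H ** p s + (v s)\<^sup>H ** p')
      + \<alpha> * Re (trace (W ** W')) + \<beta> * Re (trace W) * Re (trace W'))) (at s within T)"
proof -
  let ?W = "\<lambda>s. matrix_inv (\<sigma> s) ** q s"
  have W: "(?W has_vector_derivative W') (at s within T)"
    using has_vector_derivative_matrix_mult[OF has_vector_derivative_matrix_inv[OF \<sigma> inv] q]
    by (simp add: W'_def W_def matrix_ring matrix_assoc)
  have square: "((\<lambda>s. Re (trace (w s ** w s))) has_vector_derivative 2 * Re (trace (w s ** w'))) (at s within T)"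
      "((\<lambda>s. Re (trace (w s)) * Re (trace (w s))) has_vector_derivative 2 * (Re (trace (w s)) * Re (trace w')))
        (at s within T)"
    if "(w has_vector_derivative w') (at s within T)" for w :: "real \<Rightarrow> complex^'k^'k" and w'
    using trace_mul_sym[of "w s" w'] that
    by (auto intro!: derivative_eq_intros simp: trace_linear)
  have p2: "((\<lambda>s. inner (p s) (p s)) has_vector_derivative 2 * inner (p s) p') (at s within T)"
    by (auto intro!: derivative_eq_intros p simp: inner_commute)
  have vp2: "((\<lambda>s. inner ((v s)\<^sup>H ** p s) ((v s)\<^sup>H ** p s)) has_vector_derivative
      2 * inner ((v s)\<^sup>H ** p s) (v'\<^sup>H ** p s + (v s)\<^sup>H ** p')) (at s within T)"
    by (auto intro!: derivative_eq_intros v p simp: inner_commute inner_add)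
  have sum: "((\<lambda>s. a s - 1 / 2 * b s + \<alpha> * c s + \<beta> * d s) has_vector_derivative
      a' - 1 / 2 * b' + \<alpha> * c' + \<beta> * d') (at s within T)"
    if "(a has_vector_derivative a') (at s within T)" "(b has_vector_derivative b') (at s within T)"
      "(c has_vector_derivative c') (at s within T)" "(d has_vector_derivative d') (at s within T)"
    for a b c d :: "real \<Rightarrow> real" and a' b' c' d'
    using that by (auto intro!: derivative_eq_intros)
  show ?thesis
    unfolding riem_metric_eq mult.assoc[of \<beta>]
    by (rule has_vector_derivative_eq_rhs[OF sum[OF p2 vp2 square(1)[OF W] square(2)[OF W]]])
      (simp add: W_def algebra_simps)
qed

text \<open>\<open>proper_variation\<close> asks for continuity of the derivatives, not of
  \<open>F\<close> itself. Joint continuity of \<open>F\<close> follows from total differentiability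
  and is needed to differentiate the energy under the integral.\<close>

lemma continuous_on_of_partials:
  fixes F :: "real \<Rightarrow> real \<Rightarrow> 'a::real_normed_vector"
  assumes Fs: "\<And>s t. s \<in> A \<Longrightarrow> t \<in> B \<Longrightarrow> ((\<lambda>s. F s t) has_vector_derivative Fs s t) (at s)"
    and Ft: "\<And>s t. s \<in> A \<Longrightarrow> t \<in> B \<Longrightarrow> (F s has_vector_derivative Ft s t) (at t within B)"
    and cont: "continuous_on (A \<times> B) (\<lambda>(s, t). Ft s t)" and B: "convex B"
  shows "continuous_on (A \<times> B) (\<lambda>(s, t). F s t)"
proof -
  have "continuous (at x within A \<times> B) (\<lambda>(s, t). F s t)" if x: "x \<in> A \<times> B" for x
  proof -
    obtain s t where st: "x = (s, t)" "s \<in> A" "t \<in> B"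
      using x by auto
    have "continuous_on (A \<times> B) (\<lambda>(s, t). blinfun_scaleR_left (Ft s t))"
      using bounded_linear.continuous_on[OF bounded_linear_blinfun_scaleR_left cont]
      by (simp add: split_beta)
    then have c: "continuous (at (s, t) within A \<times> B) (\<lambda>(s, t). blinfun_scaleR_left (Ft s t))"
      using st by (simp add: continuous_on_eq_continuous_within)
    have 1: "((\<lambda>s. F s t) has_derivative (\<lambda>h. h *\<^sub>R Fs s t)) (at s within A)"
      using Fs[OF st(2,3)] has_vector_derivative_at_within unfolding has_vector_derivative_def
      by (metis has_derivative_at_withinI)
    have 2: "(F s has_derivative blinfun_apply (blinfun_scaleR_left (Ft s t))) (at t within B)"
      if "s \<in> A" "t \<in> B" for s t
      using Ft[OF that] by (simp add: has_vector_derivative_def)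
    have "((\<lambda>(s, t). F s t) has_derivative
        (\<lambda>(h, k). h *\<^sub>R Fs s t + blinfun_apply (blinfun_scaleR_left (Ft s t)) k)) (at (s, t) within A \<times> B)"
      by (rule has_derivative_partialsI[OF 1 2 c st(3) B])
    then show ?thesis
      unfolding st by (rule has_derivative_continuous)
  qed
  then show ?thesis
    by (simp add: continuous_on_eq_continuous_within)
qed

lemma inner_skew_hermitian: "K\<^sup>H = - K \<Longrightarrow> hermitian H \<Longrightarrow> inner K H = 0"
  using inner_ctranspose[of K H] by (simp add: hermitian_def)

lemma has_vector_derivative_const_eq_0:
  assumes "(f has_vector_derivative D) (at x)" "open T" "x \<in> T" "\<And>y. y \<in> T \<Longrightarrow> f y = c"
  shows "D = 0"
proof -
  have "((\<lambda>_. c) has_vector_derivative D) (at x)"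
    using assms by (intro has_vector_derivative_transform_within_open[OF assms(1-3)]) auto
  then show ?thesis
    using vector_derivative_unique_at[OF _ has_vector_derivative_const] by blast
qed

text \<open>
  Along the curve \<open>V\<close> is the lift of a geodesic of the Grassmannian and \<open>S\<close> is a geodesic of the affine
  invariant metric, so that \<open>S\<^sup>-\<^sup>1 S'\<close> is constant.
\<close>

locale product_geodesic =
  fixes V V1 :: "real \<Rightarrow> complex^'k^'p" and S :: "real \<Rightarrow> complex^'k^'k" and B H :: "complex^'k^'k"
  assumes total: "\<And>t. (V t, S t) \<in> total_space"
    and V: "\<And>t. (V has_vector_derivative V1 t) (at t)"
    and V1: "\<And>t. (V1 has_vector_derivative - (V t ** H)) (at t)"
    and VV1: "\<And>t. (V t)\<^sup>H ** V1 t = 0"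
    and H: "hermitian H"
    and S: "\<And>t. (S has_vector_derivative S t ** B) (at t)"
begin

abbreviation curve :: "real \<Rightarrow> ('p, 'k) point" where
  "curve t \<equiv> (V t, S t)"

abbreviation curve' :: "real \<Rightarrow> ('p, 'k) point" where
  "curve' t \<equiv> (V1 t, S t ** B)"

lemma hpd_S: "hpd (S t)"
  using total by (auto simp: total_space_iff)

lemma invertible_S: "invertible (S t)"
  by (rule hpd_invertible[OF hpd_S])

lemma has_vector_derivative_curve: "(curve has_vector_derivative curve' t) (at t within T)"
  by (intro has_vector_derivative_Pair has_vector_derivative_at_within[OF V] has_vector_derivative_at_within[OF S])

lemma velocity_curve: "t \<in> {0..1} \<Longrightarrow> velocity curve t = curve' t"
  unfolding velocity_def
  using vector_derivative_within_cbox[of 0 1 t curve "curve' t"] has_vector_derivative_curve by simp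

lemma continuous_on_curve: "continuous_on T V" "continuous_on T V1" "continuous_on T S"
  by (auto intro!: continuous_at_imp_continuous_on
      has_vector_derivative_continuous[OF V] has_vector_derivative_continuous[OF V1]
      has_vector_derivative_continuous[OF S])

lemma speed: "riem_metric \<alpha> \<beta> (curve t) (curve' t) (curve' t) =
    (norm (V1 t))\<^sup>2 + \<alpha> * Re (trace (B ** B)) + \<beta> * (Re (trace B))\<^sup>2"
  unfolding riem_metric_eq
  by (simp add: VV1 matrix_inv_cancel[OF invertible_S] power2_norm_eq_inner) (simp add: power2_eq_square)

lemma energy_critical:
  assumes F: "proper_variation total_space curve F"
  shows "((\<lambda>s. curve_energy (riem_metric \<alpha> \<beta>) (F s)) has_real_derivative 0) (at 0)"
proof -
  obtain \<epsilon> Fs Ft Fst where \<epsilon>: "0 < \<epsilon>"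
    and D: "\<forall>s\<in>{-\<epsilon><..<\<epsilon>}. \<forall>t\<in>{0..1}. F s t \<in> total_space \<and>
            ((\<lambda>s. F s t) has_vector_derivative Fs s t) (at s) \<and>
            (F s has_vector_derivative Ft s t) (at t within {0..1}) \<and>
            ((\<lambda>s. Ft s t) has_vector_derivative Fst s t) (at s) \<and>
            (Fs s has_vector_derivative Fst s t) (at t within {0..1})"
    and cont: "continuous_on ({-\<epsilon><..<\<epsilon>} \<times> {0..1}) (\<lambda>(s, t). Fs s t)"
      "continuous_on ({-\<epsilon><..<\<epsilon>} \<times> {0..1}) (\<lambda>(s, t). Ft s t)"
      "continuous_on ({-\<epsilon><..<\<epsilon>} \<times> {0..1}) (\<lambda>(s, t). Fst s t)"
    and F0: "\<forall>t\<in>{0..1}. F 0 t = curve t"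
    and Fend: "\<forall>s\<in>{-\<epsilon><..<\<epsilon>}. F s 0 = curve 0 \<and> F s 1 = curve 1"
    using F unfolding proper_variation_def by auto
  let ?I = "{-\<epsilon><..<\<epsilon>}" and ?J = "{0..1::real}"
  have contF: "continuous_on (?I \<times> ?J) (\<lambda>(s, t). F s t)"
    by (rule continuous_on_of_partials[where Fs = Fs, OF _ _ cont(2)]) (use D in auto)
  have I0: "0 \<in> ?I"
    using \<epsilon> by simp
  have fs: "((\<lambda>s. fst (F s t)) has_vector_derivative fst (Fs s t)) (at s)"
    "((\<lambda>s. snd (F s t)) has_vector_derivative snd (Fs s t)) (at s)"
    "((\<lambda>s. fst (Ft s t)) has_vector_derivative fst (Fst s t)) (at s)"
    "((\<lambda>s. snd (Ft s t)) has_vector_derivative snd (Fst s t)) (at s)"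
    "((\<lambda>t. fst (Fs s t)) has_vector_derivative fst (Fst s t)) (at t within ?J)"
    "((\<lambda>t. snd (Fs s t)) has_vector_derivative snd (Fst s t)) (at t within ?J)"
    if "s \<in> ?I" "t \<in> ?J" for s t
    using D that
    by (auto intro!: bounded_linear.has_vector_derivative[OF bounded_linear_fst]
        bounded_linear.has_vector_derivative[OF bounded_linear_snd])
  have total_F: "(fst (F s t))\<^sup>H ** fst (F s t) = mat 1" "invertible (snd (F s t))" if "s \<in> ?I" "t \<in> ?J" for s t
  proof -
    have "(fst (F s t), snd (F s t)) \<in> total_space"
      using D that by simp
    then show "(fst (F s t))\<^sup>H ** fst (F s t) = mat 1" "invertible (snd (F s t))"
      unfolding total_space_iff by (auto intro: hpd_invertible)
  qed
  define G where "G s t = riem_metric \<alpha> \<beta> (F s t) (Ft s t) (Ft s t)" for s t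
  define W where "W s t = matrix_inv (snd (F s t)) ** snd (Ft s t)" for s t
  define W' where "W' s t = matrix_inv (snd (F s t)) ** snd (Fst s t) - matrix_inv (snd (F s t)) ** (snd (Fs s t) ** W s t)" for s t
  define G' where "G' s t = 2 * (inner (fst (Ft s t)) (fst (Fst s t))
      - 1 / 2 * inner ((fst (F s t))\<^sup>H ** fst (Ft s t)) ((fst (Fs s t))\<^sup>H ** fst (Ft s t) + (fst (F s t))\<^sup>H ** fst (Fst s t))
      + \<alpha> * Re (trace (W s t ** W' s t)) + \<beta> * Re (trace (W s t)) * Re (trace (W' s t)))" for s t
  have G_deriv: "((\<lambda>s. G s t) has_vector_derivative G' s t) (at s within ?I)" if "s \<in> ?I" "t \<in> ?J" for s t
  proof -
    have "((\<lambda>s. riem_metric \<alpha> \<beta> (fst (F s t), snd (F s t)) (fst (Ft s t), snd (Ft s t)) (fst (Ft s t), snd (Ft s t)))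
        has_vector_derivative G' s t) (at s within ?I)"
      unfolding G'_def W'_def W_def
      by (rule has_vector_derivative_riem_metric)
         (use fs[OF that] total_F that in \<open>auto intro: has_vector_derivative_at_within\<close>)
    then show ?thesis
      by (simp add: G_def)
  qed
  have contF': "continuous_on (?I \<times> ?J) (\<lambda>x. F (fst x) (snd x))"
    "continuous_on (?I \<times> ?J) (\<lambda>x. Fs (fst x) (snd x))"
    "continuous_on (?I \<times> ?J) (\<lambda>x. Ft (fst x) (snd x))"
    "continuous_on (?I \<times> ?J) (\<lambda>x. Fst (fst x) (snd x))"
    using contF cont by (simp_all add: split_beta)
  have contG': "continuous_on (?I \<times> ?J) (\<lambda>(s, t). G' s t)"
    unfolding split_beta G'_def W'_def W_def
    by (intro continuous_intros contF') (use total_F in auto)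
  have contG: "continuous_on (?I \<times> ?J) (\<lambda>x. G (fst x) (snd x))"
  proof -
    have "G s t = riem_metric \<alpha> \<beta> (fst (F s t), snd (F s t)) (fst (Ft s t), snd (Ft s t)) (fst (Ft s t), snd (Ft s t))" for s t
      by (simp add: G_def)
    then show ?thesis
      unfolding riem_metric_eq
      by (simp only:) (intro continuous_intros contF', use total_F in auto)
  qed
  have int_G: "G s integrable_on cbox 0 1" if "s \<in> ?I" for s
  proof -
    have "continuous_on ?J (\<lambda>t. G (fst (s, t)) (snd (s, t)))"
      using that by (intro continuous_on_compose2[OF contG]) (auto intro!: continuous_intros)
    then show ?thesis
      using integrable_continuous[of 0 1 "G s"] by simp
  qed
  have leibniz: "((\<lambda>s. integral (cbox 0 1) (G s)) has_vector_derivative integral (cbox 0 1) (G' 0)) (at 0 within ?I)"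
    by (rule leibniz_rule_vector_derivative) (use G_deriv int_G contG' I0 in auto)
  have Ft_eq: "velocity (F s) t = Ft s t" if "s \<in> ?I" "t \<in> ?J" for s t
    unfolding velocity_def using D that vector_derivative_within_cbox[of 0 1 t "F s" "Ft s t"] by simp
  have energy: "curve_energy (riem_metric \<alpha> \<beta>) (F s) = 1 / 2 * integral (cbox 0 1) (G s)" if "s \<in> ?I" for s
    unfolding curve_energy_def G_def
    by (auto intro!: integral_cong simp: Ft_eq[OF that])
  have "integral (cbox 0 1) (G' 0) = 0"
  proof -
    have Ft0: "Ft 0 t = curve' t" if "t \<in> ?J" for t
    proof -
      have "(F 0 has_vector_derivative curve' t) (at t within cbox 0 1)"
        using F0 that by (intro has_vector_derivative_transform[OF _ _ has_vector_derivative_curve]) auto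
      moreover have "(F 0 has_vector_derivative Ft 0 t) (at t within cbox 0 1)"
        using D I0 that by simp
      ultimately show ?thesis
        using that vector_derivative_unique_within_closed_interval[of 0 1 t "F 0"] by simp
    qed
    let ?v = "\<lambda>t. fst (Fs 0 t)" and ?w = "\<lambda>t. fst (Fst 0 t)"
    let ?X = "\<lambda>t. matrix_inv (S t) ** snd (Fs 0 t)"
    let ?Y = "\<lambda>t. matrix_inv (S t) ** snd (Fst 0 t)"
    \<comment> \<open>The variation stays in the Stiefel factor, so
      \<open>(V t)\<^sup>H ** ?v t\<close> is skew-Hermitian and pairs to zero with the Hermitian
      \<open>H\<close>. The acceleration of \<open>V\<close> is thus orthogonal to the variation
      field.\<close>
    have tangent: "inner (?v t) (V t ** H) = 0" if t: "t \<in> ?J" for t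
    proof -
      have "((\<lambda>s. (fst (F s t))\<^sup>H ** fst (F s t)) has_vector_derivative
          (fst (F 0 t))\<^sup>H ** ?v t + (?v t)\<^sup>H ** fst (F 0 t)) (at 0)"
        using fs(1)[OF I0 t] by (intro derivative_intros)
      then have "(fst (F 0 t))\<^sup>H ** ?v t + (?v t)\<^sup>H ** fst (F 0 t) = 0"
        by (rule has_vector_derivative_const_eq_0[of _ _ _ ?I]) (use I0 total_F t in auto)
      then have "((V t)\<^sup>H ** ?v t)\<^sup>H = - ((V t)\<^sup>H ** ?v t)"
        using F0 t by (simp add: ctranspose_mult add_eq_0_iff)
      from inner_skew_hermitian[OF this H]
      show ?thesis
        using inner_matrix_mult_left[of "V t" H "?v t"] by (simp add: inner_commute)
    qed
    \<comment> \<open>Twice the metric pairing of the variation field with the velocity; the term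
      with factor 1/2 drops out by \<open>VV1\<close>.\<close>
    define \<Phi> where "\<Phi> t = 2 * (inner (?v t) (V1 t) + \<alpha> * Re (trace (B ** ?X t)) + \<beta> * Re (trace B) * Re (trace (?X t)))" for t
    have "(\<Phi> has_vector_derivative G' 0 t) (at t within ?J)" if t: "t \<in> ?J" for t
    proof -
      have X: "(?X has_vector_derivative ?Y t - B ** ?X t) (at t within ?J)"
        using has_vector_derivative_matrix_mult[OF has_vector_derivative_matrix_inv[OF
              has_vector_derivative_at_within[OF S] invertible_S invertible_S] fs(6)[OF I0 t]]
        by (simp add: matrix_ring matrix_assoc matrix_inv_cancel[OF invertible_S])
      have v: "((\<lambda>t. inner (?v t) (V1 t)) has_vector_derivative inner (?w t) (V1 t)) (at t within ?J)"
        using tangent[OF t]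
        by (auto intro!: derivative_eq_intros fs(5)[OF I0 t] has_vector_derivative_at_within[OF V1])
      have W: "W 0 t = B"
        using F0 t Ft0[OF t] by (simp add: W_def matrix_inv_cancel[OF invertible_S])
      have W': "W' 0 t = ?Y t - ?X t ** B"
        using F0 t by (simp add: W'_def W matrix_assoc)
      \<comment> \<open>\<open>W'\<close> contains \<open>?X t ** B\<close>, but the derivative of
        \<open>?X\<close> contains \<open>B ** ?X t\<close>. The two agree only under the
        traces.\<close>
      have tr: "trace (B ** (?Y t - ?X t ** B)) = trace (B ** (?Y t - B ** ?X t))"
        "trace (?Y t - ?X t ** B) = trace (?Y t - B ** ?X t)"
        using trace_mul_sym[of B "?X t ** B"] trace_mul_sym[of B "B ** ?X t"] trace_mul_sym[of B "?X t"]
          trace_mul_sym[of "B ** ?X t" B]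
        by (simp_all add: matrix_ring trace_linear matrix_assoc)
      have "G' 0 t = 2 * (inner (?w t) (V1 t) + \<alpha> * Re (trace (B ** (?Y t - B ** ?X t)))
          + \<beta> * Re (trace B) * Re (trace (?Y t - B ** ?X t)))"
        unfolding G'_def W W' tr using F0 t by (simp add: Ft0 VV1 inner_commute)
      moreover have "((\<lambda>t. 2 * (a t + \<alpha> * Re (trace (B ** x t)) + \<beta> * Re (trace B) * Re (trace (x t))))
          has_vector_derivative 2 * (a' + \<alpha> * Re (trace (B ** x')) + \<beta> * Re (trace B) * Re (trace x')))
          (at t within ?J)"
        if "(a has_vector_derivative a') (at t within ?J)" "(x has_vector_derivative x') (at t within ?J)"
        for a x a' x'
        using that by (auto intro!: derivative_eq_intros simp: matrix_ring)
      ultimately show ?thesis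
        unfolding \<Phi>_def using X v by simp
    qed
    then have "(G' 0 has_integral \<Phi> 1 - \<Phi> 0) ?J"
      by (intro fundamental_theorem_of_calculus) auto
    moreover have "Fs 0 0 = 0"
      by (rule has_vector_derivative_const_eq_0[of "\<lambda>s. F s 0" _ 0 ?I]) (use D Fend I0 in auto)
    moreover have "Fs 0 1 = 0"
      by (rule has_vector_derivative_const_eq_0[of "\<lambda>s. F s 1" _ 0 ?I]) (use D Fend I0 in auto)
    ultimately have "(G' 0 has_integral 0) ?J"
      by (simp add: \<Phi>_def matrix_ring trace_linear)
    then show ?thesis
      by (simp add: integral_unique)
  qed
  with leibniz have "((\<lambda>s. 1 / 2 * integral (cbox 0 1) (G s)) has_vector_derivative 0) (at 0 within ?I)"
    by (auto intro!: derivative_eq_intros)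
  then have "((\<lambda>s. 1 / 2 * integral (cbox 0 1) (G s)) has_vector_derivative 0) (at 0)"
    by (rule has_vector_derivative_within_open[THEN iffD1, rotated 2]) (use I0 in auto)
  then have "((\<lambda>s. curve_energy (riem_metric \<alpha> \<beta>) (F s)) has_vector_derivative 0) (at 0)"
    by (rule has_vector_derivative_transform_within_open[of _ _ _ ?I]) (use I0 energy in auto)
  then show ?thesis
    by (simp add: has_real_derivative_iff_has_vector_derivative)
qed

theorem geodesic: "geodesic total_space (riem_metric \<alpha> \<beta>) curve"
  unfolding geodesic_def
proof (intro conjI ballI allI impI)
  show "continuous_on {0..1} (velocity curve)"
    by (subst continuous_on_cong[OF refl velocity_curve]) (auto intro!: continuous_intros continuous_on_curve)
qed (use total velocity_curve has_vector_derivative_curve energy_critical in auto)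

lemma curve_length:
  assumes "\<And>t. (norm (V1 t))\<^sup>2 + \<alpha> * Re (trace (B ** B)) + \<beta> * (Re (trace B))\<^sup>2 = v" "0 \<le> v"
  shows "(curve_length (riem_metric \<alpha> \<beta>) curve)\<^sup>2 = v"
proof -
  have "curve_length (riem_metric \<alpha> \<beta>) curve = integral {0..1::real} (\<lambda>t. sqrt v)"
    unfolding curve_length_def
    by (intro integral_cong) (simp only: velocity_curve speed assms(1))
  then show ?thesis
    using assms(2) by simp
qed

end

section \<open>Vertical and horizontal vectors\<close>

text \<open>The derivative of the orbit map \<open>Q \<mapsto> act Q x\<close> at the identity in a
  skew-Hermitian direction \<open>W\<close>.\<close>

definition vert :: "('p::finite, 'k::finite) point \<Rightarrow> complex^'k^'k \<Rightarrow> ('p, 'k) point" where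
  "vert x W = (fst x ** W, snd x ** W - W ** snd x)"

definition act :: "complex^'k^'k \<Rightarrow> ('p::finite, 'k::finite) point \<Rightarrow> ('p, 'k) point" where
  "act Q x = (fst x ** Q, Q\<^sup>H ** snd x ** Q)"

lemma quot_proj_act: "quot_proj x = {act Q x | Q. unitary Q}"
  by (cases x) (simp add: quot_proj_def act_def)

lemma act_diff: "act Q (x - y) = act Q x - act Q y"
  by (simp add: act_def matrix_ring)

lemma total_spaceD:
  assumes "x \<in> total_space"
  shows "(fst x)\<^sup>H ** fst x = mat 1" "hpd (snd x)" "invertible (snd x)" "(snd x)\<^sup>H = snd x"
  using assms hpd_invertible hermitian_eqD hpd_hermitian by (cases x; auto simp: total_space_iff)+

lemma total_tangent_iff:
  "\<xi> \<in> total_tangent x \<longleftrightarrow>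
    hermitian (snd \<xi>) \<and> (fst x)\<^sup>H ** fst \<xi> + (fst \<xi>)\<^sup>H ** fst x = 0"
  by (cases x; cases \<xi>) (simp add: total_tangent_def)

text \<open>A curve in the orbit determines its unitary factor as
  \<open>(fst x)\<^sup>H ** fst (c t)\<close>, which is therefore differentiable; at the identity
  its derivative is skew-Hermitian. Conversely, the Cayley curve realises every such
  direction.\<close>

lemma vertical_eq:
  fixes x :: "('p::finite, 'k::finite) point"
  assumes x: "x \<in> total_space"
  shows "vertical x = vert x ` {W. skew W}"
proof (intro equalityI subsetI)
  fix v assume "v \<in> vertical x"
  then obtain c where c: "\<And>t. c t \<in> quot_proj x" "c 0 = x" "(c has_vector_derivative v) (at 0)"
    unfolding vertical_def tangent_vectors_def by blast
  define Q where "Q t = (fst x)\<^sup>H ** fst (c t)" for t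
  have Q: "unitary (Q t) \<and> c t = act (Q t) x" for t
  proof -
    obtain R where "unitary R" "c t = act R x"
      using c(1)[of t] unfolding quot_proj_act by blast
    then show ?thesis
      by (simp add: Q_def act_def inverse_cancel[OF total_spaceD(1)[OF x]])
  qed
  have Q0: "Q 0 = mat 1"
    by (simp add: Q_def c(2) total_spaceD(1)[OF x])
  define W where "W = (fst x)\<^sup>H ** fst v"
  have W: "(Q has_vector_derivative W) (at 0)"
    unfolding Q_def W_def using c(3)
    by (auto intro!: derivative_eq_intros bounded_linear.has_vector_derivative[OF bounded_linear_fst]
        simp: matrix_ring)
  have "((\<lambda>t. (Q t)\<^sup>H ** Q t) has_vector_derivative (Q 0)\<^sup>H ** W + W\<^sup>H ** Q 0) (at 0)"
    by (intro derivative_intros W)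
  then have "(Q 0)\<^sup>H ** W + W\<^sup>H ** Q 0 = 0"
    by (rule has_vector_derivative_const_eq_0[of _ _ _ UNIV]) (use Q in auto)
  then have skew: "W\<^sup>H = - W"
    by (simp add: Q0 add_eq_0_iff)
  have "((\<lambda>t. (fst x ** Q t, (Q t)\<^sup>H ** snd x ** Q t)) has_vector_derivative vert x W) (at 0)"
    unfolding vert_def
    by (auto intro!: derivative_eq_intros W simp: Q0 skew matrix_ring)
  moreover have "(\<lambda>t. (fst x ** Q t, (Q t)\<^sup>H ** snd x ** Q t)) = c"
    using Q by (simp add: fun_eq_iff act_def)
  ultimately have "v = vert x W"
    using c(3) vector_derivative_unique_at by metis
  then show "v \<in> vert x ` {W. skew W}"
    using skew by (simp add: skew_def)
next
  fix v assume "v \<in> vert x ` {W. skew W}"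
  then obtain W where W: "skew W" "v = vert x W"
    by auto
  have "act (cayley W t) x \<in> quot_proj x" for t
    using unitary_cayley[OF W(1)] quot_proj_act by blast
  moreover have "act (cayley W 0) x = x"
    by (simp add: act_def)
  moreover have "((\<lambda>t. act (cayley W t) x) has_vector_derivative v) (at 0)"
    unfolding act_def W(2) vert_def using has_vector_derivative_cayley[OF W(1)] W(1)
    by (auto intro!: derivative_eq_intros simp: matrix_ring skew_def)
  ultimately show "v \<in> vertical x"
    unfolding vertical_def tangent_vectors_def by (intro CollectI exI[of _ "\<lambda>t. act (cayley W t) x"]) auto
qed

lemma subspace_skew: "subspace {W. skew W}"
  by (auto simp: subspace_def skew_def ctranspose_linear)

lemma linear_vert: "linear (vert x)"
  by (auto intro!: linearI simp: vert_def matrix_ring scaleR_diff_right)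

lemma subspace_vertical: "x \<in> total_space \<Longrightarrow> subspace (vertical x)"
  by (simp add: vertical_eq linear_subspace_image linear_vert subspace_skew)

lemma subspace_total_tangent: "subspace (total_tangent x)"
proof -
  let ?T = "\<lambda>\<xi>. ((snd \<xi>)\<^sup>H - snd \<xi>, (fst x)\<^sup>H ** fst \<xi> + (fst \<xi>)\<^sup>H ** fst x)"
  have "linear ?T"
    by (rule linearI) (simp_all add: ctranspose_linear matrix_ring scaleR_add_right scaleR_diff_right)
  moreover have "total_tangent x = {\<xi>. ?T \<xi> = 0}"
    by (auto simp: total_tangent_iff hermitian_def zero_prod_def)
  ultimately show ?thesis
    using linear_subspace_kernel[of ?T] by simp
qed

lemma vertical_subset_tangent:
  assumes "x \<in> total_space"
  shows "vertical x \<subseteq> total_tangent x"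
  using total_spaceD[OF assms]
  by (auto simp: vertical_eq[OF assms] total_tangent_iff vert_def skew_def hermitian_def
      ctranspose_simps matrix_ring inverse_cancel matrix_assoc)

section \<open>Symmetry, bilinearity and positivity of the metric\<close>

lemma riem_metric_eq':
  "riem_metric \<alpha> \<beta> x \<xi> \<eta> =
     inner (fst \<xi>) (fst \<eta>) - 1 / 2 * inner ((fst x)\<^sup>H ** fst \<xi>) ((fst x)\<^sup>H ** fst \<eta>)
     + \<alpha> * Re (trace ((matrix_inv (snd x) ** snd \<xi>) ** (matrix_inv (snd x) ** snd \<eta>)))
     + \<beta> * Re (trace (matrix_inv (snd x) ** snd \<xi>)) * Re (trace (matrix_inv (snd x) ** snd \<eta>))"
  using riem_metric_eq[of \<alpha> \<beta> "fst x" "snd x" "fst \<xi>" "snd \<xi>" "fst \<eta>" "snd \<eta>"] by simp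

lemma riem_metric_sym: "riem_metric \<alpha> \<beta> x \<xi> \<eta> = riem_metric \<alpha> \<beta> x \<eta> \<xi>"
  unfolding riem_metric_eq'
  using trace_mul_sym[of "matrix_inv (snd x) ** snd \<xi>" "matrix_inv (snd x) ** snd \<eta>"]
  by (simp add: inner_commute)

lemma bilinear_riem_metric: "bilinear (riem_metric \<alpha> \<beta> x)"
  unfolding bilinear_def
  by (auto intro!: linearI simp: riem_metric_eq' matrix_ring trace_linear inner_add algebra_simps)

lemma linear_riem_metric:
  "linear (riem_metric \<alpha> \<beta> x \<xi>)" "linear (\<lambda>\<eta>. riem_metric \<alpha> \<beta> x \<eta> \<xi>)"
  using bilinear_riem_metric unfolding bilinear_def by blast+

lemmas riem_metric_linear =
  bilinear_ladd[OF bilinear_riem_metric] bilinear_radd[OF bilinear_riem_metric]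
  bilinear_lsub[OF bilinear_riem_metric] bilinear_rsub[OF bilinear_riem_metric]
  bilinear_lzero[OF bilinear_riem_metric] bilinear_rzero[OF bilinear_riem_metric]

text \<open>Replacing \<open>snd \<xi>\<close> by the Hermitian
  \<open>L = R ** snd \<xi> ** R\<close> turns the trace terms into the form of
  \<open>quadratic_form_bound\<close>. In the Stiefel part, projecting onto the columns of
  \<open>U\<close> does not increase the norm, so at least half of the squared norm remains.\<close>

lemma riem_metric_pos:
  fixes x :: "('p::finite, 'k::finite) point"
  assumes \<alpha>: "0 < \<alpha>" and \<beta>: "- \<alpha> / real CARD('k) < \<beta>"
    and x: "x \<in> total_space" and \<xi>: "\<xi> \<in> total_tangent x" "\<xi> \<noteq> 0"
  shows "0 < riem_metric \<alpha> \<beta> x \<xi> \<xi>"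
proof -
  let ?U = "fst x" and ?\<Sigma> = "snd x" and ?u = "fst \<xi>" and ?a = "snd \<xi>"
  note x' = total_spaceD[OF x]
  define R P where defs: "R = mpow ?\<Sigma> (-1/2)" "P = mpow ?\<Sigma> (1/2)"
  have H: "R\<^sup>H = R" "R ** R = matrix_inv ?\<Sigma>" "P ** R = mat 1" "R ** P = mat 1"
    using x'(2) unfolding defs by (blast intro: mpow_half)+
  define L where "L = R ** ?a ** R"
  have "L\<^sup>H = L"
    using \<xi>(1) by (simp add: L_def total_tangent_iff hermitian_def ctranspose_mult H(1) matrix_assoc)
  then have LL: "Re (trace (L ** L)) = (norm L)\<^sup>2"
    using Re_trace_ctranspose_mult[of L L] by (simp add: power2_norm_eq_inner)
  have t1: "trace (matrix_inv ?\<Sigma> ** ?a) = trace L"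
    using trace_mul_sym[of R "R ** ?a"] by (simp add: H(2)[symmetric] L_def matrix_assoc)
  have t2: "trace ((matrix_inv ?\<Sigma> ** ?a) ** (matrix_inv ?\<Sigma> ** ?a)) = trace (L ** L)"
    using trace_mul_sym[of R "R ** ?a ** R ** R ** ?a"] by (simp add: H(2)[symmetric] L_def matrix_assoc)
  have "inner (?u - ?U ** (?U\<^sup>H ** ?u)) (?u - ?U ** (?U\<^sup>H ** ?u)) = inner ?u ?u - inner (?U\<^sup>H ** ?u) (?U\<^sup>H ** ?u)"
    using inner_matrix_mult_left[of "?U\<^sup>H" ?u "?U\<^sup>H ** ?u"]
    by (simp add: inner_diff inner_commute inner_matrix_mult_left[of ?U] inverse_cancel[OF x'(1)])
  then have half: "1 / 2 * (norm ?u)\<^sup>2 \<le> inner ?u ?u - 1 / 2 * inner (?U\<^sup>H ** ?u) (?U\<^sup>H ** ?u)"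
    using inner_ge_zero[of "?u - ?U ** (?U\<^sup>H ** ?u)"] by (simp add: power2_norm_eq_inner)
  obtain \<delta> where \<delta>: "0 < \<delta>" "\<delta> * (norm L)\<^sup>2 \<le> \<alpha> * (norm L)\<^sup>2 + \<beta> * (Re (trace L))\<^sup>2"
    using quadratic_form_bound[OF \<alpha> \<beta>] by blast
  have lower: "1 / 2 * (norm ?u)\<^sup>2 + \<delta> * (norm L)\<^sup>2 \<le> riem_metric \<alpha> \<beta> x \<xi> \<xi>"
    using half \<delta>(2) unfolding riem_metric_eq' t1 t2 LL by (simp add: power2_eq_square)
  have "?u \<noteq> 0 \<or> L \<noteq> 0"
  proof (rule ccontr)
    assume 0: "\<not> (?u \<noteq> 0 \<or> L \<noteq> 0)"
    have "?a = P ** L ** P"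
      by (simp add: L_def matrix_assoc inverse_cancel[OF H(3)] H(4))
    then show False
      using 0 \<xi>(2) by (simp add: matrix_ring prod_eq_iff)
  qed
  then have "0 < (norm ?u)\<^sup>2 \<or> 0 < \<delta> * (norm L)\<^sup>2"
    using \<delta>(1) by auto
  moreover have "0 \<le> (norm ?u)\<^sup>2" "0 \<le> \<delta> * (norm L)\<^sup>2"
    using \<delta>(1) by auto
  ultimately have "0 < 1 / 2 * (norm ?u)\<^sup>2 + \<delta> * (norm L)\<^sup>2"
    by linarith
  with lower show ?thesis by simp
qed

text \<open>Gram--Schmidt, with coefficients that depend continuously on the parameter.\<close>

lemma riesz_continuous:
  fixes g :: "'t::topological_space \<Rightarrow> 'a::euclidean_space \<Rightarrow> 'a \<Rightarrow> real"
  assumes "finite E"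
    and bil: "\<And>t. t \<in> T \<Longrightarrow> bilinear (g t)" and sym: "\<And>t u w. t \<in> T \<Longrightarrow> g t u w = g t w u"
    and pos: "\<And>t u. t \<in> T \<Longrightarrow> u \<in> span E \<Longrightarrow> u \<noteq> 0 \<Longrightarrow> 0 < g t u u"
    and cont: "\<And>u w. continuous_on T u \<Longrightarrow> continuous_on T w \<Longrightarrow> continuous_on T (\<lambda>t. g t (u t) (w t))"
    and J: "\<And>t. t \<in> T \<Longrightarrow> linear (J t)" "\<And>u. continuous_on T u \<Longrightarrow> continuous_on T (\<lambda>t. J t (u t))"
  shows "\<exists>w. continuous_on T w \<and> (\<forall>t\<in>T. w t \<in> span E \<and> (\<forall>u\<in>span E. g t (w t) u = J t u))"
  using assms(1) pos J
proof (induction E arbitrary: J rule: finite_induct)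
  case empty
  show ?case
    by (rule exI[of _ "\<lambda>_. 0"]) (use empty.prems(2) bil in \<open>auto simp: bilinear_lzero linear_0\<close>)
next
  case (insert b E)
  show ?case
  proof (cases "b \<in> span E")
    case True
    then have "span (insert b E) = span E"
      by (rule span_redundant)
    then show ?thesis
      using insert.IH[of J] insert.prems by simp
  next
    case False
    have sub: "span E \<subseteq> span (insert b E)"
      by (intro span_mono) auto
    then have pos_E: "\<And>t u. t \<in> T \<Longrightarrow> u \<in> span E \<Longrightarrow> u \<noteq> 0 \<Longrightarrow> 0 < g t u u"
      using insert.prems(1) by blast
    obtain w0 where w0: "continuous_on T w0"
      "\<And>t. t \<in> T \<Longrightarrow> w0 t \<in> span E" "\<And>t u. t \<in> T \<Longrightarrow> u \<in> span E \<Longrightarrow> g t (w0 t) u = J t u"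
      using insert.IH[OF pos_E insert.prems(2,3)] by blast
    have "linear (g t b)" if "t \<in> T" for t
      using bil[OF that] by (simp add: bilinear_def)
    moreover have "continuous_on T (\<lambda>t. g t b (u t))" if "continuous_on T u" for u
      using cont[of "\<lambda>_. b" u] that by simp
    \<comment> \<open>The representer of the functional \<open>g t b\<close> on
      \<open>span E\<close> is the orthogonal projection of \<open>b\<close>; this is why the
      induction keeps \<open>J\<close> arbitrary.\<close>
    ultimately obtain p where p: "continuous_on T p"
      "\<And>t. t \<in> T \<Longrightarrow> p t \<in> span E" "\<And>t u. t \<in> T \<Longrightarrow> u \<in> span E \<Longrightarrow> g t (p t) u = g t b u"
      using insert.IH[OF pos_E, of "\<lambda>t. g t b"] by blast
    define b' where "b' t = b - p t" for t
    have b'_span: "b' t \<in> span (insert b E)" if "t \<in> T" for t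
      unfolding b'_def using p(2)[OF that] sub by (intro span_diff[OF span_base]) auto
    have b'_0: "b' t \<noteq> 0" if "t \<in> T" for t
      using p(2)[OF that] False by (auto simp: b'_def)
    have orth: "g t (b' t) u = 0" if "t \<in> T" "u \<in> span E" for t u
      using p(3)[OF that] bil[OF that(1)] by (simp add: b'_def bilinear_lsub)
    have b'_pos: "0 < g t (b' t) (b' t)" if "t \<in> T" for t
      using insert.prems(1) that b'_span b'_0 by blast
    have b'_cont: "continuous_on T b'"
      unfolding b'_def by (intro continuous_intros p)
    \<comment> \<open>\<open>w0\<close> already represents \<open>J t\<close> on
      \<open>span E\<close> and is orthogonal to \<open>b' t\<close>, so pairing with
      \<open>b' t\<close> determines the remaining coefficient.\<close>
    define k where "k t = J t (b' t) / g t (b' t) (b' t)" for t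
    define w where "w t = w0 t + k t *\<^sub>R b' t" for t
    have "continuous_on T w"
      unfolding w_def k_def
      by (intro continuous_intros w0 insert.prems cont b'_cont) (use b'_pos in force)
    moreover have "w t \<in> span (insert b E)" if "t \<in> T" for t
      unfolding w_def using w0(2)[OF that] b'_span[OF that] sub by (intro span_add span_scale) auto
    moreover have "g t (w t) u = J t u" if t: "t \<in> T" and u: "u \<in> span (insert b E)" for t u
    proof -
      obtain c where "u - c *\<^sub>R b \<in> span E"
        using u by (auto simp: span_insert)
      then have e: "u - c *\<^sub>R b' t \<in> span E"
        using span_add[OF _ span_scale[OF p(2)[OF t], of c]] by (fastforce simp: b'_def algebra_simps)
      define e where "e = u - c *\<^sub>R b' t"
      have u_eq: "u = e + c *\<^sub>R b' t"
        by (simp add: e_def)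
      have "g t (w0 t) (b' t) = 0"
        using orth[OF t w0(2)[OF t]] sym[OF t] by simp
      then have "g t (w t) u = J t e + c * (k t * g t (b' t) (b' t))"
        unfolding u_eq w_def using bil[OF t] orth[OF t e[folded e_def]] w0(3)[OF t e[folded e_def]]
        by (simp add: bilinear_ladd bilinear_radd bilinear_lmul bilinear_rmul)
      also have "k t * g t (b' t) (b' t) = J t (b' t)"
        using b'_pos[OF t] by (simp add: k_def)
      also have "J t e + c * J t (b' t) = J t u"
        unfolding u_eq using insert.prems(2)[OF t] by (simp add: linear_add linear_scale)
      finally show ?thesis .
    qed
    ultimately show ?thesis by blast
  qed
qed

lemma continuous_on_riem_metric [continuous_intros]:
  assumes "continuous_on T c" "continuous_on T \<xi>" "continuous_on T \<eta>" "\<And>t. t \<in> T \<Longrightarrow> c t \<in> total_space"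
  shows "continuous_on T (\<lambda>t. riem_metric \<alpha> \<beta> (c t) (\<xi> t) (\<eta> t))"
  unfolding riem_metric_eq'
  by (intro continuous_intros assms(1-3)) (use total_spaceD(3) assms(4) in blast)+

text \<open>The vertical spaces move with \<open>t\<close>, so the vertical part is sought in the
  fixed space of skew-Hermitian matrices, to which \<open>vert (c t)\<close> pulls the metric back.
  The pulled-back form is positive because \<open>fst (c t)\<close> has orthonormal columns, so that
  \<open>vert (c t)\<close> is injective.\<close>

lemma horizontal_decomposition:
  fixes c :: "'t::topological_space \<Rightarrow> ('p::finite, 'k::finite) point"
  assumes \<alpha>: "0 < \<alpha>" and \<beta>: "- \<alpha> / real CARD('k) < \<beta>"
    and c: "continuous_on T c" "\<And>t. t \<in> T \<Longrightarrow> c t \<in> total_space"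
    and v: "continuous_on T v" "\<And>t. t \<in> T \<Longrightarrow> v t \<in> total_tangent (c t)"
  obtains h where "continuous_on T h"
    "\<And>t. t \<in> T \<Longrightarrow> h t \<in> horizontal \<alpha> \<beta> (c t)" "\<And>t. t \<in> T \<Longrightarrow> v t - h t \<in> vertical (c t)"
proof -
  obtain E :: "(complex^'k^'k) set" where E: "independent E" "span E = {W. skew W}"
    using basis_exists[of "{W :: complex^'k^'k. skew W}"] subspace_skew span_subspace by metis
  have fin: "finite E"
    using E(1) by (rule independent_imp_finite)
  let ?g = "\<lambda>t W W'. riem_metric \<alpha> \<beta> (c t) (vert (c t) W) (vert (c t) W')"
  let ?J = "\<lambda>t W. riem_metric \<alpha> \<beta> (c t) (v t) (vert (c t) W)"
  have cont_vert: "continuous_on T (\<lambda>t. vert (c t) (u t))" if "continuous_on T u" for u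
    unfolding vert_def by (intro continuous_intros c that)
  have "\<exists>w. continuous_on T w \<and> (\<forall>t\<in>T. w t \<in> span E \<and> (\<forall>u\<in>span E. ?g t (w t) u = ?J t u))"
  proof (rule riesz_continuous[OF fin])
    fix t assume t: "t \<in> T"
    note comp = linear_compose[OF linear_vert, unfolded o_def]
    show "bilinear (?g t)"
      unfolding bilinear_def by (intro conjI allI comp[OF linear_riem_metric(1)] comp[OF linear_riem_metric(2)])
    show "linear (?J t)"
      by (rule comp[OF linear_riem_metric(1)])
    show "?g t u w = ?g t w u" for u w
      by (rule riem_metric_sym)
    fix u assume u: "u \<in> span E" "u \<noteq> 0"
    have "fst (vert (c t) u) \<noteq> 0"
    proof
      assume 0: "fst (vert (c t) u) = 0"
      have "u = (fst (c t))\<^sup>H ** fst (vert (c t) u)"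
        by (simp add: vert_def inverse_cancel[OF total_spaceD(1)[OF c(2)[OF t]]])
      with 0 u(2) show False
        by (simp add: matrix_ring)
    qed
    moreover have "vert (c t) u \<in> total_tangent (c t)"
      using vertical_subset_tangent[OF c(2)[OF t]] vertical_eq[OF c(2)[OF t]] u(1) E(2) by auto
    ultimately show "0 < ?g t u u"
      using riem_metric_pos[OF \<alpha> \<beta> c(2)[OF t]] by fastforce
  qed (use c v cont_vert in \<open>auto intro!: continuous_intros\<close>)
  then obtain w where w: "continuous_on T w" "\<And>t. t \<in> T \<Longrightarrow> skew (w t)"
    "\<And>t W. t \<in> T \<Longrightarrow> skew W \<Longrightarrow> ?g t (w t) W = ?J t W"
    using E(2) by auto
  define h where "h t = v t - vert (c t) (w t)" for t
  have vert_w: "vert (c t) (w t) \<in> vertical (c t)" if "t \<in> T" for t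
    using w(2) vertical_eq[OF c(2)] that by auto
  show ?thesis
  proof
    show "continuous_on T h"
      unfolding h_def by (intro continuous_intros v cont_vert w)
    show "v t - h t \<in> vertical (c t)" if "t \<in> T" for t
      using vert_w[OF that] by (simp add: h_def)
    show "h t \<in> horizontal \<alpha> \<beta> (c t)" if t: "t \<in> T" for t
      unfolding horizontal_def
    proof (intro CollectI conjI ballI)
      show "h t \<in> total_tangent (c t)"
        unfolding h_def using v(2)[OF t] vert_w[OF t] vertical_subset_tangent[OF c(2)[OF t]]
        by (intro subspace_diff[OF subspace_total_tangent]) auto
      fix u assume "u \<in> vertical (c t)"
      then obtain W where "skew W" "u = vert (c t) W"
        using vertical_eq[OF c(2)[OF t]] by auto
      then show "riem_metric \<alpha> \<beta> (c t) (h t) u = 0"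
        using w(3)[OF t] by (simp add: h_def riem_metric_linear)
    qed
  qed
qed

text \<open>Two candidates differ by a vertical vector that is orthogonal to itself, hence zero by
  positivity; this justifies the definite description.\<close>

lemma horizontal_part_eqI:
  fixes x :: "('p::finite, 'k::finite) point"
  assumes \<alpha>: "0 < \<alpha>" and \<beta>: "- \<alpha> / real CARD('k) < \<beta>"
    and x: "x \<in> total_space" and \<eta>: "\<eta> \<in> horizontal \<alpha> \<beta> x" "\<xi> - \<eta> \<in> vertical x"
  shows "horizontal_part \<alpha> \<beta> x \<xi> = \<eta>"
  unfolding horizontal_part_def
proof (rule the_equality)
  fix \<zeta> assume \<zeta>: "\<zeta> \<in> horizontal \<alpha> \<beta> x \<and> \<xi> - \<zeta> \<in> vertical x"
  have "(\<xi> - \<eta>) - (\<xi> - \<zeta>) \<in> vertical x"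
    by (rule subspace_diff[OF subspace_vertical[OF x]]) (use \<eta> \<zeta> in auto)
  then have d: "\<zeta> - \<eta> \<in> vertical x"
    by simp
  then have "riem_metric \<alpha> \<beta> x (\<zeta> - \<eta>) (\<zeta> - \<eta>) = 0"
    using \<eta> \<zeta> by (simp add: horizontal_def riem_metric_linear(3)[of _ _ _ _ _ "\<zeta> - \<eta>"])
  then show "\<zeta> = \<eta>"
    using riem_metric_pos[OF \<alpha> \<beta> x, of "\<zeta> - \<eta>"] d vertical_subset_tangent[OF x] by fastforce
qed (use \<eta> in simp)

section \<open>Invariance of the metric and of the splitting under the unitary action\<close>

lemma act_total_space:
  assumes "x \<in> total_space" "unitary Q"
  shows "act Q x \<in> total_space"
proof -
  have "(fst x ** Q)\<^sup>H ** (fst x ** Q) = mat 1"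
    using assms by (simp add: ctranspose_mult matrix_assoc inverse_cancel[OF total_spaceD(1)])
  then show ?thesis
    using assms by (simp add: act_def total_space_iff hpd_unitary_conj total_spaceD(2))
qed

lemma matrix_inv_unitary_conj:
  assumes "invertible A" "unitary Q"
  shows "matrix_inv (Q\<^sup>H ** A ** Q) = Q\<^sup>H ** matrix_inv A ** Q"
  by (rule matrix_inv_unique) (use assms in \<open>simp add: matrix_assoc matrix_inv_cancel\<close>)

lemma riem_metric_act:
  fixes x :: "('p::finite, 'k::finite) point"
  assumes x: "x \<in> total_space" and Q: "unitary Q"
  shows "riem_metric \<alpha> \<beta> (act Q x) (act Q \<xi>) (act Q \<eta>) = riem_metric \<alpha> \<beta> x \<xi> \<eta>"
proof -
  have conj: "trace (Q\<^sup>H ** A ** Q) = trace A" for A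
    using trace_unitary_conj[of "Q\<^sup>H" A] Q by (simp add: matrix_assoc)
  have mult: "(Q\<^sup>H ** A ** Q) ** (Q\<^sup>H ** B ** Q) = Q\<^sup>H ** (A ** B) ** Q" for A B
    using Q by (simp add: matrix_assoc)
  have inner: "inner (A ** Q) (B ** Q) = inner A B" for A B :: "complex^'k^'p"
    using Q by (simp add: inner_matrix_mult_right matrix_assoc)
  have inner_conj: "inner (Q\<^sup>H ** A ** Q) (Q\<^sup>H ** B ** Q) = inner A B" for A B
  proof -
    have "inner (A ** Q) (B ** Q) = inner A B" "inner (Q\<^sup>H ** A) (Q\<^sup>H ** B) = inner A B"
      for A B :: "complex^'k^'k"
      using Q by (simp_all add: inner_matrix_mult_right[of A] inner_matrix_mult_left[of _ A] matrix_assoc)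
    then show ?thesis by simp
  qed
  have fst_act: "(fst (act Q x))\<^sup>H ** fst (act Q \<zeta>) = Q\<^sup>H ** ((fst x)\<^sup>H ** fst \<zeta>) ** Q"
    "fst (act Q \<zeta>) = fst \<zeta> ** Q" for \<zeta> :: "('p, 'k) point"
    by (simp_all add: act_def ctranspose_mult matrix_assoc)
  have snd_act: "matrix_inv (snd (act Q x)) ** snd (act Q \<zeta>) = Q\<^sup>H ** (matrix_inv (snd x) ** snd \<zeta>) ** Q"
    for \<zeta> :: "('p, 'k) point"
    unfolding act_def snd_conv matrix_inv_unitary_conj[OF total_spaceD(3)[OF x] Q] using Q
    by (simp add: matrix_assoc)
  show ?thesis
    unfolding riem_metric_eq' fst_act(1) snd_act mult conj inner_conj unfolding fst_act(2) inner ..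
qed

lemma act_tangent:
  assumes "\<xi> \<in> total_tangent x"
  shows "act Q \<xi> \<in> total_tangent (act Q x)"
proof -
  have "(fst (act Q x))\<^sup>H ** fst (act Q \<xi>) + (fst (act Q \<xi>))\<^sup>H ** fst (act Q x)
      = Q\<^sup>H ** ((fst x)\<^sup>H ** fst \<xi> + (fst \<xi>)\<^sup>H ** fst x) ** Q"
    by (simp add: act_def ctranspose_mult matrix_assoc matrix_ring)
  also have "(fst x)\<^sup>H ** fst \<xi> + (fst \<xi>)\<^sup>H ** fst x = 0"
    using assms total_tangent_iff by blast
  finally show ?thesis
    using assms by (simp add: total_tangent_iff hermitian_conj matrix_ring) (simp add: act_def hermitian_conj)
qed

lemma act_vertical:
  assumes x: "x \<in> total_space" and Q: "unitary Q"
  shows "vertical (act Q x) = act Q ` vertical x"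
proof -
  have vert: "act Q (vert x W) = vert (act Q x) (Q\<^sup>H ** W ** Q)" for W
    using Q by (simp add: act_def vert_def matrix_assoc matrix_ring)
  have skew: "skew (Q\<^sup>H ** W ** Q)" "skew (Q ** W ** Q\<^sup>H)" if "skew W" for W
    using that by (simp_all add: skew_def ctranspose_mult matrix_assoc matrix_ring)
  have "vert (act Q x) W \<in> act Q ` vert x ` {W. skew W}" if "skew W" for W
  proof -
    have "vert (act Q x) W = act Q (vert x (Q ** W ** Q\<^sup>H))"
      unfolding vert using Q by (simp add: matrix_assoc)
    then show ?thesis
      using skew(2)[OF that] by blast
  qed
  moreover have "act Q (vert x W) \<in> vert (act Q x) ` {W. skew W}" if "skew W" for W
    unfolding vert using skew(1)[OF that] by blast
  ultimately show ?thesis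
    unfolding vertical_eq[OF x] vertical_eq[OF act_total_space[OF x Q]] by blast
qed

lemma act_horizontal:
  assumes x: "x \<in> total_space" and Q: "unitary Q" and \<xi>: "\<xi> \<in> horizontal \<alpha> \<beta> x"
  shows "act Q \<xi> \<in> horizontal \<alpha> \<beta> (act Q x)"
  using \<xi> act_tangent[of \<xi> x Q] by (auto simp: horizontal_def act_vertical[OF x Q] riem_metric_act[OF x Q])

section \<open>Comparison of lifts, speed and length in the quotient\<close>

lemma has_vector_derivative_unique_01:
  assumes "(f has_vector_derivative D) (at t within {0..1})" "(g has_vector_derivative E) (at t within {0..1})"
    and "t \<in> {0..1}" "\<And>t. t \<in> {0..1} \<Longrightarrow> f t = g t"
  shows "D = E"
proof -
  have "(f has_vector_derivative E) (at t within {0..1})"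
    by (rule has_vector_derivative_transform[OF assms(3) _ assms(2)]) (use assms(4) in simp)
  then show ?thesis
    using vector_derivative_unique_within_closed_interval[of 0 1 t f D E] assms(1,3) by simp
qed

text \<open>Both tangency equations are the differentiated constraints
  \<open>(snd (c t))\<^sup>H = snd (c t)\<close> and
  \<open>(fst (c t))\<^sup>H ** fst (c t) = mat 1\<close>.\<close>

lemma derivative_total_tangent:
  assumes c: "\<And>t. t \<in> {0..1} \<Longrightarrow> c t \<in> total_space"
    and v: "(c has_vector_derivative v) (at t within {0..1})" and t: "t \<in> {0..1}"
  shows "v \<in> total_tangent (c t)"
proof -
  have d: "((\<lambda>t. fst (c t)) has_vector_derivative fst v) (at t within {0..1})"
    "((\<lambda>t. snd (c t)) has_vector_derivative snd v) (at t within {0..1})"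
    using v by (auto intro: bounded_linear.has_vector_derivative[OF bounded_linear_fst]
        bounded_linear.has_vector_derivative[OF bounded_linear_snd])
  have "(snd v)\<^sup>H = snd v"
    by (rule has_vector_derivative_unique_01[OF has_vector_derivative_ctranspose[OF d(2)] d(2) t])
       (rule total_spaceD(4)[OF c])
  moreover have "(fst (c t))\<^sup>H ** fst v + (fst v)\<^sup>H ** fst (c t) = 0"
    by (rule has_vector_derivative_unique_01[OF has_vector_derivative_matrix_mult[OF
            has_vector_derivative_ctranspose[OF d(1)] d(1)] has_vector_derivative_const t])
       (rule total_spaceD(1)[OF c])
  ultimately show ?thesis
    by (simp add: total_tangent_iff hermitian_def)
qed

text \<open>The unitary matrix relating the lifts is given pointwise only, but it equals
  \<open>(fst (c t))\<^sup>H ** fst (c' t)\<close> and so inherits differentiability. The product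
  rule then splits \<open>v'\<close> into the transported velocity and a motion inside the
  orbit.\<close>

lemma lift_change:
  fixes c c' :: "real \<Rightarrow> ('p::finite, 'k::finite) point"
  assumes c: "\<And>t. t \<in> {0..1} \<Longrightarrow> c t \<in> total_space" and c': "\<And>t. t \<in> {0..1} \<Longrightarrow> c' t \<in> total_space"
    and eq: "\<And>t. t \<in> {0..1} \<Longrightarrow> quot_proj (c t) = quot_proj (c' t)"
    and v: "(c has_vector_derivative v) (at t within {0..1})"
    and v': "(c' has_vector_derivative v') (at t within {0..1})" and t: "t \<in> {0..1}"
  obtains Q where "unitary Q" "c' t = act Q (c t)" "v' - act Q v \<in> vertical (c' t)"
proof -
  define Q where "Q t = (fst (c t))\<^sup>H ** fst (c' t)" for t
  have Q: "unitary (Q t) \<and> c' t = act (Q t) (c t)" if s: "t \<in> {0..1}" for t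
  proof -
    have "c' t \<in> quot_proj (c t)"
      using eq[OF s] by (simp only: quot_proj_eq_iff)
    then obtain R where "unitary R" "c' t = act R (c t)"
      unfolding quot_proj_act by (elim CollectE exE conjE)
    then show ?thesis
      by (simp add: Q_def act_def inverse_cancel[OF total_spaceD(1)[OF c[OF s]]])
  qed
  have d: "((\<lambda>t. fst (c t)) has_vector_derivative fst v) (at t within {0..1})"
    "((\<lambda>t. snd (c t)) has_vector_derivative snd v) (at t within {0..1})"
    "((\<lambda>t. fst (c' t)) has_vector_derivative fst v') (at t within {0..1})"
    using v v' by (auto intro: bounded_linear.has_vector_derivative[OF bounded_linear_fst]
        bounded_linear.has_vector_derivative[OF bounded_linear_snd])
  define Q' where "Q' = (fst (c t))\<^sup>H ** fst v' + (fst v)\<^sup>H ** fst (c' t)"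
  have Q': "(Q has_vector_derivative Q') (at t within {0..1})"
    unfolding Q_def Q'_def by (intro derivative_intros d)
  have Qt: "unitary (Q t)" "c' t = act (Q t) (c t)"
    using Q[OF t] by auto
  \<comment> \<open>The velocity of \<open>Q\<close> translated back to the identity, where
    unitarity makes it skew-Hermitian.\<close>
  define W where "W = (Q t)\<^sup>H ** Q'"
  have "(Q t)\<^sup>H ** Q' + Q'\<^sup>H ** Q t = 0"
    by (rule has_vector_derivative_unique_01[OF has_vector_derivative_matrix_mult[OF
            has_vector_derivative_ctranspose[OF Q'] Q'] has_vector_derivative_const t])
       (use Q in simp)
  then have skew: "skew W"
    by (simp add: W_def skew_def ctranspose_simps add_eq_0_iff2)
  have QH: "Q'\<^sup>H = - (W ** (Q t)\<^sup>H)"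
  proof -
    have "Q'\<^sup>H = W\<^sup>H ** (Q t)\<^sup>H"
      using Qt(1) by (simp add: W_def ctranspose_mult matrix_assoc)
    then show ?thesis
      using skew by (simp add: skew_def matrix_ring)
  qed
  have QW: "Q' = Q t ** W"
    using Qt(1) by (simp add: W_def)
  have "((\<lambda>t. (fst (c t) ** Q t, (Q t)\<^sup>H ** (snd (c t) ** Q t))) has_vector_derivative
      (fst (c t) ** Q' + fst v ** Q t,
       (Q t)\<^sup>H ** (snd (c t) ** Q' + snd v ** Q t) + Q'\<^sup>H ** (snd (c t) ** Q t))) (at t within {0..1})"
    by (intro derivative_intros d Q')
  also have "(fst (c t) ** Q' + fst v ** Q t,
       (Q t)\<^sup>H ** (snd (c t) ** Q' + snd v ** Q t) + Q'\<^sup>H ** (snd (c t) ** Q t))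
      = act (Q t) v + vert (c' t) W"
    unfolding Qt(2) QH using Qt(1) by (simp add: act_def vert_def QW matrix_ring matrix_assoc)
  finally have "v' = act (Q t) v + vert (c' t) W"
    by (rule has_vector_derivative_unique_01[OF v' _ t]) (use Q in \<open>simp add: act_def matrix_assoc\<close>)
  then have "v' - act (Q t) v = vert (c' t) W"
    by simp
  then have "v' - act (Q t) v \<in> vertical (c' t)"
    using vertical_eq[OF c'[OF t]] skew by auto
  then show ?thesis
    using that Qt by blast
qed

text \<open>For any other lift, the horizontal part of the velocity is the transported
  \<open>h\<close>, and the action is isometric. The speed is thus independent of the lift, as the
  definite description in \<open>quot_speed\<close> requires.\<close>

lemma quot_speed_eq:
  fixes c :: "real \<Rightarrow> ('p::finite, 'k::finite) point"
  assumes \<alpha>: "0 < \<alpha>" and \<beta>: "- \<alpha> / real CARD('k) < \<beta>"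
    and c: "\<And>t. t \<in> {0..1} \<Longrightarrow> c t \<in> total_space"
    and v: "(c has_vector_derivative v) (at t within {0..1})" and t: "t \<in> {0..1}"
    and h: "h \<in> horizontal \<alpha> \<beta> (c t)" "v - h \<in> vertical (c t)"
  shows "quot_speed \<alpha> \<beta> (\<lambda>t. quot_proj (c t)) t = sqrt (riem_metric \<alpha> \<beta> (c t) h h)"
  unfolding quot_speed_def
proof (rule the_equality)
  have "quot_metric \<alpha> \<beta> (c t) v v = riem_metric \<alpha> \<beta> (c t) h h"
    by (simp add: quot_metric_def horizontal_part_eqI[OF \<alpha> \<beta> c[OF t] h])
  then show "\<exists>c' v'. (\<forall>\<tau>\<in>{0..1}. c' \<tau> \<in> total_space \<and> quot_proj (c' \<tau>) = quot_proj (c \<tau>)) \<and>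
       (c' has_vector_derivative v') (at t within {0..1}) \<and>
       sqrt (riem_metric \<alpha> \<beta> (c t) h h) = sqrt (quot_metric \<alpha> \<beta> (c' t) v' v')"
    using c v by (intro exI[of _ c] exI[of _ v]) auto
next
  fix r
  assume "\<exists>c' v'. (\<forall>\<tau>\<in>{0..1}. c' \<tau> \<in> total_space \<and> quot_proj (c' \<tau>) = quot_proj (c \<tau>)) \<and>
       (c' has_vector_derivative v') (at t within {0..1}) \<and> r = sqrt (quot_metric \<alpha> \<beta> (c' t) v' v')"
  then obtain c' v' where c': "\<And>\<tau>. \<tau> \<in> {0..1} \<Longrightarrow> c' \<tau> \<in> total_space"
    "\<And>\<tau>. \<tau> \<in> {0..1} \<Longrightarrow> quot_proj (c \<tau>) = quot_proj (c' \<tau>)"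
    and v': "(c' has_vector_derivative v') (at t within {0..1})"
    and r: "r = sqrt (quot_metric \<alpha> \<beta> (c' t) v' v')"
    by force
  obtain Q where Q: "unitary Q" "c' t = act Q (c t)" "v' - act Q v \<in> vertical (c' t)"
    by (rule lift_change[of c c', OF _ _ _ v v' t]) (use c c' that in blast)+
  have "act Q h \<in> horizontal \<alpha> \<beta> (c' t)"
    unfolding Q(2) by (rule act_horizontal[OF c[OF t] Q(1) h(1)])
  moreover have "(v' - act Q v) + act Q (v - h) \<in> vertical (c' t)"
    using Q h(2) by (intro subspace_add[OF subspace_vertical[OF c'(1)[OF t]]]) (simp_all add: act_vertical[OF c[OF t]])
  then have "v' - act Q h \<in> vertical (c' t)"
    by (simp add: act_diff)
  ultimately have "horizontal_part \<alpha> \<beta> (c' t) v' = act Q h"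
    by (rule horizontal_part_eqI[OF \<alpha> \<beta> c'(1)[OF t]])
  then show "r = sqrt (riem_metric \<alpha> \<beta> (c t) h h)"
    by (simp add: r quot_metric_def Q(2) riem_metric_act[OF c[OF t] Q(1)])
qed

theorem quot_length_of_lift:
  fixes c :: "real \<Rightarrow> ('p::finite, 'k::finite) point"
  assumes \<alpha>: "0 < \<alpha>" and \<beta>: "- \<alpha> / real CARD('k) < \<beta>"
    and c: "\<And>t. t \<in> {0..1} \<Longrightarrow> c t \<in> total_space"
    and v: "\<And>t. t \<in> {0..1} \<Longrightarrow> (c has_vector_derivative v t) (at t within {0..1})"
    and v_cont: "continuous_on {0..1} v"
    and speed: "\<And>t. t \<in> {0..1} \<Longrightarrow> riem_metric \<alpha> \<beta> (c t) (v t) (v t) = e"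
  defines "\<gamma> \<equiv> \<lambda>t. quot_proj (c t)"
  shows "quot_speed \<alpha> \<beta> \<gamma> integrable_on {0..1}" (is ?int)
    and "(quot_length \<alpha> \<beta> \<gamma>)\<^sup>2 \<le> e" (is ?le)
    and "(quot_length \<alpha> \<beta> \<gamma>)\<^sup>2 = e \<longleftrightarrow> (\<forall>t\<in>{0..1}. v t \<in> horizontal \<alpha> \<beta> (c t))" (is ?iff)
proof -
  have c_cont: "continuous_on {0..1} c"
    by (rule continuous_on_vector_derivative[OF v])
  have v_tangent: "v t \<in> total_tangent (c t)" if "t \<in> {0..1}" for t
    by (rule derivative_total_tangent[OF c v[OF that] that])
  obtain h where h_cont: "continuous_on {0..1} h"
    and h: "\<And>t. t \<in> {0..1} \<Longrightarrow> h t \<in> horizontal \<alpha> \<beta> (c t)"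
      "\<And>t. t \<in> {0..1} \<Longrightarrow> v t - h t \<in> vertical (c t)"
    by (rule horizontal_decomposition[OF \<alpha> \<beta> c_cont _ v_cont]) (use c v_tangent that in blast)+
  define f where "f t = riem_metric \<alpha> \<beta> (c t) (h t) (h t)" for t
  have nonneg: "0 \<le> riem_metric \<alpha> \<beta> (c t) \<xi> \<xi>" if "t \<in> {0..1}" "\<xi> \<in> total_tangent (c t)" for t \<xi>
    using riem_metric_pos[OF \<alpha> \<beta> c[OF that(1)] that(2)]
    by (cases "\<xi> = 0") (auto simp: riem_metric_linear less_imp_le)
  have f0: "0 \<le> f t" if "t \<in> {0..1}" for t
    unfolding f_def using h(1)[OF that] by (intro nonneg[OF that]) (simp add: horizontal_def)
  \<comment> \<open>The vertical remainder is orthogonal to \<open>h t\<close>, so the constant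
    \<open>e\<close> is the sum of the horizontal and the vertical squared speeds.\<close>
  have pythagoras: "e = f t + riem_metric \<alpha> \<beta> (c t) (v t - h t) (v t - h t)" if t: "t \<in> {0..1}" for t
  proof -
    have "riem_metric \<alpha> \<beta> (c t) (h t) (v t - h t) = 0"
      using h[OF t] by (simp add: horizontal_def)
    then show ?thesis
      using speed[OF t] riem_metric_sym[of \<alpha> \<beta> "c t" "h t" "v t"]
      by (simp add: f_def riem_metric_linear)
  qed
  have w_tangent: "v t - h t \<in> total_tangent (c t)" if "t \<in> {0..1}" for t
    using h(2)[OF that] vertical_subset_tangent[OF c[OF that]] by blast
  have f_le: "f t \<le> e" if "t \<in> {0..1}" for t
    using pythagoras[OF that] nonneg[OF that w_tangent[OF that]] by simp
  have f_eq: "f t = e \<longleftrightarrow> v t \<in> horizontal \<alpha> \<beta> (c t)" if t: "t \<in> {0..1}" for t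
  proof
    assume "f t = e"
    then have "riem_metric \<alpha> \<beta> (c t) (v t - h t) (v t - h t) = 0"
      using pythagoras[OF t] by simp
    then have "v t - h t = 0"
      using riem_metric_pos[OF \<alpha> \<beta> c[OF t] w_tangent[OF t]] by fastforce
    then show "v t \<in> horizontal \<alpha> \<beta> (c t)"
      using h(1)[OF t] by simp
  next
    assume "v t \<in> horizontal \<alpha> \<beta> (c t)"
    then have "v t = h t"
      using horizontal_part_eqI[OF \<alpha> \<beta> c[OF t], of "v t" "v t"] horizontal_part_eqI[OF \<alpha> \<beta> c[OF t] h[OF t]]
        subspace_0[OF subspace_vertical[OF c[OF t]]] by simp
    then show "f t = e"
      using speed[OF t] by (simp add: f_def)
  qed
  have e0: "0 \<le> e"
    using f0[of 0] f_le[of 0] by simp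
  have qs: "quot_speed \<alpha> \<beta> \<gamma> t = sqrt (f t)" if t: "t \<in> {0..1}" for t
    unfolding \<gamma>_def f_def by (rule quot_speed_eq[OF \<alpha> \<beta> c v[OF t] t h[OF t]])
  have f_cont: "continuous_on {0..1} (\<lambda>t. sqrt (f t))"
    unfolding f_def by (intro continuous_intros c_cont h_cont c)
  then have int: "(\<lambda>t. sqrt (f t)) integrable_on {0..1}"
    by (rule integrable_continuous_interval)
  then show ?int
    by (rule integrable_eq) (simp add: qs)
  have len: "quot_length \<alpha> \<beta> \<gamma> = integral {0..1} (\<lambda>t. sqrt (f t))"
    unfolding quot_length_def by (intro integral_cong qs)
  have len0: "0 \<le> quot_length \<alpha> \<beta> \<gamma>"
    unfolding len by (intro integral_nonneg int) (simp add: f0)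
  have diff: "integral {0..1} (\<lambda>t. sqrt e - sqrt (f t)) = sqrt e - quot_length \<alpha> \<beta> \<gamma>"
    unfolding len by (subst integral_diff) (auto intro: int)
  have diff0: "0 \<le> sqrt e - sqrt (f t)" if "t \<in> {0..1}" for t
    using f_le[OF that] by simp
  have "0 \<le> sqrt e - quot_length \<alpha> \<beta> \<gamma>"
    unfolding diff[symmetric] by (intro integral_nonneg integrable_diff int diff0) auto
  then have "(quot_length \<alpha> \<beta> \<gamma>)\<^sup>2 \<le> (sqrt e)\<^sup>2"
    using len0 by (intro power_mono) auto
  then show ?le
    using e0 by simp
  have "(quot_length \<alpha> \<beta> \<gamma>)\<^sup>2 = e \<longleftrightarrow> quot_length \<alpha> \<beta> \<gamma> = sqrt e"
    using len0 e0 by (metis real_sqrt_abs real_sqrt_pow2 abs_of_nonneg)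
  also have "\<dots> \<longleftrightarrow> integral {0..1} (\<lambda>t. sqrt e - sqrt (f t)) = 0"
    unfolding diff by auto
  \<comment> \<open>A continuous nonnegative integrand with integral zero vanishes everywhere, which
    gives horizontality at every time and not only almost everywhere.\<close>
  also have "\<dots> \<longleftrightarrow> (\<forall>t\<in>{0..1}. sqrt e - sqrt (f t) = 0)"
    by (rule integral_eq_0_iff) (use diff0 in \<open>auto intro!: continuous_intros f_cont\<close>)
  also have "\<dots> \<longleftrightarrow> (\<forall>t\<in>{0..1}. v t \<in> horizontal \<alpha> \<beta> (c t))"
    using f_eq by (simp add: eq_commute[of e])
  finally show ?iff .
qed

section \<open>The lifted curve\<close>

lemma has_vector_derivative_rdg:
  assumes "\<And>i. ((\<lambda>t. f t i) has_real_derivative f' i) (at t)"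
  shows "((\<lambda>t. rdg (f t)) has_vector_derivative rdg f') (at t)"
proof -
  have sum: "rdg h = (\<Sum>i\<in>UNIV. h i *\<^sub>R dg (\<lambda>j. if j = i then 1 else 0))" for h :: "'a \<Rightarrow> real"
    by (auto simp: vec_eq_iff dg_nth if_distrib[of "\<lambda>z. _ * z"] scaleR_conv_of_real[where 'a = complex] cong: if_cong)
  have "((\<lambda>t. f t i *\<^sub>R dg (\<lambda>j. if j = i then 1 else 0)) has_vector_derivative
      f' i *\<^sub>R dg (\<lambda>j. if j = i then 1 else 0)) (at t)" for i
    using has_vector_derivative_scaleR[OF assms has_vector_derivative_const, of i "dg (\<lambda>j. if j = i then 1 else 0)"] by simp
  then show ?thesis
    unfolding sum by (intro has_vector_derivative_sum)
qed

lemma dg_0: "dg (\<lambda>i. 0) = 0"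
  by (simp add: vec_eq_iff dg_nth)

lemma trace_spectral: "unitary Q \<Longrightarrow> trace (Q ** rdg d ** Q\<^sup>H) = of_real (\<Sum>i\<in>UNIV. d i)"
  using trace_unitary_conj[of Q "rdg d"] by (simp add: matrix_assoc trace_dg)

text \<open>With \<open>X = U ** Q\<close> and \<open>Z\<close> the part of \<open>U' ** Q'\<close>
  orthogonal to the columns of \<open>U\<close>, one has \<open>X\<^sup>H ** X = mat 1\<close> and
  \<open>X\<^sup>H ** Z = 0\<close>, and \<open>Z\<^sup>H ** Z\<close> is diagonal with the squared
  sines. Every claim becomes a scalar identity for each angle.\<close>

lemma geo_U_facts:
  fixes U U' :: "complex^'k^'p"
  assumes U: "U\<^sup>H ** U = mat 1" "U'\<^sup>H ** U' = mat 1" and svd: "cos_svd (U\<^sup>H ** U') Q \<Theta> Q'"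
  defines "V \<equiv> geo_U U U' Q \<Theta> Q'"
  obtains V1 H where "hermitian H"
    "\<And>t. (V t)\<^sup>H ** V t = mat 1"
    "\<And>t. (V has_vector_derivative V1 t) (at t)"
    "\<And>t. (V1 has_vector_derivative - (V t ** H)) (at t)"
    "\<And>t. (V t)\<^sup>H ** V1 t = 0"
    "\<And>t. (norm (V1 t))\<^sup>2 = (norm \<Theta>)\<^sup>2"
proof -
  obtain \<theta> where Q: "unitary Q" "unitary Q'" and \<Theta>: "\<Theta> = rdg \<theta>"
    and \<theta>: "\<And>i. 0 \<le> \<theta> i" "\<And>i. \<theta> i \<le> pi / 2"
    and A: "U\<^sup>H ** U' = Q ** rdg (\<lambda>i. cos (\<theta> i)) ** Q'\<^sup>H"
    using cos_svdE[OF svd] by blast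
  \<comment> \<open>The pseudo-inverse of the sines fails to be an inverse only at zero angles,
    where the curve does not move in that direction.\<close>
  have sin_0: "\<theta> i = 0" if "sin (\<theta> i) = 0" for i
  proof (rule ccontr)
    assume "\<theta> i \<noteq> 0"
    then have "0 < sin (\<theta> i)"
      using \<theta>[of i] pi_gt_zero by (intro sin_gt_zero) linarith+
    with that show False by simp
  qed
  define X where "X = U ** Q"
  define Z where "Z = (mat 1 - U ** U\<^sup>H) ** U' ** Q'"
  have Z_eq: "Z = U' ** Q' - U ** (U\<^sup>H ** U') ** Q'"
    by (simp add: Z_def matrix_ring matrix_assoc)
  have XX: "X\<^sup>H ** X = mat 1"
    using Q by (simp add: X_def ctranspose_mult matrix_assoc inverse_cancel[OF U(1)])
  have XZ: "X\<^sup>H ** Z = 0"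
    by (simp add: X_def Z_eq ctranspose_mult matrix_assoc matrix_ring inverse_cancel[OF U(1)])
  have ZX: "Z\<^sup>H ** X = 0"
    using arg_cong[OF XZ, of ctranspose] by (simp only: ctranspose_simps ctranspose_ctranspose)
  have ZZ: "Z\<^sup>H ** Z = rdg (\<lambda>i. (sin (\<theta> i))\<^sup>2)"
  proof -
    have "Z\<^sup>H ** Z = Q'\<^sup>H ** (U'\<^sup>H ** U' - (U\<^sup>H ** U')\<^sup>H ** (U\<^sup>H ** U')) ** Q'"
      by (simp add: Z_eq ctranspose_simps matrix_assoc matrix_ring inverse_cancel[OF U(1)])
    also have "\<dots> = mat 1 - rdg (\<lambda>i. (cos (\<theta> i))\<^sup>2)"
      unfolding U(2) A using Q by (simp add: ctranspose_mult matrix_assoc matrix_ring power2_eq_square)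
    also have "\<dots> = rdg (\<lambda>i. (sin (\<theta> i))\<^sup>2)"
      by (auto simp: vec_eq_iff dg_nth mat_def sin_squared_eq)
    finally show ?thesis .
  qed
  \<comment> \<open>This family contains \<open>V\<close> and is closed under differentiation in the
    coefficients; by \<open>gram\<close>, its mutual products are all diagonalised by
    \<open>Q\<close>.\<close>
  define N where "N a b = (X ** rdg a + Z ** rdg b) ** Q\<^sup>H" for a b :: "'k \<Rightarrow> real"
  have gram: "(N a b)\<^sup>H ** N a' b' = Q ** rdg (\<lambda>i. a i * a' i + b i * b' i * (sin (\<theta> i))\<^sup>2) ** Q\<^sup>H" for a b a' b'
  proof -
    have "(X ** rdg a + Z ** rdg b)\<^sup>H ** (X ** rdg a' + Z ** rdg b') =
        rdg a ** (X\<^sup>H ** X) ** rdg a' + rdg a ** (X\<^sup>H ** Z) ** rdg b'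
        + (rdg b ** (Z\<^sup>H ** X) ** rdg a' + rdg b ** (Z\<^sup>H ** Z) ** rdg b')"
      by (simp add: ctranspose_simps matrix_ring matrix_assoc)
    also have "\<dots> = rdg (\<lambda>i. a i * a' i + b i * b' i * (sin (\<theta> i))\<^sup>2)"
      unfolding XX XZ ZX ZZ by (simp add: matrix_ring dg_add mult_ac)
    finally have *: "(X ** rdg a + Z ** rdg b)\<^sup>H ** (X ** rdg a' + Z ** rdg b') =
        rdg (\<lambda>i. a i * a' i + b i * b' i * (sin (\<theta> i))\<^sup>2)" .
    have "(N a b)\<^sup>H ** N a' b' = Q ** ((X ** rdg a + Z ** rdg b)\<^sup>H ** (X ** rdg a' + Z ** rdg b')) ** Q\<^sup>H"
      unfolding N_def ctranspose_mult[of _ "Q\<^sup>H"] ctranspose_ctranspose by (simp only: matrix_assoc)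
    then show ?thesis
      unfolding * .
  qed
  have deriv: "((\<lambda>t. N (a t) (b t)) has_vector_derivative N a' b') (at t)"
    if "\<And>i. ((\<lambda>t. a t i) has_real_derivative a' i) (at t)" "\<And>i. ((\<lambda>t. b t i) has_real_derivative b' i) (at t)"
    for a b a' b' and t :: real
    unfolding N_def using has_vector_derivative_rdg[of a a' t] has_vector_derivative_rdg[of b b' t] that
    by (auto intro!: derivative_eq_intros simp: matrix_ring)
  let ?a = "\<lambda>t i. cos (t * \<theta> i)" and ?b = "\<lambda>t i. sin (t * \<theta> i) * inverse (sin (\<theta> i))"
  let ?a1 = "\<lambda>t i. - \<theta> i * sin (t * \<theta> i)" and ?b1 = "\<lambda>t i. \<theta> i * cos (t * \<theta> i) * inverse (sin (\<theta> i))"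
  \<comment> \<open>All coefficients solve f'' = - \<theta>^2 f, so the acceleration of the curve is
    \<open>- (V t ** H)\<close> with the squared angles collected in \<open>H\<close>.\<close>
  define H where "H = Q ** rdg (\<lambda>i. (\<theta> i)\<^sup>2) ** Q\<^sup>H"
  have V: "V t = N (?a t) (?b t)" for t
  proof -
    have t\<Theta>: "t *\<^sub>R \<Theta> = rdg (\<lambda>i. t * \<theta> i)"
      by (simp add: \<Theta> dg_scaleR scaleR_conv_of_real[where 'a = complex])
    show ?thesis
      unfolding V_def geo_U_def t\<Theta> unfolding \<Theta> diag_apply_rdg pinv_rdg
      by (simp add: N_def X_def Z_def matrix_ring matrix_assoc mult.commute)
  qed
  define V1 where "V1 t = N (?a1 t) (?b1 t)" for t
  show ?thesis
  proof
    show "hermitian H"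
      unfolding H_def by (rule hermitian_spectral_form)
    fix t
    have cancel: "inverse (sin (\<theta> i)) * sin (\<theta> i) = 1 \<or> \<theta> i = 0" for i
      using sin_0 by (cases "sin (\<theta> i) = 0") auto
    \<comment> \<open>The squared sine from \<open>Z\<^sup>H ** Z\<close> cancels the two
      pseudo-inverse entries, except at zero angles, which are treated separately.\<close>
    have gram_entry: "\<theta> i = 0 \<or> (r * inverse (sin (\<theta> i))) * (q * inverse (sin (\<theta> i))) * (sin (\<theta> i))\<^sup>2 = r * q"
      for i r q
    proof -
      have "(r * inverse (sin (\<theta> i))) * (q * inverse (sin (\<theta> i))) * (sin (\<theta> i))\<^sup>2
          = r * q * (inverse (sin (\<theta> i)) * sin (\<theta> i))\<^sup>2"
        by (simp only: power2_eq_square mult_ac)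
      then show ?thesis
        using cancel[of i] by auto
    qed
    have "(?a t i) * (?a t i) + ?b t i * ?b t i * (sin (\<theta> i))\<^sup>2 = 1" for i
    proof (cases "\<theta> i = 0")
      case False
      then have e: "?b t i * ?b t i * (sin (\<theta> i))\<^sup>2 = sin (t * \<theta> i) * sin (t * \<theta> i)"
        using gram_entry by blast
      show ?thesis
        unfolding e using sin_cos_squared_add2[of "t * \<theta> i"] by (simp add: power2_eq_square)
    qed simp
    then show "(V t)\<^sup>H ** V t = mat 1"
      unfolding V gram using Q by simp
    show "(V has_vector_derivative V1 t) (at t)"
      unfolding V[abs_def] V1_def by (rule deriv) (auto intro!: derivative_eq_intros)
    have "N (\<lambda>i. - (\<theta> i)\<^sup>2 * ?a t i) (\<lambda>i. - (\<theta> i)\<^sup>2 * ?b t i) = - (V t ** H)"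
    proof -
      have "rdg (\<lambda>i. - (\<theta> i)\<^sup>2 * f i) = - (rdg f ** rdg (\<lambda>i. (\<theta> i)\<^sup>2))" for f :: "'k \<Rightarrow> real"
        by (auto simp: vec_eq_iff dg_nth)
      then show ?thesis
        unfolding V N_def H_def \<open>\<And>f. rdg (\<lambda>i. - (\<theta> i)\<^sup>2 * f i) = - (rdg f ** rdg (\<lambda>i. (\<theta> i)\<^sup>2))\<close> using Q by (simp add: matrix_ring matrix_assoc)
    qed
    moreover have "(V1 has_vector_derivative N (\<lambda>i. - (\<theta> i)\<^sup>2 * ?a t i) (\<lambda>i. - (\<theta> i)\<^sup>2 * ?b t i)) (at t)"
      unfolding V1_def
      by (rule deriv) (auto intro!: derivative_eq_intros simp: power2_eq_square)
    ultimately show "(V1 has_vector_derivative - (V t ** H)) (at t)"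
      by simp
    have "?a t i * ?a1 t i + ?b t i * ?b1 t i * (sin (\<theta> i))\<^sup>2 = 0" for i
      using gram_entry[of i "sin (t * \<theta> i)" "\<theta> i * cos (t * \<theta> i)"] by auto
    then show "(V t)\<^sup>H ** V1 t = 0"
      unfolding V V1_def gram by (simp only: dg_0 matrix_ring of_real_0)
    have "?a1 t i * ?a1 t i + ?b1 t i * ?b1 t i * (sin (\<theta> i))\<^sup>2 = (\<theta> i)\<^sup>2" for i
    proof (cases "\<theta> i = 0")
      case False
      then have e: "?b1 t i * ?b1 t i * (sin (\<theta> i))\<^sup>2 = (\<theta> i * cos (t * \<theta> i)) * (\<theta> i * cos (t * \<theta> i))"
        using gram_entry by blast
      have "?a1 t i * ?a1 t i + (\<theta> i * cos (t * \<theta> i)) * (\<theta> i * cos (t * \<theta> i))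
          = (\<theta> i)\<^sup>2 * ((cos (t * \<theta> i))\<^sup>2 + (sin (t * \<theta> i))\<^sup>2)"
        by algebra
      then show ?thesis
        unfolding e by simp
    qed simp
    then have "(V1 t)\<^sup>H ** V1 t = Q ** rdg (\<lambda>i. (\<theta> i)\<^sup>2) ** Q\<^sup>H"
      unfolding V1_def gram by simp
    then have "Re (trace ((V1 t)\<^sup>H ** V1 t)) = (\<Sum>i\<in>UNIV. (\<theta> i)\<^sup>2)"
      using trace_spectral[OF Q(1)] by (simp only: Re_complex_of_real)
    then show "(norm (V1 t))\<^sup>2 = (norm \<Theta>)\<^sup>2"
      using power2_norm_eq_inner[of "V1 t"] by (simp only: \<Theta> norm_rdg Re_trace_ctranspose_mult)
  qed
qed

text \<open>The derivative of the power of \<open>?M\<close> is that power times its logarithm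
  \<open>L\<close>. Carrying \<open>L\<close> past the right factor \<open>P\<close> gives the
  constant \<open>B = R ** L ** P\<close>, which is similar to \<open>L\<close> and hence has the
  same traces.\<close>

lemma geo_\<Sigma>_facts:
  assumes h: "hpd \<Sigma>" "hpd \<Sigma>'" and Q: "unitary Q" "unitary Q'"
  defines "S \<equiv> geo_\<Sigma> \<Sigma> \<Sigma>' Q Q'" and "L \<equiv> mlog (whitened \<Sigma> \<Sigma>' Q Q')"
  obtains B where "\<And>t. hpd (S t)" "\<And>t. (S has_vector_derivative S t ** B) (at t)"
    "Re (trace (B ** B)) = (norm L)\<^sup>2" "trace B = trace L"
proof
  let ?M = "whitened \<Sigma> \<Sigma>' Q Q'"
  define P R where defs: "P = mpow \<Sigma> (1/2)" "R = mpow \<Sigma> (-1/2)"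
  have PR: "P\<^sup>H = P" "P ** R = mat 1" "R ** P = mat 1"
    using h(1) unfolding defs by (blast intro: mpow_half)+
  note M = hpd_whitened[OF h Q]
  obtain A m where A: "unitary A" and m: "\<And>i. 0 < m i" and M_eq: "?M = A ** rdg m ** A\<^sup>H"
    using hpd_spectral[OF M] by blast
  have S: "S t = P ** mpow ?M t ** P" for t
    by (simp only: S_def geo_\<Sigma>_def whitened_def defs)
  have L: "L = A ** rdg (\<lambda>i. ln (m i)) ** A\<^sup>H"
    unfolding L_def M_eq by (rule mlog_spectral[OF A m])
  have S_eq: "S t = P ** (A ** rdg (\<lambda>i. m i powr t) ** A\<^sup>H) ** P" for t
    unfolding S M_eq mpow_spectral[OF A m] ..
  let ?B = "R ** L ** P"
  show "hpd (S t)" for t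
    using hpd_congruence[OF hpd_mpow[OF M, of t] hpd_invertible[OF hpd_mpow[OF h(1), of "1/2"]]]
    unfolding S defs[symmetric] PR(1) .
  show "(S has_vector_derivative S t ** ?B) (at t)" for t
  proof -
    have "((\<lambda>t. m i powr t) has_real_derivative m i powr t * ln (m i)) (at t)" for i
      using m[of i] by (auto intro!: derivative_eq_intros)
    from has_vector_derivative_rdg[OF this]
    have "((\<lambda>t. P ** (A ** rdg (\<lambda>i. m i powr t) ** A\<^sup>H) ** P) has_vector_derivative
        P ** (A ** rdg (\<lambda>i. m i powr t * ln (m i)) ** A\<^sup>H) ** P) (at t)"
      by (auto intro!: derivative_eq_intros simp: matrix_ring)
    moreover have "P ** (A ** rdg (\<lambda>i. m i powr t * ln (m i)) ** A\<^sup>H) ** P = S t ** ?B"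
      unfolding S_eq L using A by (simp add: matrix_assoc inverse_cancel[OF PR(2)])
    ultimately show ?thesis
      unfolding S_eq[abs_def] by simp
  qed
  have "L\<^sup>H = L"
    unfolding L_def by (intro hermitian_eqD hermitian_mlog M)
  then have "(norm L)\<^sup>2 = Re (trace (L ** L))"
    using Re_trace_ctranspose_mult[of L L] by (simp add: power2_norm_eq_inner)
  moreover have "trace (?B ** ?B) = trace (L ** L)"
    using trace_mul_sym[of R "L ** (L ** P)"]
    by (simp add: matrix_assoc inverse_cancel[OF PR(2)] PR(2))
  ultimately show "Re (trace (?B ** ?B)) = (norm L)\<^sup>2"
    by simp
  show "trace ?B = trace L"
    using trace_mul_sym[of R "L ** P"] by (simp add: matrix_assoc PR(2))
qed

lemma geo_lift_facts:
  fixes U U' :: "complex^'k^'p"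
  assumes \<alpha>: "0 < \<alpha>" and \<beta>: "- \<alpha> / real CARD('k) < \<beta>"
    and x: "(U, \<Sigma>) \<in> total_space" and y: "(U', \<Sigma>') \<in> total_space"
    and svd: "cos_svd (U\<^sup>H ** U') Q \<Theta> Q'"
  defines "c \<equiv> geo_lift U \<Sigma> U' \<Sigma>' Q \<Theta> Q'" and "v \<equiv> div_formula \<alpha> \<beta> \<Sigma> \<Sigma>' Q \<Theta> Q'"
  shows "geodesic total_space (riem_metric \<alpha> \<beta>) c"
    and "(curve_length (riem_metric \<alpha> \<beta>) c)\<^sup>2 = v"
    and "quot_speed \<alpha> \<beta> (\<lambda>t. quot_proj (c t)) integrable_on {0..1}"
    and "(quot_length \<alpha> \<beta> (\<lambda>t. quot_proj (c t)))\<^sup>2 \<le> v"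
    and "(quot_length \<alpha> \<beta> (\<lambda>t. quot_proj (c t)))\<^sup>2 = v \<longleftrightarrow>
      (\<forall>t\<in>{0..1}. velocity c t \<in> horizontal \<alpha> \<beta> (c t))"
proof -
  have h: "hpd \<Sigma>" "hpd \<Sigma>'" and U: "U\<^sup>H ** U = mat 1" "U'\<^sup>H ** U' = mat 1"
    using x y by (auto simp: total_space_iff)
  have Q: "unitary Q" "unitary Q'"
    using svd by (auto simp: cos_svd_def)
  let ?L = "mlog (whitened \<Sigma> \<Sigma>' Q Q')"
  define V S where "V = geo_U U U' Q \<Theta> Q'" and "S = geo_\<Sigma> \<Sigma> \<Sigma>' Q Q'"
  obtain V1 H where facts_V: "hermitian H" "\<And>t. (V t)\<^sup>H ** V t = mat 1"
    "\<And>t. (V has_vector_derivative V1 t) (at t)"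
    "\<And>t. (V1 has_vector_derivative - (V t ** H)) (at t)"
    "\<And>t. (V t)\<^sup>H ** V1 t = 0" and norm_V1: "\<And>t. (norm (V1 t))\<^sup>2 = (norm \<Theta>)\<^sup>2"
    by (rule geo_U_facts[OF U svd, folded V_def]) (rule that)
  obtain B where facts_S: "\<And>t. hpd (S t)" "\<And>t. (S has_vector_derivative S t ** B) (at t)"
    and B: "Re (trace (B ** B)) = (norm ?L)\<^sup>2" "trace B = trace ?L"
    by (rule geo_\<Sigma>_facts[OF h Q, folded S_def]) (rule that)
  interpret product_geodesic V V1 S B H
    by standard (use facts_V facts_S in \<open>auto simp: total_space_iff\<close>)
  have c: "c = curve"
    by (simp add: c_def geo_lift_def V_def S_def fun_eq_iff)
  have v_eq: "(norm (V1 t))\<^sup>2 + \<alpha> * Re (trace (B ** B)) + \<beta> * (Re (trace B))\<^sup>2 = v" for t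
    using norm_V1[of t] by (simp add: B v_def div_formula_whitened[OF h Q])
  have v0: "0 \<le> v"
    unfolding v_def by (rule div_formula_nonneg[OF \<alpha> \<beta> x y svd])
  show "geodesic total_space (riem_metric \<alpha> \<beta>) c"
    unfolding c by (rule geodesic)
  show "(curve_length (riem_metric \<alpha> \<beta>) c)\<^sup>2 = v"
    unfolding c by (rule curve_length[OF v_eq v0])
  have speed_v: "riem_metric \<alpha> \<beta> (curve t) (curve' t) (curve' t) = v" for t
    unfolding speed by (rule v_eq)
  have cont: "continuous_on {0..1} curve'"
    by (intro continuous_intros continuous_on_curve)
  note quot = quot_length_of_lift[OF \<alpha> \<beta> total has_vector_derivative_curve cont speed_v]
  show "quot_speed \<alpha> \<beta> (\<lambda>t. quot_proj (c t)) integrable_on {0..1}"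
    "(quot_length \<alpha> \<beta> (\<lambda>t. quot_proj (c t)))\<^sup>2 \<le> v"
    unfolding c by (rule quot)+
  show "(quot_length \<alpha> \<beta> (\<lambda>t. quot_proj (c t)))\<^sup>2 = v \<longleftrightarrow>
      (\<forall>t\<in>{0..1}. velocity c t \<in> horizontal \<alpha> \<beta> (c t))"
    unfolding c quot(3) using velocity_curve by simp
qed

text \<open>The value of \<open>d\<close> is tied to arbitrary data only where the polar factor is
  unique. The quotient length ignores vertical velocity, so it is compared with the formula by an
  inequality together with its exact case of equality.\<close>

theorem proposition6:
  fixes \<alpha> \<beta> :: real
  assumes "CARD('k::finite) < CARD('p::finite)"
    and "0 < \<alpha>"
    and "- \<alpha> / real CARD('k) < \<beta>"
  shows
    "(\<exists>d :: ('p, 'k) point set \<Rightarrow> ('p, 'k) point set \<Rightarrow> real. svd_divergence \<alpha> \<beta> d) \<and>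
     (\<forall>d :: ('p, 'k) point set \<Rightarrow> ('p, 'k) point set \<Rightarrow> real.
        svd_divergence \<alpha> \<beta> d \<longrightarrow>
          symmetric_divergence_on quot_manifold d \<and>
          (\<forall>U \<Sigma> U' \<Sigma>' Q \<Theta> Q'.
             (U, \<Sigma>) \<in> total_space \<and> (U', \<Sigma>') \<in> total_space \<and>
             cos_svd (U\<^sup>H ** U') Q \<Theta> Q' \<and> invertible (U\<^sup>H ** U') \<longrightarrow>
             d (quot_proj (U, \<Sigma>)) (quot_proj (U', \<Sigma>')) = div_formula \<alpha> \<beta> \<Sigma> \<Sigma>' Q \<Theta> Q')) \<and>
     (\<forall>(U :: complex^'k^'p) \<Sigma> U' \<Sigma>' Q \<Theta> Q'.
        (U, \<Sigma>) \<in> total_space \<and> (U', \<Sigma>') \<in> total_space \<and> cos_svd (U\<^sup>H ** U') Q \<Theta> Q' \<longrightarrow>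
        (let c = geo_lift U \<Sigma> U' \<Sigma>' Q \<Theta> Q';
             \<gamma> = (\<lambda>t. quot_proj (c t));
             v = div_formula \<alpha> \<beta> \<Sigma> \<Sigma>' Q \<Theta> Q'
         in geodesic total_space (riem_metric \<alpha> \<beta>) c \<and>
            (curve_length (riem_metric \<alpha> \<beta>) c)\<^sup>2 = v \<and>
            quot_speed \<alpha> \<beta> \<gamma> integrable_on {0..1} \<and>
            (quot_length \<alpha> \<beta> \<gamma>)\<^sup>2 \<le> v \<and>
            ((quot_length \<alpha> \<beta> \<gamma>)\<^sup>2 = v \<longleftrightarrow>
               (\<forall>t\<in>{0..1}. velocity c t \<in> horizontal \<alpha> \<beta> (c t)))))"
proof (intro conjI allI impI)
  show "\<exists>d :: ('p, 'k) point set \<Rightarrow> ('p, 'k) point set \<Rightarrow> real. svd_divergence \<alpha> \<beta> d"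
    by (rule svd_divergence_exists)
next
  fix d :: "('p, 'k) point set \<Rightarrow> ('p, 'k) point set \<Rightarrow> real"
  assume d: "svd_divergence \<alpha> \<beta> d"
  show "symmetric_divergence_on quot_manifold d"
    by (rule svd_divergence_symmetric[OF assms(2,3) d])
  fix U U' :: "complex^'k^'p" and \<Sigma> \<Sigma>' Q \<Theta> Q'
  assume "(U, \<Sigma>) \<in> total_space \<and> (U', \<Sigma>') \<in> total_space \<and>
    cos_svd (U\<^sup>H ** U') Q \<Theta> Q' \<and> invertible (U\<^sup>H ** U')"
  then show "d (quot_proj (U, \<Sigma>)) (quot_proj (U', \<Sigma>')) = div_formula \<alpha> \<beta> \<Sigma> \<Sigma>' Q \<Theta> Q'"
    using svd_divergence_eq[OF d] by blast
next
  fix U :: "complex^'k^'p" and \<Sigma> U' \<Sigma>' Q \<Theta> Q'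
  assume *: "(U, \<Sigma>) \<in> total_space \<and> (U', \<Sigma>') \<in> total_space \<and> cos_svd (U\<^sup>H ** U') Q \<Theta> Q'"
  show "let c = geo_lift U \<Sigma> U' \<Sigma>' Q \<Theta> Q';
             \<gamma> = (\<lambda>t. quot_proj (c t));
             v = div_formula \<alpha> \<beta> \<Sigma> \<Sigma>' Q \<Theta> Q'
         in geodesic total_space (riem_metric \<alpha> \<beta>) c \<and>
            (curve_length (riem_metric \<alpha> \<beta>) c)\<^sup>2 = v \<and>
            quot_speed \<alpha> \<beta> \<gamma> integrable_on {0..1} \<and>
            (quot_length \<alpha> \<beta> \<gamma>)\<^sup>2 \<le> v \<and>
            ((quot_length \<alpha> \<beta> \<gamma>)\<^sup>2 = v \<longleftrightarrow>
               (\<forall>t\<in>{0..1}. velocity c t \<in> horizontal \<alpha> \<beta> (c t)))"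
    unfolding Let_def using * by (intro conjI geo_lift_facts[OF assms(2,3)]) auto
qed

end
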